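(* Let $(V,E,\mathbf 1_r)$ be a root-reward tree. There exists $\epsilon_0\in(0,1)$, which may be taken to be $|V|^{-2|B|-1}/4$, such that, for $\epsilon\in(0,\epsilon_0)$, $\lambda>0$ and $v\in O$, the set of gameplay processes (counter evolutions $X:\{0,\dots,F\}\to V$, identified by their laws) governed by Nash equilibria in $\mathrm{Game}(\epsilon,\lambda,v)$ is $\{X_\theta:\theta\in\Theta\}$, where $X_\theta(0)=v$.
   Context: A root-reward tree $(V,E,\mathbf 1_r)$ consists of a finite rooted tree $(V,E)$ whose root $r$ is a leaf; $B$ (the boundary) is the set of all leaves (including $r$), $B^*=B\setminus\{r\}$, $O=V\setminus B$ (the field of open play) is non-empty, and the payment function is $p=\mathbf 1_r:B\to\{0,1\}$. Write $u\sim v$ for adjacency. $d_{\rm out}(v)$ is the minimum length of a path from $v$ to $B^*$ each of whose edges leads away from $r$. For $v\ne r$, $v_+$ is the parent of $v$ (the neighbour closer to $r$). For $v\in V\setminus B^*$, $\mathcal V_-(v)$ is the set of children $u$ of $v$ with $d_{\rm out}(u)=d_{\rm out}(v)-1$. $\Theta$ is the set of maps $\theta:(0,\infty)\times O\times\{0,1,2,\dots\}\to V$ with $\theta(\lambda,v,i)\in\mathcal V_-(v)$ for each $v\in O$. For $\theta\in\Theta$, $X_\theta=X_\theta(\epsilon,\lambda,\cdot)$ is the Markov process with $X_\theta(0)=v$ such that, whenever $X_\theta(k)\in O$: $X_\theta(k+1)=X_\theta(k)$ with probability $1-\epsilon$; $X_\theta(k+1)=(X_\theta(k))_+$ with probability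 $\epsilon\frac{\lambda}{1+\lambda}$; $X_\theta(k+1)=\theta(\lambda,X_\theta(k),k)$ with probability $\epsilon\frac1{1+\lambda}$. It is stopped on arrival at $B$, at time $F_\theta=\min\{j\ge0:X_\theta(j)\in B\}$. The game $\mathrm{Game}(\epsilon,\lambda,v)$: $\epsilon\in(0,1]$ is the move probability, $\lambda\in[0,\infty)$ is Maxine's initial fortune (Mina's fortune at the start of every turn is one unit), and $v\in O$. Set $\lambda_0=\lambda$, $X_0=v$. At turn $i\ge1$, with Maxine's fortune equal to $\lambda_{i-1}$ and the counter at $X_{i-1}\in O$: (a) Maxine stakes $a_{i-1}\in[0,\lambda_{i-1}]$ and Mina stakes $b_{i-1}\in[0,1]$; stakes are not returned, and Maxine's relative fortune becomes $\lambda_i=\frac{\lambda_{i-1}-a_{i-1}}{1-b_{i-1}}$ (with value $\infty$, meaning that Mina alone is bankrupt, if only the denominator vanishes); currency is revalued so that Mina again has one unit. (b) With probability $1-\epsilon$ no move takes place and $X_i=X_{i-1}$. (c) Otherwise Maxine wins the turn with probability $\frac{a_{i-1}}{a_{i-1}+b_{i-1}}$, and Mina wins it otherwise. The winner moves the counter to a neighbour $X_i\sim X_{i-1}$ of her choice. All coins are independent. The game ends at $F=\min\{i\ge1:X_i\in B\}$; remaining reserves are swept away and Mina pays Maxine $\mathrm{Pay}=p(X_F)$. If the counter never reaches $B$, then $\mathrm{Pay}=1$. Conventions: if $a_{i-1}=b_{i-1}=0$, Maxine's win probability is $\lambda_{i-1}/(1+\lambda_{i-1})$; if both $\lambda_{i-1}-a_{i-1}$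 and $1-b_{i-1}$ vanish, $\lambda_i$ is set equal to $\lambda_{i-1}$. Let $\mathcal P[0,\infty)$ be the space of probability measures on $[0,\infty)$, viewed as a metric space under total variation distance and endowed with the Borel $\sigma$-algebra of this metric. A (mixed) strategy for Maxine is a pair of measurable maps: a stake map $s_+:[0,\infty)\times O\times\{1,2,\dots\}\to\mathcal P[0,\infty)$, such that the supremum of the support of $s_+(x,w,i)$ is at most $x$, and a move map $m_+:[0,\infty)\times O\times\{1,2,\dots\}\to V$ with $m_+(x,w,i)\sim w$. At turn $i$ she takes $a_{i-1}$ to be an independent sample of the law $s_+(\lambda_{i-1},X_{i-1},i)$ and nominates the move $m_+(\lambda_i,X_{i-1},i)$, which she makes if she wins the turn. A mixed strategy for Mina is a pair $(s_-,m_-)$ of the same kind, except that the supremum of the support of $s_-(x,w,i)$ is at most one; she samples $b_{i-1}$ from $s_-(\lambda_{i-1},X_{i-1},i)$ and nominates $m_-(\lambda_i,X_{i-1},i)$. Let $\mathcal S_+,\mathcal S_-$ be the spaces of mixed strategies of Maxine and Mina, and let $M(\epsilon,\lambda,v,S_-,S_+)$ be the mean of $\mathrm{Pay}$ in $\mathrm{Game}(\epsilon,\lambda,v)$ played under $(S_-,S_+)$. A pair $(S_-,S_+)\in\mathcal S_-\times\mathcal S_+$ is a Nash equilibrium if, for all initial data $(\lambda,v)\in[0,\infty)\times O$, $M(\epsilon,\lambda,v,S_-',S_+)\ge M(\epsilon,\lambda,v,S_-,S_+)\ge M(\epsilon,\lambda,v,S_-,S_+')$ for every $S_-'\in\mathcal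 S_-$ and $S_+'\in\mathcal S_+$.
   Formalization: Stake maps are measurable for the σ-algebra on P[0,∞) generated by the evaluations μ ↦ μ(A), not the Borel σ-algebra of total variation; with the latter, x ↦ δ_{εx} is not measurable and already the path r–v–b has no Nash equilibrium. *)

theory Defs
  imports "HOL-Probability.Probability"
begin

section \<open>Rooted trees\<close>

record 'v rooted_graph =
  verts :: "'v set"
  edges :: "'v set set"
  rootv :: 'v

definition adj :: "'v rooted_graph \<Rightarrow> 'v \<Rightarrow> 'v \<Rightarrow> bool" where
  "adj T u v \<longleftrightarrow> {u, v} \<in> edges T"

definition is_path :: "'v rooted_graph \<Rightarrow> 'v list \<Rightarrow> bool" where
  "is_path T p \<longleftrightarrow> p \<noteq> [] \<and> set p \<subseteq> verts T \<and> distinct p \<and> successively (adj T) p"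

definition is_tree :: "'v rooted_graph \<Rightarrow> bool" where
  "is_tree T \<longleftrightarrow>
     (\<forall>e\<in>edges T. \<exists>u\<in>verts T. \<exists>v\<in>verts T. u \<noteq> v \<and> e = {u, v}) \<and>
     (\<forall>u\<in>verts T. \<forall>v\<in>verts T. \<exists>p. is_path T p \<and> hd p = u \<and> last p = v) \<and>
     \<not> (\<exists>p. is_path T p \<and> 3 \<le> length p \<and> adj T (last p) (hd p))"

definition boundary :: "'v rooted_graph \<Rightarrow> 'v set" where
  "boundary T = {v \<in> verts T. card {u. adj T v u} = 1}"

definition open_play :: "'v rooted_graph \<Rightarrow> 'v set" where
  "open_play T = verts T - boundary T"

definition root_reward_tree :: "'v rooted_graph \<Rightarrow> bool" where
  "root_reward_tree T \<longleftrightarrow>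
     finite (verts T) \<and> is_tree T \<and> rootv T \<in> boundary T \<and> open_play T \<noteq> {}"

definition payment :: "'v rooted_graph \<Rightarrow> 'v \<Rightarrow> real" where
  "payment T = indicator {rootv T}"

definition gdist :: "'v rooted_graph \<Rightarrow> 'v \<Rightarrow> 'v \<Rightarrow> nat" where
  "gdist T u v = (LEAST n. \<exists>p. is_path T p \<and> hd p = u \<and> last p = v \<and> length p = Suc n)"

text \<open>The edge from \<open>u\<close> to \<open>w\<close> leads away from the root, i.e. \<open>w\<close> is a child of \<open>u\<close>.\<close>

definition away :: "'v rooted_graph \<Rightarrow> 'v \<Rightarrow> 'v \<Rightarrow> bool" where
  "away T u w \<longleftrightarrow> adj T u w \<and> gdist T (rootv T) u < gdist T (rootv T) w"

definition parent :: "'v rooted_graph \<Rightarrow> 'v \<Rightarrow> 'v" where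
  "parent T v = (THE u. away T u v)"

definition d_out :: "'v rooted_graph \<Rightarrow> 'v \<Rightarrow> nat" where
  "d_out T v = (LEAST n. \<exists>p. is_path T p \<and> successively (away T) p \<and>
     hd p = v \<and> last p \<in> boundary T - {rootv T} \<and> length p = Suc n)"

definition V_minus :: "'v rooted_graph \<Rightarrow> 'v \<Rightarrow> 'v set" where
  "V_minus T v = {u. away T v u \<and> Suc (d_out T u) = d_out T v}"


section \<open>Laws of processes\<close>

text \<open>
  The law, on the space of sequences, of the Markov chain that starts at \<open>x0\<close> and whose
  transition from time \<open>k\<close> to time \<open>k + 1\<close> is given by the kernel \<open>K k\<close>, as constructed by the
  Ionescu-Tulcea theorem. Processes stopped at a time \<open>F\<close> are encoded by sequences that
  remain constant from time \<open>F\<close> on.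
\<close>

definition chain_steps ::
    "'s measure \<Rightarrow> 's \<Rightarrow> (nat \<Rightarrow> 's \<Rightarrow> 's measure) \<Rightarrow> nat \<Rightarrow> (nat \<Rightarrow> 's) \<Rightarrow> 's measure" where
  "chain_steps S x0 K n \<omega> = (case n of 0 \<Rightarrow> return S x0 | Suc k \<Rightarrow> K k (\<omega> k))"

definition chain_law ::
    "'s measure \<Rightarrow> 's \<Rightarrow> (nat \<Rightarrow> 's \<Rightarrow> 's measure) \<Rightarrow> (nat \<Rightarrow> 's) measure" where
  "chain_law S x0 K =
     projective_family.lim UNIV (Ionescu_Tulcea.CI (chain_steps S x0 K) (\<lambda>_. S)) (\<lambda>_. S)"

text \<open>
  The position of the counter after a turn that begins with the counter at \<open>w\<close>, where a move
  takes place with probability \<open>\<epsilon>\<close> and Maxine is then the one to move with probability \<open>q\<close>;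
  \<open>u\<close> and \<open>d\<close> are the moves of Maxine and Mina.
\<close>

definition turn_pmf :: "real \<Rightarrow> real \<Rightarrow> 'v \<Rightarrow> 'v \<Rightarrow> 'v \<Rightarrow> 'v pmf" where
  "turn_pmf \<epsilon> q w u d =
     bind_pmf (bernoulli_pmf \<epsilon>) (\<lambda>move. bind_pmf (bernoulli_pmf q) (\<lambda>maxine.
       return_pmf (if move then if maxine then u else d else w)))"


section \<open>The processes \<open>X\<^sub>\<theta>\<close>\<close>

definition Theta :: "'v rooted_graph \<Rightarrow> (real \<Rightarrow> 'v \<Rightarrow> nat \<Rightarrow> 'v) set" where
  "Theta T = {\<theta>. \<forall>lam>0. \<forall>v\<in>open_play T. \<forall>i. \<theta> lam v i \<in> V_minus T v}"

definition theta_kernel ::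
    "'v rooted_graph \<Rightarrow> real \<Rightarrow> real \<Rightarrow> (real \<Rightarrow> 'v \<Rightarrow> nat \<Rightarrow> 'v) \<Rightarrow> nat \<Rightarrow> 'v \<Rightarrow> 'v measure" where
  "theta_kernel T \<epsilon> lam \<theta> k w =
     measure_pmf (if w \<in> open_play T
                  then turn_pmf \<epsilon> (lam / (1 + lam)) w (parent T w) (\<theta> lam w k)
                  else return_pmf w)"

definition theta_law ::
    "'v rooted_graph \<Rightarrow> real \<Rightarrow> real \<Rightarrow> 'v \<Rightarrow> (real \<Rightarrow> 'v \<Rightarrow> nat \<Rightarrow> 'v) \<Rightarrow> (nat \<Rightarrow> 'v) measure" where
  "theta_law T \<epsilon> lam v \<theta> = chain_law (count_space UNIV) v (theta_kernel T \<epsilon> lam \<theta>)"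


section \<open>Mixed strategies\<close>

abbreviation halfline :: "real measure" where
  "halfline \<equiv> restrict_space borel {0..}"

definition msupport :: "real measure \<Rightarrow> real set" where
  "msupport \<mu> = {x. 0 \<le> x \<and> (\<forall>U. open U \<longrightarrow> x \<in> U \<longrightarrow> 0 < emeasure \<mu> (U \<inter> {0..}))}"

text \<open>
  A mixed strategy is a pair of a stake map and a move map. The fortune argument of a move map
  is the relative fortune after the stakes of the turn have been deducted, which may be
  \<open>\<infinity>\<close>, so the move map is defined there too. The largest stake available, when
  Maxine's fortune is \<open>x\<close>, is \<open>cap x\<close>.

  Measurability of the stake map refers to the \<open>\<sigma>\<close>-algebra that is generated by the evaluations
  \<open>\<mu> \<mapsto> \<mu> A\<close>. The Borel \<open>\<sigma>\<close>-algebra of the total variation metric is too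
  fine for this purpose: every set of Dirac masses is closed in that metric, so a map from
  \<open>x\<close> to the Dirac mass at \<open>c * x\<close>, with \<open>c > 0\<close>, is not measurable for it
  (consider the Dirac masses at the points of a set that is not Borel). Equilibrium stakes are
  of this kind: on the tree with one vertex in open play, Maxine stakes \<open>\<epsilon> * x\<close>.
\<close>

type_synonym 'v strategy =
  "(real \<Rightarrow> 'v \<Rightarrow> nat \<Rightarrow> real measure) \<times> (ennreal \<Rightarrow> 'v \<Rightarrow> nat \<Rightarrow> 'v)"

definition strategies :: "'v rooted_graph \<Rightarrow> (real \<Rightarrow> real) \<Rightarrow> 'v strategy set" where
  "strategies T cap = {(s, m).
     (\<lambda>(x, w, i). s x w i) \<in>
       measurable (halfline \<Otimes>\<^sub>M count_space (open_play T) \<Otimes>\<^sub>M count_space {1..})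
         (prob_algebra halfline) \<and>
     (\<forall>x\<ge>0. \<forall>w\<in>open_play T. \<forall>i\<ge>1. Sup (ereal ` msupport (s x w i)) \<le> ereal (cap x)) \<and>
     (\<lambda>(x, w, i). m x w i) \<in>
       measurable (borel \<Otimes>\<^sub>M count_space (open_play T) \<Otimes>\<^sub>M count_space {1..})
         (count_space (verts T)) \<and>
     (\<forall>x. \<forall>w\<in>open_play T. \<forall>i\<ge>1. adj T w (m x w i))}"

definition maxine_strategies :: "'v rooted_graph \<Rightarrow> 'v strategy set" where
  "maxine_strategies T = strategies T (\<lambda>x. x)"

definition mina_strategies :: "'v rooted_graph \<Rightarrow> 'v strategy set" where
  "mina_strategies T = strategies T (\<lambda>_. 1)"


section \<open>The game\<close>

definition next_fortune :: "real \<Rightarrow> real \<Rightarrow> real \<Rightarrow> ennreal" where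
  "next_fortune x a b =
     (if 1 - b = 0 then if x - a = 0 then ennreal x else \<infinity>
      else ennreal ((x - a) / (1 - b)))"

definition win_prob :: "real \<Rightarrow> real \<Rightarrow> real \<Rightarrow> real" where
  "win_prob x a b = (if a = 0 \<and> b = 0 then x / (1 + x) else a / (a + b))"

definition game_space :: "(ennreal \<times> 'v) measure" where
  "game_space = borel \<Otimes>\<^sub>M count_space UNIV"

text \<open>
  The state of the game is the pair of Maxine's relative fortune and the counter's position.
  Fortune \<open>\<infinity>\<close> means that Mina is bankrupt: her stake is zero from then on, so that Maxine wins
  every turn whatever she stakes (also when she stakes nothing, as \<open>x / (1 + x) \<rightarrow> 1\<close>), and
  the relative fortune remains \<open>\<infinity>\<close>.
\<close>

definition game_kernel ::
    "'v rooted_graph \<Rightarrow> real \<Rightarrow> 'v strategy \<Rightarrow> 'v strategy \<Rightarrow> nat \<Rightarrow>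
     ennreal \<times> 'v \<Rightarrow> (ennreal \<times> 'v) measure" where
  "game_kernel T \<epsilon> Sm Sp i = (\<lambda>(x, w).
     if w \<notin> open_play T then return game_space (x, w)
     else if x = \<infinity> then
       distr (measure_pmf (turn_pmf \<epsilon> 1 w (snd Sp \<infinity> w i) (snd Sm \<infinity> w i)))
         game_space (Pair \<infinity>)
     else
       fst Sp (enn2real x) w i \<bind> (\<lambda>a. fst Sm (enn2real x) w i \<bind> (\<lambda>b.
         let x' = next_fortune (enn2real x) a b in
         distr (measure_pmf (turn_pmf \<epsilon> (win_prob (enn2real x) a b) w
                 (snd Sp x' w i) (snd Sm x' w i)))
           game_space (Pair x'))))"

text \<open>Turn \<open>k + 1\<close> leads from time \<open>k\<close> to time \<open>k + 1\<close>.\<close>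

definition game_law ::
    "'v rooted_graph \<Rightarrow> real \<Rightarrow> real \<Rightarrow> 'v \<Rightarrow> 'v strategy \<Rightarrow> 'v strategy \<Rightarrow>
     (nat \<Rightarrow> ennreal \<times> 'v) measure" where
  "game_law T \<epsilon> lam v Sm Sp =
     chain_law game_space (ennreal lam, v) (\<lambda>k. game_kernel T \<epsilon> Sm Sp (Suc k))"

definition gameplay_law ::
    "'v rooted_graph \<Rightarrow> real \<Rightarrow> real \<Rightarrow> 'v \<Rightarrow> 'v strategy \<Rightarrow> 'v strategy \<Rightarrow> (nat \<Rightarrow> 'v) measure" where
  "gameplay_law T \<epsilon> lam v Sm Sp =
     distr (game_law T \<epsilon> lam v Sm Sp) (Pi\<^sub>M UNIV (\<lambda>_. count_space UNIV)) (\<lambda>\<omega> k. snd (\<omega> k))"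

definition Pay :: "'v rooted_graph \<Rightarrow> (nat \<Rightarrow> 'v) \<Rightarrow> real" where
  "Pay T X = (if \<exists>i\<ge>1. X i \<in> boundary T
              then payment T (X (LEAST i. 1 \<le> i \<and> X i \<in> boundary T)) else 1)"

definition mean_pay ::
    "'v rooted_graph \<Rightarrow> real \<Rightarrow> real \<Rightarrow> 'v \<Rightarrow> 'v strategy \<Rightarrow> 'v strategy \<Rightarrow> real" where
  "mean_pay T \<epsilon> lam v Sm Sp = (\<integral>X. Pay T X \<partial>gameplay_law T \<epsilon> lam v Sm Sp)"

definition nash_equilibrium ::
    "'v rooted_graph \<Rightarrow> real \<Rightarrow> 'v strategy \<Rightarrow> 'v strategy \<Rightarrow> bool" where
  "nash_equilibrium T \<epsilon> Sm Sp \<longleftrightarrow>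
     Sm \<in> mina_strategies T \<and> Sp \<in> maxine_strategies T \<and>
     (\<forall>lam\<ge>0. \<forall>v\<in>open_play T.
        (\<forall>Sm'\<in>mina_strategies T. mean_pay T \<epsilon> lam v Sm Sp \<le> mean_pay T \<epsilon> lam v Sm' Sp) \<and>
        (\<forall>Sp'\<in>maxine_strategies T. mean_pay T \<epsilon> lam v Sm Sp' \<le> mean_pay T \<epsilon> lam v Sm Sp))"

end

theory Submission
  imports Defs
begin

text \<open>
\<^bold>\<open>The value of the game.\<close> Let \<open>x\<close> be Maxine's fortune. Suppose that a move is won by Maxine with
probability \<open>x / (1 + x)\<close>, that she moves to the parent, and that Mina moves along a shortest path
to a leaf. From a vertex with \<open>d_out = k\<close> the counter then performs a gambler's walk: it reaches
the parent before a leaf with probability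
\<open>climb k x = 1 - 1 / (1 + x + \<dots> + x ^ k)\<close>. The root is reached from \<open>v\<close> with probability
\<open>h x v\<close>, the product of \<open>climb (d_out u) x\<close> over the vertices \<open>u \<noteq> r\<close> on the path from \<open>v\<close> to the
root. The theorem holds because \<open>h\<close> is the value of the game, and because each player has
exactly one optimal stake at every state with \<open>x > 0\<close>: a common fraction \<open>share v x = \<epsilon> / K\<close> of the two
fortunes, where \<open>K\<close> is a multiple of the derivative of \<open>h\<close> in \<open>x\<close>. Such stakes leave the relative
fortune unchanged, so that the counter moves as \<open>X\<^sub>\<theta>\<close> does. Maxine's optimal move is the parent,
and Mina's optimal moves are those to \<open>V_minus\<close>, which leaves the choice of \<open>\<theta>\<close>.

\<^bold>\<open>One turn.\<close> Suppose that the stakes \<open>a\<close>, \<open>b\<close> turn the fortune \<open>x\<close> into \<open>y\<close>. With the best moves the mean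
value after the turn is \<open>h y + \<epsilon> * D y * (a / (a + b) - y / (1 + y))\<close>, where \<open>D\<close> is the difference
between the values of the two moves. By Cauchy's mean value theorem, applied to \<open>h\<close> and
\<open>x / (1 + x)\<close>, the difference of this mean and \<open>h x\<close> is a common factor with the sign of
\<open>x - y\<close> times \<open>\<epsilon> * D y / W - D u * K u\<close>. Here \<open>u\<close> lies between \<open>x\<close> and \<open>y\<close>, and \<open>(1 + x) * W\<close> is the
total stake. The equilibrium stake makes the second factor vanish as \<open>y \<rightarrow> x\<close>. When one player
deviates, a relative change \<open>\<delta>\<close> of the fortune changes \<open>W\<close> by about \<open>\<delta>\<close>, which is to be compared
with \<open>W \<approx> s \<le> \<epsilon>\<close>. The factors \<open>D\<close> and \<open>K\<close> are built from polynomials of degree at most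
\<open>n = card V\<close>, a few for each of at most \<open>n\<close> levels, and lose a proportion of at most \<open>n ^ 5 * \<delta>\<close>. Since
\<open>4 * \<epsilon> * n ^ 5 \<le> 1\<close>, the change of \<open>W\<close> decides the sign, unless a player stakes so much
that \<open>\<delta> \<ge> \<epsilon>\<close>. Such a deviation costs her more than the turn can yield, because the
counter moves with probability \<open>\<epsilon>\<close> only. Hence each deviation strictly hurts the deviating player
(\<open>maxine_turn\<close>, \<open>mina_turn\<close>; with the moves, \<open>staked_val_upper\<close> and \<open>staked_val_lower\<close>).

\<^bold>\<open>The whole game.\<close> Along the game \<open>h\<close> is therefore a supermartingale if Mina plays her equilibrium
strategy, and a submartingale if Maxine plays hers. As \<open>h\<close> is bounded by the indicator
of the complement of the leaves other than \<open>r\<close>, Maxine secures \<open>h\<close> (\<open>lower_pay\<close>). For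
Mina, unfinished games are the difficulty, because they pay Maxine one unit. While the fortune is
bounded, Mina's share is bounded away from zero and she wins enough consecutive moves
with a probability bounded below, so an unfinished game has a large fortune at late times,
where \<open>h\<close> is nearly one anyway (\<open>bounded_fortune_vanishes\<close>, \<open>upper_pay\<close>).

\<^bold>\<open>Uniqueness.\<close> Let \<open>(Sm, Sp)\<close> be a Nash equilibrium. Replacing one of the strategies by
an equilibrium strategy of the above form gives mean payment \<open>h\<close> again, so the martingale
inequality is an equality at all times in the two resulting games. The strict one-turn
inequalities then fix the stakes and the moves at every state that is reached. By induction on
time, the states reached in these two games, in the game played under \<open>(Sm, Sp)\<close> and by \<open>X\<^sub>\<theta>\<close> are
the same (\<open>joint_law\<close>, \<open>gameplay_is_theta\<close>). Conversely each \<open>\<theta>\<close> may serve as Mina's move map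
(\<open>theta_is_gameplay\<close>).
\<close>

section \<open>The probability of climbing one level\<close>

definition geo :: "nat \<Rightarrow> real \<Rightarrow> real" where
  "geo k x = (\<Sum>i\<le>k. x ^ i)"

definition dgeo :: "nat \<Rightarrow> real \<Rightarrow> real" where
  "dgeo k x = (\<Sum>i<k. real (Suc i) * x ^ i)"

text \<open>The probability that a walk on \<open>{0..k + 1}\<close> which steps upwards with probability
  \<open>x / (1 + x)\<close> and starts at \<open>k\<close> arrives at \<open>k + 1\<close> before \<open>0\<close>.\<close>

definition climb :: "nat \<Rightarrow> real \<Rightarrow> real" where
  "climb k x = 1 - 1 / geo k x"

lemma geo_0 [simp]: "geo 0 x = 1"
  by (simp add: geo_def)

lemma geo_Suc: "geo (Suc k) x = geo k x + x ^ Suc k"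
  by (simp add: geo_def)

lemma geo_Suc': "geo (Suc k) x = 1 + x * geo k x"
  unfolding geo_def by (subst sum.atMost_Suc_shift) (simp add: sum_distrib_left)

lemma geo_pred: "1 \<le> k \<Longrightarrow> geo k x = 1 + x * geo (k - 1) x"
  by (metis geo_Suc' Suc_diff_1 less_eq_Suc_le One_nat_def)

lemma geo_ge_1: "0 \<le> x \<Longrightarrow> 1 \<le> geo k x"
  by (induction k) (auto simp: geo_Suc intro: add_increasing2)

lemma geo_pos: "0 \<le> x \<Longrightarrow> 0 < geo k x"
  using geo_ge_1[of x k] by linarith

lemma geo_mono: "0 \<le> y \<Longrightarrow> y \<le> x \<Longrightarrow> geo k y \<le> geo k x"
  unfolding geo_def by (intro sum_mono power_mono)

lemma geo_mono_index: "0 \<le> x \<Longrightarrow> j \<le> k \<Longrightarrow> geo j x \<le> geo k x"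
  unfolding geo_def by (intro sum_mono2) auto

lemma geo_strict_mono_index: "0 < x \<Longrightarrow> j < k \<Longrightarrow> geo j x < geo k x"
  using geo_mono_index[of x "Suc j" k] zero_less_power[of x "Suc j"] geo_Suc[of j x]
  by linarith

lemma has_real_derivative_geo: "(geo k has_real_derivative dgeo k x) (at x)"
proof -
  have "((\<lambda>x. \<Sum>i\<le>k. x ^ i) has_real_derivative (\<Sum>i\<le>k. real i * x ^ (i - 1))) (at x)"
    by (auto intro!: derivative_eq_intros)
  moreover have "(\<Sum>i\<le>k. real i * x ^ (i - 1)) = dgeo k x"
    unfolding dgeo_def by (cases k) (simp_all add: sum.atMost_Suc_shift lessThan_Suc_atMost del: sum.atMost_Suc)
  ultimately show ?thesis by (simp add: geo_def[abs_def])
qed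

text \<open>The logarithmic derivative of the polynomial is at most \<open>(A + n) / (1 + u)\<close>: the assumption on
  consecutive coefficients bounds the derivative by \<open>A\<close> times the polynomial, and the degree bounds
  \<open>u\<close> times the derivative by \<open>n\<close> times the polynomial. Growth bounds by powers of
  \<open>(1 + y) / (1 + x)\<close> become relative losses \<open>1 - m * \<delta>\<close> in the estimate of a turn.\<close>

lemma poly_growth:
  fixes c :: "nat \<Rightarrow> real"
  assumes c: "\<And>i. 0 \<le> c i" and step: "\<And>i. i < n \<Longrightarrow> real (Suc i) * c (Suc i) \<le> real A * c i"
    and yx: "0 \<le> y" "y \<le> x"
  shows "(\<Sum>i\<le>n. c i * x ^ i) * ((1 + y) / (1 + x)) ^ (A + n) \<le> (\<Sum>i\<le>n. c i * y ^ i)"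
proof -
  define P where "P = (\<lambda>x::real. \<Sum>i\<le>n. c i * x ^ i)"
  define P' where "P' = (\<lambda>x::real. \<Sum>i\<le>n. c i * (real i * x ^ (i - 1)))"
  let ?N = "A + n"
  have der: "(P has_real_derivative P' u) (at u)" for u
    unfolding P_def P'_def by (auto intro!: derivative_eq_intros sum.cong simp: mult_ac)
  have bound: "P' u * (1 + u) \<le> real ?N * P u" if u: "0 \<le> u" for u
  proof -
    have "P' u = (\<Sum>i<n. real (Suc i) * c (Suc i) * u ^ i)"
      unfolding P'_def by (cases n) (simp_all add: sum.atMost_Suc_shift lessThan_Suc_atMost algebra_simps del: sum.atMost_Suc)
    also have "\<dots> \<le> (\<Sum>i<n. real A * c i * u ^ i)"
      using step u by (intro sum_mono mult_right_mono) auto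
    also have "\<dots> \<le> (\<Sum>i\<le>n. real A * c i * u ^ i)"
      using c u by (intro sum_mono2) auto
    finally have 1: "P' u \<le> real A * P u"
      by (simp add: P_def sum_distrib_left mult.assoc)
    have "P' u * u = (\<Sum>i\<le>n. real i * (c i * u ^ i))"
      unfolding P'_def sum_distrib_right
    proof (intro sum.cong refl)
      fix i show "c i * (real i * u ^ (i - 1)) * u = real i * (c i * u ^ i)"
        by (cases i) (auto simp: algebra_simps)
    qed
    also have "\<dots> \<le> (\<Sum>i\<le>n. real n * (c i * u ^ i))"
      using c u by (intro sum_mono mult_right_mono) auto
    finally have 2: "P' u * u \<le> real n * P u"
      by (simp add: P_def sum_distrib_left)
    from 1 2 show ?thesis by (simp add: algebra_simps)
  qed
  have "P x / (1 + x) ^ ?N \<le> P y / (1 + y) ^ ?N"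
  proof (rule DERIV_nonpos_imp_nonincreasing[of y x "\<lambda>u. P u / (1 + u) ^ ?N"])
    show "y \<le> x" by fact
    fix u assume "y \<le> u" "u \<le> x"
    with yx have u: "0 \<le> u" by simp
    have "((\<lambda>u. P u / (1 + u) ^ ?N) has_real_derivative
        (P' u * (1 + u) ^ ?N - P u * (real ?N * (1 + u) ^ (?N - 1))) / ((1 + u) ^ ?N * (1 + u) ^ ?N)) (at u)"
      using u by (auto intro!: derivative_eq_intros der)
    moreover have "(P' u * (1 + u) ^ ?N - P u * (real ?N * (1 + u) ^ (?N - 1))) \<le> 0"
    proof (cases "?N")
      case 0
      with bound[OF u] u have "P' u \<le> 0"
        by (simp add: mult_le_0_iff)
      with 0 show ?thesis by simp
    next
      case (Suc N)
      have "P' u * (1 + u) ^ ?N - P u * (real ?N * (1 + u) ^ (?N - 1))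
         = (P' u * (1 + u) - real ?N * P u) * (1 + u) ^ N"
        unfolding Suc by (simp add: algebra_simps)
      also have "\<dots> \<le> 0"
        using bound[OF u] u by (intro mult_nonpos_nonneg) auto
      finally show ?thesis .
    qed
    ultimately show "\<exists>d. ((\<lambda>u. P u / (1 + u) ^ ?N) has_real_derivative d) (at u) \<and> d \<le> 0"
      using u by (intro exI conjI) (auto intro!: divide_nonpos_nonneg)
  qed
  then have "P x * (1 + y) ^ ?N / (1 + x) ^ ?N \<le> P y"
    using yx by (simp add: field_simps)
  then show ?thesis by (simp add: P_def power_divide)
qed

lemma geo_growth:
  assumes "0 \<le> y" "y \<le> x"
  shows "geo k x * ((1 + y) / (1 + x)) ^ (2 * k) \<le> geo k y"
  using poly_growth[of "\<lambda>_. 1" k k y x] assms by (simp add: geo_def mult_2)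

lemma dgeo_growth:
  assumes "0 \<le> y" "y \<le> x"
  shows "dgeo k x * ((1 + y) / (1 + x)) ^ (2 * k) \<le> dgeo k y"
proof (cases k)
  case 0 then show ?thesis by (simp add: dgeo_def)
next
  case (Suc j)
  have "(\<Sum>i\<le>j. real (Suc i) * x ^ i) * ((1 + y) / (1 + x)) ^ (k + j) \<le> (\<Sum>i\<le>j. real (Suc i) * y ^ i)"
    using assms Suc by (intro poly_growth) (auto simp del: of_nat_Suc intro!: mult_right_mono)
  moreover have "dgeo k u = (\<Sum>i\<le>j. real (Suc i) * u ^ i)" for u
    by (simp add: dgeo_def Suc lessThan_Suc_atMost)
  ultimately have 1: "dgeo k x * ((1 + y) / (1 + x)) ^ (k + j) \<le> dgeo k y" by simp
  have "dgeo k x * ((1 + y) / (1 + x)) ^ (2 * k) \<le> dgeo k x * ((1 + y) / (1 + x)) ^ (k + j)"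
    using assms Suc by (intro mult_left_mono power_decreasing) (auto simp: dgeo_def simp del: sum.lessThan_Suc of_nat_Suc intro!: sum_nonneg)
  with 1 show ?thesis by simp
qed

text \<open>Both \<open>geo 1 x / (1 + x) = 1\<close> and the increments \<open>x ^ (k + 1) / (1 + x)\<close> are nondecreasing in \<open>x\<close>.\<close>

lemma geo_over_1_mono:
  assumes "1 \<le> k" "0 \<le> y" "y \<le> x"
  shows "geo k y * (1 + x) \<le> geo k x * (1 + y)"
  using assms(1)
proof (induction k rule: dec_induct)
  case base
  have "geo 1 z = 1 + z" for z using geo_Suc[of 0 z] by simp
  then show ?case by (metis mult.commute order_refl)
next
  case (step k)
  have "y * (1 + x) * y ^ k \<le> x * (1 + y) * x ^ k"
  proof (rule mult_mono)
    show "y * (1 + x) \<le> x * (1 + y)" using assms by (simp add: algebra_simps)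
    show "y ^ k \<le> x ^ k" using assms by (intro power_mono)
  qed (use assms in auto)
  with step.IH show ?case by (simp add: geo_Suc algebra_simps)
qed

lemma power_cross:
  fixes x u :: real
  assumes "0 \<le> x" "x \<le> u" "i \<le> j"
  shows "x ^ j * u ^ i \<le> u ^ j * x ^ i"
proof -
  have "x ^ j * u ^ i = x ^ (j - i) * (x ^ i * u ^ i)"
    using assms(3) by (metis mult.assoc le_add_diff_inverse2 power_add)
  also have "\<dots> \<le> u ^ (j - i) * (x ^ i * u ^ i)"
    using assms by (intro mult_right_mono power_mono) auto
  also have "\<dots> = u ^ j * x ^ i"
    using assms(3) by (metis mult.assoc mult.commute le_add_diff_inverse2 power_add)
  finally show ?thesis .
qed

lemma geo_ratio_mono:
  assumes "b \<le> a" "0 \<le> x" "x \<le> u"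
  shows "geo a x * geo b u \<le> geo a u * geo b x"
  using assms(1)
proof (induction a rule: dec_induct)
  case base then show ?case by (simp add: mult.commute)
next
  case (step a)
  have "x ^ Suc a * geo b u \<le> u ^ Suc a * geo b x"
    unfolding geo_def sum_distrib_left using step assms
    by (intro sum_mono power_cross) auto
  with step.IH show ?case by (simp add: geo_Suc algebra_simps)
qed

text \<open>The mean of the law on \<open>{0..k}\<close> with weights proportional to \<open>x ^ i\<close>. It grows with \<open>x\<close>, as the
  weights move to the right.\<close>

definition tilt :: "nat \<Rightarrow> real \<Rightarrow> real" where
  "tilt k x = x * dgeo k x / geo k x"

lemma tilt_num: "x * dgeo k x = (\<Sum>i\<le>k. real i * x ^ i)"
  unfolding dgeo_def sum_distrib_left
  by (cases k) (simp_all add: sum.atMost_Suc_shift lessThan_Suc_atMost algebra_simps del: sum.atMost_Suc)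

lemma tilt_mono:
  assumes x: "0 \<le> x" "x \<le> u"
  shows "tilt k x \<le> tilt k u"
proof -
  have "(x * dgeo k x) * geo k u \<le> (u * dgeo k u) * geo k x"
    unfolding tilt_num
  proof (induction k)
    case 0 then show ?case by simp
  next
    case (Suc k)
    let ?N = "\<lambda>x. \<Sum>i\<le>k. real i * x ^ i"
    let ?k = "Suc k"
    \<comment> \<open>the new terms of the cross product, after passing from k to k + 1\<close>
    have "0 \<le> (\<Sum>j\<le>k. (real ?k - real j) * (u ^ ?k * x ^ j - x ^ ?k * u ^ j))"
      using x by (intro sum_nonneg mult_nonneg_nonneg) (auto simp del: power_Suc intro!: power_cross)
    also have "\<dots> = real ?k * u ^ ?k * geo k x + ?N u * x ^ ?k - real ?k * x ^ ?k * geo k u - ?N x * u ^ ?k"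
      unfolding geo_def sum_distrib_left sum_distrib_right sum.distrib[symmetric] sum_subtractf[symmetric]
      by (intro sum.cong refl) (simp only: algebra_simps)
    finally show ?case using Suc.IH by (simp add: geo_Suc algebra_simps)
  qed
  then show ?thesis
    using geo_pos[of x k] geo_pos[of u k] x by (simp add: tilt_def field_simps)
qed

lemma dgeo_pos: "1 \<le> k \<Longrightarrow> 0 \<le> x \<Longrightarrow> 0 < dgeo k x"
  unfolding dgeo_def
  by (rule sum_pos2[of _ 0]) auto

lemma dgeo_upper:
  assumes "1 \<le> k" "0 \<le> x"
  shows "(1 + x) * dgeo k x \<le> 2 * real k * geo k x"
proof -
  have "dgeo k x \<le> (\<Sum>i<k. real k * x ^ i)"
    unfolding dgeo_def using assms by (intro sum_mono mult_right_mono) auto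
  also have "\<dots> = real k * geo (k - 1) x"
    using assms by (simp add: geo_def sum_distrib_left lessThan_Suc_atMost[symmetric])
  finally have "(1 + x) * dgeo k x \<le> (1 + x) * (real k * geo (k - 1) x)"
    using assms by (intro mult_left_mono) auto
  also have "\<dots> = real k * (geo (k - 1) x + x * geo (k - 1) x)" by (simp add: algebra_simps)
  also have "\<dots> \<le> real k * (geo k x + geo k x)"
    using assms geo_mono_index[of x "k - 1" k] geo_pred[of k x]
    by (intro mult_left_mono add_mono) auto
  finally show ?thesis by (simp add: algebra_simps)
qed

lemma dgeo_lower:
  assumes "1 \<le> k" "0 \<le> x"
  shows "geo k x \<le> (1 + x) * dgeo k x"
proof -
  have "geo (k - 1) x = (\<Sum>i<k. 1 * x ^ i)"
    using assms by (simp add: geo_def lessThan_Suc_atMost[symmetric])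
  also have "\<dots> \<le> dgeo k x"
    unfolding dgeo_def using assms by (intro sum_mono mult_right_mono) auto
  finally have 1: "geo (k - 1) x \<le> dgeo k x" .
  have "geo k x = 1 + x * geo (k - 1) x" using geo_pred assms by simp
  also have "\<dots> \<le> dgeo k x + x * dgeo k x"
    using 1 geo_ge_1[of x "k - 1"] assms by (intro add_mono mult_left_mono) auto
  finally show ?thesis by (simp add: algebra_simps)
qed

lemma climb_0 [simp]: "climb 0 x = 0"
  by (simp add: climb_def)

lemma climb_at_0 [simp]: "climb k 0 = 0"
  by (cases k) (simp_all add: climb_def geo_Suc')

lemma climb_nonneg: "0 \<le> x \<Longrightarrow> 0 \<le> climb k x"
  using geo_ge_1[of x k] by (simp add: climb_def)

lemma climb_less_1: "0 \<le> x \<Longrightarrow> climb k x < 1"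
  using geo_pos[of x k] by (simp add: climb_def)

lemma climb_mono: "0 \<le> y \<Longrightarrow> y \<le> x \<Longrightarrow> climb k y \<le> climb k x"
  using geo_mono[of y x k] geo_pos[of y k] geo_pos[of x k]
  unfolding climb_def by (intro diff_left_mono frac_le) auto

lemma climb_strict_mono_index: "0 < x \<Longrightarrow> j < k \<Longrightarrow> climb j x < climb k x"
  using geo_strict_mono_index[of x j k] geo_pos[of x j] geo_pos[of x k]
  unfolding climb_def by (intro diff_strict_left_mono frac_less2) auto

lemma climb_mono_index: "0 \<le> x \<Longrightarrow> j \<le> k \<Longrightarrow> climb j x \<le> climb k x"
  using geo_mono_index[of x j k] geo_pos[of x j] geo_pos[of x k]
  unfolding climb_def by (intro diff_left_mono frac_le) auto

lemma climb_pos: "0 < x \<Longrightarrow> 1 \<le> k \<Longrightarrow> 0 < climb k x"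
  using climb_strict_mono_index[of x 0 k] by simp

lemma climb_eq: "1 \<le> k \<Longrightarrow> 0 \<le> x \<Longrightarrow> climb k x = x * geo (k - 1) x / geo k x"
  using geo_pos[of x k] geo_pred[of k x] by (simp add: climb_def field_simps)

lemma has_real_derivative_climb:
  assumes "0 \<le> x"
  shows "(climb k has_real_derivative dgeo k x / (geo k x)\<^sup>2) (at x)"
proof -
  have "((\<lambda>x. 1 - 1 / geo k x) has_real_derivative dgeo k x / (geo k x)\<^sup>2) (at x)"
    using geo_pos[of x k] assms
    by (auto intro!: derivative_eq_intros has_real_derivative_geo simp: power2_eq_square)
  then show ?thesis by (simp add: climb_def[abs_def])
qed

text \<open>Reversing the order of the coefficients gives
  \<open>climb k x = geo (k - 1) (1 / x) / geo k (1 / x)\<close>, and \<open>x / (1 + x)\<close> is \<open>1 / (1 + 1 / x)\<close>. So this is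
  the growth bound for \<open>geo k\<close> at the reciprocal fortunes.\<close>

lemma climb_growth:
  assumes k: "1 \<le> k" and "0 < u" "u \<le> y"
  shows "climb k y * ((u / (1 + u)) / (y / (1 + y))) ^ (2 * k) \<le> climb k u"
proof -
  have inv: "geo j x = x ^ j * geo j (1 / x)" if "0 < x" for x j
  proof -
    have "x ^ j * geo j (1 / x) = (\<Sum>i\<le>j. x ^ (j - i))"
      unfolding geo_def sum_distrib_left using that
      by (intro sum.cong) (auto simp: power_diff power_divide)
    also have "\<dots> = geo j x" unfolding geo_def
      by (rule sum.reindex_bij_witness[of _ "\<lambda>i. j - i" "\<lambda>i. j - i"]) auto
    finally show ?thesis ..
  qed
  have climb_inv: "climb k x = geo (k - 1) (1 / x) / geo k (1 / x)" if "0 < x" for x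
  proof -
    have "climb k x = x * x ^ (k - 1) * geo (k - 1) (1 / x) / (x ^ k * geo k (1 / x))"
      using that k climb_eq[of k x] inv[of x k] inv[of x "k - 1"] by simp
    also have "x * x ^ (k - 1) = x ^ k" using k by (metis Suc_diff_1 One_nat_def less_eq_Suc_le power_Suc)
    finally show ?thesis using that by simp
  qed
  define U Y where "U = 1 / u" and "Y = 1 / y"
  have UY: "0 \<le> Y" "Y \<le> U" "0 \<le> U" using assms by (auto simp: U_def Y_def frac_le)
  have r: "(u / (1 + u)) / (y / (1 + y)) = (1 + Y) / (1 + U)"
    using assms by (simp add: U_def Y_def field_simps)
  let ?r = "((1 + Y) / (1 + U)) ^ (2 * k)"
  have "climb k y * ?r = geo (k - 1) Y / geo k Y * ?r"
    using assms climb_inv[of y] by (simp add: Y_def)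
  also have "\<dots> \<le> geo (k - 1) U / geo k Y * ?r"
    using UY geo_mono[of Y U "k - 1"] geo_pos[of Y k]
    by (intro mult_right_mono divide_right_mono) auto
  also have "\<dots> \<le> geo (k - 1) U / geo k U"
  proof -
    have "geo k U * ?r \<le> geo k Y" using geo_growth UY by simp
    then have "geo (k-1) U * (geo k U * ?r) \<le> geo (k-1) U * geo k Y"
      using geo_pos[of U "k-1"] UY by (intro mult_left_mono) auto
    then show ?thesis
      using geo_pos[of Y k] geo_pos[of U k] UY by (simp add: field_simps)
  qed
  also have "\<dots> = climb k u" using assms climb_inv[of u] by (simp add: U_def)
  finally show ?thesis using r by simp
qed

section \<open>Climbing a sequence of levels\<close>

text \<open>Applied to the values of \<open>d_out\<close> on the path from a vertex to the root, this is the
  probability of reaching the root at constant fortune \<open>x\<close>: the counter has to climb past these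
  vertices one after the other.\<close>

definition escape :: "nat list \<Rightarrow> real \<Rightarrow> real" where
  "escape ks x = (\<Prod>k\<leftarrow>ks. climb k x)"

lemma escape_Nil [simp]: "escape [] x = 1"
  and escape_Cons: "escape (k # ks) x = climb k x * escape ks x"
  by (simp_all add: escape_def)

lemma escape_nonneg: "0 \<le> x \<Longrightarrow> 0 \<le> escape ks x"
  by (induction ks) (auto simp: escape_Cons climb_nonneg)

lemma escape_pos: "0 < x \<Longrightarrow> \<forall>k\<in>set ks. 1 \<le> k \<Longrightarrow> 0 < escape ks x"
  by (induction ks) (auto simp: escape_Cons climb_pos)

lemma escape_le_1: "0 \<le> x \<Longrightarrow> escape ks x \<le> 1"
  by (induction ks) (auto simp: escape_Cons climb_nonneg escape_nonneg less_imp_le[OF climb_less_1] intro!: mult_le_one)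

lemma escape_mono: "0 \<le> y \<Longrightarrow> y \<le> x \<Longrightarrow> escape ks y \<le> escape ks x"
  by (induction ks) (auto simp: escape_Cons climb_nonneg escape_nonneg climb_mono intro!: mult_mono)

lemma has_real_derivative_escape:
  assumes "0 < u" "\<forall>k\<in>set ks. 1 \<le> k"
  shows "(escape ks has_real_derivative
    escape ks u * (\<Sum>k\<leftarrow>ks. dgeo k u / (geo k u * (u * geo (k - 1) u)))) (at u)"
  using assms(2)
proof (induction ks)
  case Nil
  have "escape [] = (\<lambda>_. 1)" by auto
  then show ?case by simp
next
  case (Cons k ks)
  let ?S = "\<Sum>k\<leftarrow>ks. dgeo k u / (geo k u * (u * geo (k - 1) u))"
  have "((\<lambda>x. climb k x * escape ks x) has_real_derivative
      dgeo k u / (geo k u)\<^sup>2 * escape ks u + escape ks u * ?S * climb k u) (at u)"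
    using Cons assms(1) by (intro DERIV_mult has_real_derivative_climb) auto
  moreover have "dgeo k u / (geo k u)\<^sup>2 = climb k u * (dgeo k u / (geo k u * (u * geo (k - 1) u)))"
    using assms Cons.prems geo_pos[of u k] geo_pos[of u "k - 1"]
    by (simp add: climb_eq power2_eq_square)
  ultimately show ?case
    by (simp add: escape_Cons[abs_def] algebra_simps)
qed

lemma isCont_escape: "0 \<le> u \<Longrightarrow> isCont (escape ks) u"
proof (induction ks)
  case Nil
  have "escape [] = (\<lambda>_. 1)" by auto
  then show ?case by simp
next
  case (Cons k ks)
  then have "isCont (\<lambda>x. climb k x * escape ks x) u"
    using DERIV_isCont[OF has_real_derivative_climb[of u k]] by (intro continuous_mult) auto
  then show ?case by (simp add: escape_Cons[abs_def])
qed

lemma escape_growth: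
  assumes "0 < u" "u \<le> y" "\<forall>k\<in>set ks. 1 \<le> k \<and> k \<le> n"
  shows "escape ks y * ((u / (1 + u)) / (y / (1 + y))) ^ (2 * n * length ks) \<le> escape ks u"
  using assms(3)
proof (induction ks)
  case Nil then show ?case by simp
next
  case (Cons k ks)
  let ?r = "(u / (1 + u)) / (y / (1 + y))"
  have "(u / (1 + u)) \<le> (y / (1 + y))" using assms by (simp add: field_simps)
  moreover have "0 < y / (1 + y)" using assms by simp
  ultimately have "?r \<le> 1" by (intro divide_le_eq_1_pos[THEN iffD2])
  moreover have "0 \<le> ?r" using assms by simp
  ultimately have r: "0 \<le> ?r" "?r \<le> 1" by blast+
  have "climb k y * ?r ^ (2 * n) \<le> climb k y * ?r ^ (2 * k)"
    using r Cons.prems assms by (intro mult_left_mono power_decreasing) (auto simp: climb_nonneg)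
  also have "\<dots> \<le> climb k u" using climb_growth assms Cons.prems by auto
  finally have 1: "climb k y * ?r ^ (2 * n) \<le> climb k u" .
  have "escape (k # ks) y * ?r ^ (2 * n * length (k # ks))
    = (climb k y * ?r ^ (2 * n)) * (escape ks y * ?r ^ (2 * n * length ks))"
    by (simp add: escape_Cons power_add algebra_simps)
  also have "\<dots> \<le> climb k u * escape ks u"
    using 1 Cons assms r by (intro mult_mono mult_nonneg_nonneg) (auto simp: climb_nonneg escape_nonneg)
  finally show ?case by (simp add: escape_Cons)
qed

text \<open>Each factor is at least \<open>climb 1 x = x / (1 + x)\<close>.\<close>

lemma escape_lower:
  assumes "0 \<le> x" "\<forall>k\<in>set l. 1 \<le> k"
  shows "(x / (1 + x)) ^ length l \<le> escape l x"
  using assms(2)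
proof (induction l)
  case Nil then show ?case by simp
next
  case (Cons k l)
  have "1 + x \<le> geo k x"
    using geo_mono_index[of x 1 k] geo_Suc[of 0 x] Cons.prems assms by simp
  then have "1 / geo k x \<le> 1 / (1 + x)" using assms by (intro divide_left_mono) auto
  then have "x / (1 + x) \<le> climb k x" using assms by (simp add: climb_def field_simps)
  then have "x / (1 + x) * (x / (1 + x)) ^ length l \<le> climb k x * escape l x"
    using Cons assms climb_nonneg[of x k] by (intro mult_mono) auto
  then show ?case by (simp add: escape_Cons)
qed

lemma sum_list_diff_le:
  fixes f g :: "'a \<Rightarrow> real"
  shows "(\<And>k. k \<in> set l \<Longrightarrow> f k - g k \<le> c) \<Longrightarrow> (\<Sum>k\<leftarrow>l. f k) - (\<Sum>k\<leftarrow>l. g k) \<le> real (length l) * c"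
proof (induction l)
  case (Cons k l)
  have "f k - g k \<le> c" by (rule Cons.prems) simp
  moreover have "(\<Sum>k\<leftarrow>l. f k) - (\<Sum>k\<leftarrow>l. g k) \<le> real (length l) * c"
    by (rule Cons.IH) (rule Cons.prems, simp)
  ultimately show ?case by (simp add: algebra_simps)
qed simp

section \<open>Equilibrium stakes\<close>

text \<open>This is \<open>(1 + x)\<^sup>2\<close> times the derivative of \<open>escape (d # ks)\<close>, divided by the
  difference between the values of the two moves, as \<open>has_real_derivative_value\<close> shows. With stakes
  inversely proportional to it, the gain from winning the turn and the loss of fortune balance to first
  order.\<close>

definition stake_den :: "nat \<Rightarrow> nat list \<Rightarrow> real \<Rightarrow> real" where
  "stake_den d ks x = (1 + x) * (\<Sum>k\<leftarrow>d # ks. dgeo k x / geo k x * (geo (d - 1) x / geo (k - 1) x))"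

text \<open>The fraction of her fortune that either player stakes in equilibrium.\<close>

definition stake :: "real \<Rightarrow> nat \<Rightarrow> nat list \<Rightarrow> real \<Rightarrow> real" where
  "stake \<epsilon> d ks x = \<epsilon> / stake_den d ks x"

text \<open>The mean value after a turn in which the fortune has become \<open>y\<close>, Maxine wins a move with probability
  \<open>q\<close>, and both players move as well as they can: to the parent, whose levels are \<open>ks\<close>,
  and to a child with \<open>d_out = d - 1\<close>, whose levels are \<open>(d - 1) # d # ks\<close>.\<close>

definition turn_value :: "real \<Rightarrow> nat \<Rightarrow> nat list \<Rightarrow> real \<Rightarrow> real \<Rightarrow> real" where
  "turn_value \<epsilon> d ks y q = (1 - \<epsilon>) * escape (d # ks) y +
     \<epsilon> * (q * escape ks y + (1 - q) * (climb (d - 1) y * escape (d # ks) y))"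

text \<open>The list \<open>d # ks\<close> stands for the values of \<open>d_out\<close> on the path from the current vertex to the
  root, and \<open>n\<close> for the number of vertices.\<close>

locale levels =
  fixes n d :: nat and ks :: "nat list" and \<epsilon> :: real
  assumes n: "3 \<le> n" and d: "1 \<le> d" "d \<le> n" and ks: "\<forall>k\<in>set ks. 1 \<le> k \<and> k \<le> n"
    and len: "length ks < n" and \<epsilon>: "0 < \<epsilon>" "4 * \<epsilon> * real n ^ 5 \<le> 1"
begin

abbreviation "K \<equiv> stake_den d ks"
abbreviation "h \<equiv> escape (d # ks)"
abbreviation "g \<equiv> escape ks"

lemma level_range: "k \<in> set (d # ks) \<Longrightarrow> 1 \<le> k \<and> k \<le> n"
  using d ks by auto

text \<open>The difference between the values of the two moves,
  \<open>escape ks y - climb (d - 1) y * escape (d # ks) y\<close>, in closed form.\<close>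

definition "gap y = g y * (1 + y) / geo d y"

text \<open>The left-hand sides add up the exponents and losses in the growth bounds below, first for Mina's and then for
  Maxine's deviations.\<close>

lemma power5_absorbs: "2 * real n ^ 2 + 8 * real n ^ 3 + 1 \<le> real n ^ 5" "6 * real n + 1 \<le> real n ^ 5"
proof -
  have n': "3 \<le> real n" using n by simp
  have 9: "9 \<le> real n ^ 2" using power_mono[OF n', of 2] by simp
  have "real n ^ 5 = real n ^ 3 * real n ^ 2" by (simp add: power_add[symmetric])
  also have "\<dots> \<ge> real n ^ 3 * 9" using 9 by (intro mult_left_mono) auto
  finally have a: "9 * real n ^ 3 \<le> real n ^ 5" by simp
  have b: "3 * real n ^ 2 \<le> real n ^ 3"
    using mult_right_mono[OF n', of "real n ^ 2"] by (simp add: power3_eq_cube power2_eq_square)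
  have c: "3 * real n \<le> real n ^ 2"
    using mult_right_mono[OF n', of "real n"] by (simp add: power2_eq_square)
  show "2 * real n ^ 2 + 8 * real n ^ 3 + 1 \<le> real n ^ 5" using a b 9 by linarith
  show "6 * real n + 1 \<le> real n ^ 5" using a b c 9 n' by linarith
qed

lemma eps_small: "\<epsilon> \<le> 1 / 4" "4 * (real n ^ 5 * \<epsilon>) \<le> 1"
proof -
  have "1 \<le> real n ^ 5" using n by simp
  then have "4 * \<epsilon> * 1 \<le> 4 * \<epsilon> * real n ^ 5" using \<epsilon> by (intro mult_left_mono) auto
  with \<epsilon>(2) show "\<epsilon> \<le> 1 / 4" by linarith
  from \<epsilon> show "4 * (real n ^ 5 * \<epsilon>) \<le> 1" by (simp add: mult.commute mult.left_commute)
qed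

lemma K_term_nonneg:
  "k \<in> set (d # ks) \<Longrightarrow> 0 \<le> x \<Longrightarrow> 0 \<le> dgeo k x / geo k x * (geo (d - 1) x / geo (k - 1) x)"
  using dgeo_pos[of k x] geo_pos[of x k] geo_pos[of x "d-1"] geo_pos[of x "k-1"] level_range[of k]
  by (intro mult_nonneg_nonneg divide_nonneg_nonneg) auto

lemma K_ge_1: assumes "0 \<le> x" shows "1 \<le> K x"
proof -
  have "0 \<le> (\<Sum>k\<leftarrow>ks. dgeo k x / geo k x * (geo (d - 1) x / geo (k - 1) x))"
    using K_term_nonneg assms by (intro sum_list_nonneg) auto
  then have "(1 + x) * (dgeo d x / geo d x) \<le> K x"
    using assms geo_pos[of x "d - 1"]
    unfolding stake_den_def by (intro mult_left_mono) auto
  moreover have "1 \<le> (1 + x) * (dgeo d x / geo d x)"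
    using dgeo_lower[of d x] d assms geo_pos[of x d] by simp
  ultimately show ?thesis by simp
qed

lemma stake_bounds: assumes "0 \<le> x" shows "0 < stake \<epsilon> d ks x" "stake \<epsilon> d ks x \<le> \<epsilon>"
  using K_ge_1[OF assms] \<epsilon> by (auto simp: stake_def field_simps)

lemma stake_K: "0 \<le> x \<Longrightarrow> stake \<epsilon> d ks x * K x = \<epsilon>"
  using K_ge_1[of x] by (simp add: stake_def)

text \<open>When the fortune decreases, the denominators of \<open>K\<close> can only help. The numerators
  \<open>dgeo k\<close> and \<open>geo (d - 1)\<close> contribute \<open>2 * n\<close> each to the exponent, and \<open>1 + x\<close> contributes one.\<close>

lemma K_growth:
  assumes yx: "0 \<le> y" "y \<le> x"
  shows "K x * ((1 + y) / (1 + x)) ^ (4 * n + 1) \<le> K y"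
proof -
  let ?r = "(1 + y) / (1 + x)"
  have r: "0 \<le> ?r" "?r \<le> 1" using yx by auto
  have "dgeo k x / geo k x * (geo (d - 1) x / geo (k - 1) x) * ?r ^ (4 * n)
      \<le> dgeo k y / geo k y * (geo (d - 1) y / geo (k - 1) y)" if k: "k \<in> set (d # ks)" for k
  proof -
    have x: "0 \<le> x" using yx by simp
    have "dgeo k x * ?r ^ (2 * n) \<le> dgeo k x * ?r ^ (2 * k)"
      using r level_range[OF k] dgeo_pos[of k x] x by (intro mult_left_mono power_decreasing) auto
    also have "\<dots> \<le> dgeo k y" using dgeo_growth yx by simp
    finally have 1: "dgeo k x * ?r ^ (2 * n) \<le> dgeo k y" .
    have "geo (d-1) x * ?r ^ (2 * n) \<le> geo (d-1) x * ?r ^ (2 * (d - 1))"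
      using r d geo_pos[of x "d-1"] x by (intro mult_left_mono power_decreasing) auto
    also have "\<dots> \<le> geo (d-1) y" using geo_growth yx by simp
    finally have 2: "geo (d-1) x * ?r ^ (2 * n) \<le> geo (d-1) y" .
    have "dgeo k x / geo k x * (geo (d - 1) x / geo (k - 1) x) * ?r ^ (4 * n)
      = (dgeo k x * ?r ^ (2 * n)) * (geo (d - 1) x * ?r ^ (2 * n)) / (geo k x * geo (k - 1) x)"
      by (simp add: power_add[symmetric] mult_ac)
    also have "\<dots> \<le> dgeo k y * geo (d - 1) y / (geo k y * geo (k - 1) y)"
      using 1 2 yx r x dgeo_pos[of k x] dgeo_pos[of k y] level_range[OF k]
      by (intro frac_le mult_mono mult_nonneg_nonneg mult_pos_pos geo_mono geo_pos)
         (auto simp: less_imp_le[OF geo_pos])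
    finally show ?thesis by simp
  qed
  note term_le = this
  define S where "S x = (\<Sum>k\<leftarrow>d # ks. dgeo k x / geo k x * (geo (d - 1) x / geo (k - 1) x))" for x
  have "0 \<le> S x"
    unfolding S_def using K_term_nonneg[of _ x] yx by (intro sum_list_nonneg) force
  moreover have "S x * ?r ^ (4 * n) \<le> S y"
    unfolding S_def sum_list_mult_const[symmetric] by (intro sum_list_mono term_le)
  ultimately have "((1 + x) * ?r) * (S x * ?r ^ (4 * n)) \<le> (1 + y) * S y"
    using yx r by (intro mult_mono mult_nonneg_nonneg) auto
  moreover have "K x = (1 + x) * S x" "K y = (1 + y) * S y"
    by (simp_all only: stake_den_def S_def)
  ultimately show ?thesis by (simp only: power_add power_one_right mult_ac)
qed

text \<open>The product of \<open>K x\<close> and \<open>x / (1 + x)\<close>. In this normalisation \<open>K\<close> is nearly nondecreasing, as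
  the means \<open>tilt k\<close> are nondecreasing.\<close>

definition "P x = (\<Sum>k\<leftarrow>d # ks. tilt k x * (geo (d - 1) x / geo (k - 1) x))"

lemma K_P: "0 < x \<Longrightarrow> K x = P x / (x / (1 + x))"
  unfolding stake_den_def P_def tilt_def
  by (simp add: sum_list_mult_const[symmetric] sum_list_const_mult field_simps)
     (simp add: sum_list_mult_const[symmetric] sum_list_const_mult[symmetric] algebra_simps)

text \<open>For \<open>k \<le> d\<close> the quotient \<open>geo (d - 1) x / geo (k - 1) x\<close> is nondecreasing. For \<open>k > d\<close> it is at most
  \<open>2 / (1 + x)\<close> and falls by at most \<open>4 * k * e\<close>, where \<open>e\<close> is the increase of \<open>x / (1 + x)\<close>; with
  \<open>tilt k x \<le> 2 * k * P x\<close> this is a loss of at most \<open>8 * n\<^sup>2 * P x * e\<close> for each of at most \<open>n\<close> levels.\<close>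

lemma P_growth:
  assumes x: "0 < x" "x \<le> u"
  shows "P x * (1 - 8 * real n ^ 3 * (u / (1 + u) - x / (1 + x))) \<le> P u"
proof -
  define e where "e = u / (1 + u) - x / (1 + x)"
  have e: "e = (u - x) / ((1 + x) * (1 + u))" "0 \<le> e"
    using x by (auto simp: e_def field_simps)
  have nn: "0 \<le> tilt k x * (geo (d - 1) x / geo (k - 1) x)" if "k \<in> set (d # ks)" for k
    using dgeo_pos[of k x] geo_pos[of x k] geo_pos[of x "d-1"] geo_pos[of x "k-1"] level_range[OF that] x
    by (auto simp: tilt_def)
  have P: "x / (1 + x) \<le> P x"
  proof -
    have "x / (1 + x) \<le> tilt d x"
      using mult_left_mono[OF dgeo_lower[of d x], of x] d x geo_pos[of x d]
      by (simp add: tilt_def field_simps)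
    also have "\<dots> \<le> P x" using nn geo_pos[of x "d - 1"] x
      by (auto simp: P_def intro!: sum_list_nonneg)
    finally show ?thesis .
  qed
  have "tilt k x * (geo (d - 1) x / geo (k - 1) x) - tilt k u * (geo (d - 1) u / geo (k - 1) u)
    \<le> 8 * real n ^ 2 * P x * e" if k: "k \<in> set (d # ks)" for k
  proof -
    let ?r = "\<lambda>x. geo (d - 1) x / geo (k - 1) x"
    have r0: "0 \<le> ?r u" using geo_pos[of u "d-1"] geo_pos[of u "k-1"] x by simp
    have t0: "0 \<le> tilt k x" using dgeo_pos[of k x] geo_pos[of x k] level_range[OF k] x by (simp add: tilt_def)
    have "tilt k x * ?r u \<le> tilt k u * ?r u"
      using tilt_mono[of x u k] x r0 by (intro mult_right_mono) auto
    then have 1: "tilt k x * ?r x - tilt k u * ?r u \<le> tilt k x * (?r x - ?r u)"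
      by (simp add: algebra_simps)
    show ?thesis
    proof (cases "k \<le> d")
      case True
      have "?r x \<le> ?r u"
        using geo_ratio_mono[of "k - 1" "d - 1" x u] x True geo_pos[of x "k-1"] geo_pos[of u "k-1"]
        by (simp add: field_simps diff_le_mono)
      then have "tilt k x * (?r x - ?r u) \<le> 0" using t0 by (simp add: mult_nonneg_nonpos)
      moreover have "0 \<le> 8 * real n ^ 2 * P x * e" using P x e
        by (intro mult_nonneg_nonneg) (auto intro: order.trans[OF _ P])
      ultimately show ?thesis using 1 by linarith
    next
      case False
      have "geo (d - 1) x / geo (k - 1) x \<le> 2 / (1 + x)"
      proof -
        have "geo d x \<le> geo (k - 1) x" using False x by (intro geo_mono_index) auto
        moreover have "(1 + x) * geo (d - 1) x \<le> 2 * geo d x"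
          using geo_pred[of d x] geo_mono_index[of x "d-1" d] x d by (simp add: algebra_simps)
        ultimately show ?thesis using geo_pos[of x "k-1"] x by (simp add: field_simps)
      qed
      moreover have "?r x * ((1 + x) / (1 + u)) ^ (2 * k) \<le> ?r u"
      proof -
        have "((1 + x) / (1 + u)) ^ (2 * k) \<le> ((1 + x) / (1 + u)) ^ (2 * (k - 1))"
          using x by (intro power_decreasing) auto
        then have "geo (k - 1) u * ((1 + x) / (1 + u)) ^ (2 * k)
            \<le> geo (k - 1) u * ((1 + x) / (1 + u)) ^ (2 * (k - 1))"
          using x geo_pos[of u "k-1"] by (intro mult_left_mono) auto
        also have "\<dots> \<le> geo (k - 1) x"
          using geo_growth[of x u "k - 1"] x by simp
        finally have "((1 + x) / (1 + u)) ^ (2 * k) / geo (k - 1) x \<le> 1 / geo (k - 1) u"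
          using geo_pos[of x "k-1"] geo_pos[of u "k-1"] x by (simp add: field_simps)
        then have "geo (d - 1) x * (((1 + x) / (1 + u)) ^ (2 * k) / geo (k - 1) x) \<le> geo (d - 1) u * (1 / geo (k - 1) u)"
          using x geo_pos[of x "k-1"] geo_pos[of u "d-1"] by (intro mult_mono geo_mono) auto
        then show ?thesis by simp
      qed
      moreover have "1 - real (2 * k) * ((u - x) / (1 + u)) \<le> ((1 + x) / (1 + u)) ^ (2 * k)"
      proof -
        have "(1 + x) / (1 + u) = 1 + (- ((u - x) / (1 + u)))" using x by (simp add: field_simps)
        then show ?thesis using Bernoulli_inequality[of "- ((u - x) / (1 + u))" "2 * k"] x
          by (simp add: field_simps)
      qed
      ultimately have "?r x - ?r u \<le> 2 / (1 + x) * (real (2 * k) * ((u - x) / (1 + u)))"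
      proof -
        assume a: "geo (d - 1) x / geo (k - 1) x \<le> 2 / (1 + x)"
          and b: "?r x * ((1 + x) / (1 + u)) ^ (2 * k) \<le> ?r u"
          and c: "1 - real (2 * k) * ((u - x) / (1 + u)) \<le> ((1 + x) / (1 + u)) ^ (2 * k)"
        have rx: "0 \<le> ?r x" using geo_pos[of x "d-1"] geo_pos[of x "k-1"] x by simp
        have "?r x * (1 - real (2 * k) * ((u - x) / (1 + u))) \<le> ?r u"
          using mult_left_mono[OF c rx] b by linarith
        then have "?r x - ?r u \<le> ?r x * (real (2 * k) * ((u - x) / (1 + u)))"
          by (simp add: right_diff_distrib)
        also have "\<dots> \<le> 2 / (1 + x) * (real (2 * k) * ((u - x) / (1 + u)))"
          using a x by (intro mult_right_mono) auto
        finally show ?thesis .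
      qed
      also have "\<dots> = 4 * real k * e" using x by (simp add: e)
      finally have r: "?r x - ?r u \<le> 4 * real k * e" .
      have "tilt k x \<le> 2 * real k * (x / (1 + x))"
        using mult_left_mono[OF dgeo_upper[of k x], of x] level_range[OF k] x geo_pos[of x k]
        by (simp add: tilt_def field_simps)
      also have "\<dots> \<le> 2 * real k * P x" using P by (intro mult_left_mono) auto
      finally have t: "tilt k x \<le> 2 * real k * P x" .
      have "tilt k x * (?r x - ?r u) \<le> tilt k x * (4 * real k * e)"
        using r t0 by (intro mult_left_mono) auto
      also have "\<dots> \<le> (2 * real k * P x) * (4 * real k * e)"
        using t e(2) by (intro mult_right_mono mult_nonneg_nonneg) auto
      also have "\<dots> = 8 * real k ^ 2 * (P x * e)" by (simp add: power2_eq_square)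
      also have "\<dots> \<le> 8 * real n ^ 2 * (P x * e)"
        using level_range[OF k] e P x by (intro mult_right_mono mult_left_mono power_mono mult_nonneg_nonneg)
          (auto intro: order.trans[OF _ P])
      finally show ?thesis using 1 by (simp add: mult.assoc)
    qed
  qed
  then have "P x - P u \<le> real (length (d # ks)) * (8 * real n ^ 2 * P x * e)"
    unfolding P_def[of x] P_def[of u] by (rule sum_list_diff_le)
  also have "\<dots> \<le> real n * (8 * real n ^ 2 * P x * e)"
    using len e P x by (intro mult_right_mono mult_nonneg_nonneg) (auto intro: order.trans[OF _ P])
  finally show ?thesis by (simp add: e_def power2_eq_square power3_eq_cube algebra_simps)
qed

section \<open>The value after one turn\<close>

text \<open>At win probability \<open>y / (1 + y)\<close> the value is harmonic along the walk, so only the excess of \<open>q\<close>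
  over this probability contributes.\<close>

lemma turn_value_eq:
  assumes "0 \<le> y"
  shows "turn_value \<epsilon> d ks y q = h y + \<epsilon> * gap y * (q - y / (1 + y))"
proof -
  define S where "S = geo (d - 1) y"
  have S: "1 \<le> S" "geo d y = 1 + y * S"
    using geo_ge_1[of y "d - 1"] assms geo_pred[of d y] d by (simp_all add: S_def)
  have S0: "0 < 1 + y * S" using S assms by (simp add: add_pos_nonneg)
  have y1: "0 < 1 + y" using assms by simp
  have r: "climb (d - 1) y = (S - 1) / S"
    unfolding climb_def S_def[symmetric] using S(1) by (simp add: diff_divide_distrib)
  have hh: "h y = y * S / (1 + y * S) * g y"
    unfolding escape_Cons climb_eq[OF d(1) assms] S(2) S_def ..
  have rh: "climb (d - 1) y * h y = (S - 1) * y / (1 + y * S) * g y"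
    unfolding r hh using S by simp
  have gp: "gap y = (1 + y) / (1 + y * S) * g y" using S by (simp add: gap_def)
  have 1: "g y - climb (d - 1) y * h y = gap y"
    unfolding rh gp using S0 by (simp add: field_simps)
  have 2: "climb (d - 1) y * h y + y / (1 + y) * gap y = h y"
  proof -
    have "y / (1 + y) * gap y = y / (1 + y * S) * g y" unfolding gp using y1 by simp
    then show ?thesis
      unfolding rh unfolding hh by (simp add: algebra_simps diff_divide_distrib)
  qed
  have "turn_value \<epsilon> d ks y q = (1 - \<epsilon>) * h y + \<epsilon> * (climb (d - 1) y * h y + q * (g y - climb (d - 1) y * h y))"
    by (simp add: turn_value_def algebra_simps)
  also have "\<dots> = (1 - \<epsilon>) * h y + \<epsilon> * (h y - y / (1 + y) * gap y + q * gap y)"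
    using 1 2 by simp
  finally show ?thesis by (simp add: algebra_simps)
qed

lemma gap_nonneg: "0 \<le> y \<Longrightarrow> 0 \<le> gap y"
  using geo_pos[of y d] escape_nonneg[of y ks] by (simp add: gap_def)

lemma gap_pos: "0 < y \<Longrightarrow> 0 < gap y"
  using geo_pos[of y d] escape_pos[of y ks] ks by (simp add: gap_def)

lemma has_real_derivative_value:
  assumes "0 < u"
  shows "(h has_real_derivative gap u * K u / (1 + u)\<^sup>2) (at u)"
proof -
  let ?S = "\<Sum>k\<leftarrow>d # ks. dgeo k u / geo k u * (geo (d - 1) u / geo (k - 1) u)"
  have pos: "0 < geo d u" "0 < geo (d - 1) u" using geo_pos assms by auto
  have "(\<Sum>k\<leftarrow>d # ks. dgeo k u / (geo k u * (u * geo (k - 1) u))) * (u * geo (d - 1) u) = ?S"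
    unfolding sum_list_mult_const[symmetric] using assms
    by (intro arg_cong[of _ _ sum_list] map_cong refl) simp
  then have "(\<Sum>k\<leftarrow>d # ks. dgeo k u / (geo k u * (u * geo (k - 1) u))) = ?S / (u * geo (d - 1) u)"
    using assms pos by (simp only: eq_divide_eq) simp
  moreover have "(h has_real_derivative
    h u * (\<Sum>k\<leftarrow>d # ks. dgeo k u / (geo k u * (u * geo (k - 1) u)))) (at u)"
    using level_range assms by (intro has_real_derivative_escape) auto
  moreover have "h u * (?S / (u * geo (d - 1) u)) = gap u * K u / (1 + u)\<^sup>2"
    unfolding stake_den_def gap_def escape_Cons using assms pos d
    by (subst climb_eq) (auto simp: power2_eq_square)
  ultimately show ?thesis by simp
qed

text \<open>Cauchy's mean value theorem for the value against \<open>x / (1 + x)\<close>, the win probability at equilibrium.\<close>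

lemma value_mean_slope:
  assumes "0 \<le> y" "y < x"
  obtains u where "y < u" "u < x"
    "h x - h y = gap u * K u * ((x - y) / ((1 + x) * (1 + y)))"
proof -
  have der: "((\<lambda>u. u / (1 + u)) has_real_derivative 1 / (1 + u)\<^sup>2) (at u)" if "0 \<le> u" for u :: real
    using that by (auto intro!: derivative_eq_intros simp: power2_eq_square field_simps)
  have "\<exists>c>y. c < x \<and> (h x - h y) * (1 / (1 + c)\<^sup>2)
      = (x / (1 + x) - y / (1 + y)) * (gap c * K c / (1 + c)\<^sup>2)"
    using assms
    by (intro GMVT'[where g = "\<lambda>u. u / (1 + u)"] isCont_escape DERIV_isCont[OF der] der
        has_real_derivative_value) auto
  then obtain c where c: "y < c" "c < x" and eq: "(h x - h y) * (1 / (1 + c)\<^sup>2)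
      = (x / (1 + x) - y / (1 + y)) * (gap c * K c / (1 + c)\<^sup>2)" by blast
  have "h x - h y = (x / (1 + x) - y / (1 + y)) * (gap c * K c)"
    using eq c assms by simp
  also have "x / (1 + x) - y / (1 + y) = (x - y) / ((1 + x) * (1 + y))"
    using assms by (simp add: field_simps)
  finally show ?thesis using that c by (simp add: mult.commute)
qed

lemma value_mean_slope_up:
  assumes "0 \<le> x" "x < y"
  obtains u where "x < u" "u < y"
    "h x - h y = gap u * K u * ((x - y) / ((1 + x) * (1 + y)))"
proof -
  obtain u where u: "x < u" "u < y" and C: "h y - h x = gap u * K u * ((y - x) / ((1 + y) * (1 + x)))"
    using value_mean_slope[OF assms] by blast
  have "h x - h y = - (gap u * K u * ((y - x) / ((1 + y) * (1 + x))))" using C by simp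
  also have "\<dots> = gap u * K u * (- (y - x) / ((1 + y) * (1 + x)))"
    by (simp only: minus_divide_left mult_minus_right)
  finally show ?thesis using that[OF u] by (simp add: mult.commute)
qed

text \<open>As \<open>x - a = y * (1 - b)\<close>, the excess \<open>a / (a + b) - y / (1 + y)\<close> of the win probability equals
  \<open>(x - y) / ((a + b) * (1 + y))\<close>. The effect of the turn and the change of the value through the
  change of fortune therefore share a factor, and the total stake, \<open>(1 + x) * W\<close>, decides between them.\<close>

lemma turn_value_diff:
  assumes y: "0 \<le> y" and x: "0 < x" and ab: "0 < a + b" "x - a = y * (1 - b)"
    and C: "h x - h y = C * ((x - y) / ((1 + x) * (1 + y)))"
    and W: "a + b = (1 + x) * W"
  shows "turn_value \<epsilon> d ks y (a / (a + b)) - h x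
    = (x - y) / ((1 + x) * (1 + y)) * (\<epsilon> * gap y / W - C)"
proof -
  have W0: "0 < W" using ab(1) x unfolding W by (simp add: zero_less_mult_iff)
  have "a / (a + b) - y / (1 + y) = (a - y * b) / ((a + b) * (1 + y))"
    using ab y by (simp add: field_simps)
  also have "a - y * b = x - y" using ab(2) by (simp add: algebra_simps)
  also have "(x - y) / ((a + b) * (1 + y)) = (x - y) / ((1 + x) * (1 + y)) / W"
    unfolding W by (simp add: mult_ac)
  finally have *: "a / (a + b) - y / (1 + y) = (x - y) / ((1 + x) * (1 + y)) / W" .
  have "turn_value \<epsilon> d ks y (a / (a + b)) - h x
      = \<epsilon> * gap y * ((x - y) / ((1 + x) * (1 + y)) / W) - (h x - h y)"
    unfolding turn_value_eq[OF y] * by simp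
  moreover define m where "m = (x - y) / ((1 + x) * (1 + y))"
  ultimately show ?thesis unfolding C m_def[symmetric] by (simp add: algebra_simps)
qed

text \<open>If the deviating player stakes more than in equilibrium, the total stake, in units of \<open>1 + x\<close>, grows
  from \<open>s\<close> to \<open>\<delta> + s - s * \<delta>\<close>. For \<open>\<delta> < \<epsilon>\<close> this outweighs a proportional loss of \<open>n ^ 5 * \<delta>\<close>, because
  the loss acts on a quantity of size at most \<open>2 * \<epsilon>\<close>. The surplus \<open>\<delta> / 4\<close> serves to pass to the limit
  in \<open>mina_bankrupt\<close>.\<close>

lemma dominate_up:
  assumes "0 < \<delta>" "\<delta> < \<epsilon>" "0 < s" "s \<le> \<epsilon>"
  shows "s + \<delta> / 4 \<le> (1 - real n ^ 5 * \<delta>) * (\<delta> + s - s * \<delta>)"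
proof -
  let ?L = "real n ^ 5"
  have L: "0 \<le> ?L" by simp
  have 1: "4 * (?L * \<delta>) \<le> 1" "4 * (?L * s) \<le> 1"
    using eps_small(2) mult_left_mono[of \<delta> \<epsilon> ?L] mult_left_mono[of s \<epsilon> ?L] assms L by simp_all
  have s: "s \<le> 1 / 4" using eps_small assms by simp
  have "1 / 4 \<le> 1 - s - ?L * s - ?L * \<delta> * (1 - s)"
  proof -
    have "?L * \<delta> * (1 - s) \<le> ?L * \<delta> * 1" using assms s L by (intro mult_left_mono) auto
    then show ?thesis using 1 s by linarith
  qed
  then have "\<delta> * (1 / 4) \<le> \<delta> * (1 - s - ?L * s - ?L * \<delta> * (1 - s))"
    using assms by (intro mult_left_mono) auto
  also have "\<dots> = (1 - ?L * \<delta>) * (\<delta> + s - s * \<delta>) - s" by (simp add: algebra_simps)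
  finally show ?thesis by simp
qed

text \<open>If the deviating player stakes less, the total stake falls to \<open>s - \<delta> * (1 - s)\<close>. As
  \<open>n ^ 5 * s < 1 - s\<close>, it falls by more than the proportion \<open>n ^ 5 * \<delta>\<close>.\<close>

lemma dominate_down:
  assumes "0 < \<delta>" "0 < s" "s \<le> \<epsilon>"
  shows "s - \<delta> * (1 - s) < s * (1 - real n ^ 5 * \<delta>)"
proof -
  let ?L = "real n ^ 5"
  have "4 * (?L * s) \<le> 1"
    using eps_small(2) mult_left_mono[of s \<epsilon> ?L] assms by simp
  moreover have "s \<le> 1 / 4" using eps_small assms by simp
  ultimately have "?L * s < 1 - s" by simp
  then have "\<delta> * (?L * s) < \<delta> * (1 - s)" using assms by simp
  then show ?thesis by (simp add: algebra_simps)
qed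

lemma small_delta:
  assumes "0 < \<delta>" "0 < s" "s \<le> \<epsilon>" "0 < s - \<delta> * (1 - s)"
  shows "\<delta> < 2 * \<epsilon>"
proof -
  have "s \<le> 1 / 4" using eps_small assms by simp
  then have "\<delta> * (1 / 2) \<le> \<delta> * (1 - s)" using assms by (intro mult_left_mono) auto
  then show ?thesis using assms by linarith
qed

lemma bernoulli: "0 \<le> \<delta> \<Longrightarrow> \<delta> \<le> 1 \<Longrightarrow> 1 - real m * \<delta> \<le> (1 - \<delta>) ^ m" for \<delta> :: real
  using Bernoulli_inequality[of "- \<delta>" m] by simp

text \<open>The exponents are those of \<open>gap_growth_up\<close> and \<open>K_growth\<close>.\<close>

lemma power_loss_maxine:
  assumes "0 \<le> \<delta>" "\<delta> \<le> 1"
  shows "1 - real n ^ 5 * \<delta> \<le> (1 - \<delta>) ^ (2 * n) * (1 - \<delta>) ^ (4 * n + 1)"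
proof -
  have "1 - real n ^ 5 * \<delta> \<le> 1 - real (2 * n + (4 * n + 1)) * \<delta>"
    using power5_absorbs(2) assms by (intro diff_left_mono mult_right_mono) auto
  also have "\<dots> \<le> (1 - \<delta>) ^ (2 * n + (4 * n + 1))" using bernoulli assms by blast
  finally show ?thesis by (simp only: power_add)
qed

text \<open>The factors are those of \<open>gap_growth_down\<close> and, through \<open>K = P / (x / (1 + x))\<close>, of \<open>P_growth\<close>.\<close>

lemma power_loss_mina:
  assumes "0 \<le> \<delta>" "8 * real n ^ 3 * \<delta> \<le> 1"
  shows "1 - real n ^ 5 * \<delta> \<le> (1 - \<delta>) ^ (2 * n * n) * ((1 - \<delta>) * (1 - 8 * real n ^ 3 * \<delta>))"
proof -
  have "1 \<le> 8 * real n ^ 3" using n one_le_power[of "real n" 3] by linarith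
  then have "1 * \<delta> \<le> 8 * real n ^ 3 * \<delta>" using assms by (intro mult_right_mono) auto
  with assms have d1: "\<delta> \<le> 1" by simp
  let ?A = "real (2 * n * n + 1) * \<delta>" and ?B = "8 * real n ^ 3 * \<delta>"
  have "0 \<le> ?A * ?B" using assms by simp
  have "(2 * real n ^ 2 + 8 * real n ^ 3 + 1) * \<delta> \<le> real n ^ 5 * \<delta>"
    using power5_absorbs(1) assms by (intro mult_right_mono) auto
  moreover have "(2 * real n ^ 2 + 8 * real n ^ 3 + 1) * \<delta> = ?A + ?B"
    by (simp add: algebra_simps power2_eq_square)
  ultimately have "1 - real n ^ 5 * \<delta> \<le> 1 - ?A - ?B" by linarith
  also have "\<dots> \<le> (1 - ?A) * (1 - ?B)" using \<open>0 \<le> ?A * ?B\<close> by (simp add: algebra_simps)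
  also have "\<dots> \<le> (1 - \<delta>) ^ (2 * n * n + 1) * (1 - ?B)"
    using bernoulli[of \<delta> "2 * n * n + 1"] assms d1 by (intro mult_right_mono) auto
  finally show ?thesis by (simp add: mult_ac)
qed

lemma cube_small: "0 \<le> \<delta> \<Longrightarrow> \<delta> < 2 * \<epsilon> \<Longrightarrow> 8 * real n ^ 3 * \<delta> \<le> 1"
proof -
  assume \<delta>: "0 \<le> \<delta>" "\<delta> < 2 * \<epsilon>"
  have "8 * real n ^ 3 * \<delta> \<le> real n ^ 5 * \<delta>" using power5_absorbs(1) \<delta> by (intro mult_right_mono) (auto intro: order.trans[rotated])
  also have "\<dots> \<le> real n ^ 5 * (2 * \<epsilon>)" using \<delta> by (intro mult_left_mono) auto
  also have "\<dots> = 2 * (real n ^ 5 * \<epsilon>)" by simp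
  finally show ?thesis using eps_small(2) by linarith
qed

text \<open>The gap is the product of the nondecreasing \<open>escape ks\<close> and the nonincreasing \<open>(1 + y) / geo d y\<close>.
  For an increasing fortune only the second factor loses, and for a decreasing one only the first.\<close>

lemma gap_growth_up:
  assumes "0 \<le> y" "y \<le> u" "u \<le> x"
  shows "gap y * ((1 + y) / (1 + x)) ^ (2 * n) \<le> gap u"
proof -
  let ?r = "(1 + y) / (1 + x)"
  have g: "g y \<le> g u" "0 \<le> g y" "0 \<le> g u" using assms by (auto simp: escape_mono escape_nonneg)
  have pos: "0 < geo d y" "0 < geo d u" "0 < geo d x" using assms by (auto simp: geo_pos)
  have "geo d x * ?r ^ (2 * n) \<le> geo d x * ?r ^ (2 * d)"
    using assms d pos by (intro mult_left_mono power_decreasing) auto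
  also have "\<dots> \<le> geo d y" using geo_growth assms by auto
  moreover define R where "R = ?r ^ (2 * n)"
  ultimately have 1: "?r ^ (2 * n) / geo d y \<le> 1 / geo d x"
    using pos unfolding R_def[symmetric] by (simp add: field_simps)
  have 2: "(1 + x) / geo d x \<le> (1 + u) / geo d u"
    using geo_over_1_mono[of d u x] d assms pos by (simp add: field_simps)
  have "gap y * ?r ^ (2 * n) = g y * ((1 + y) * (?r ^ (2 * n) / geo d y))"
    by (simp add: gap_def)
  also have "\<dots> \<le> g u * ((1 + x) * (1 / geo d x))"
    using 1 g assms pos by (intro mult_mono mult_nonneg_nonneg) auto
  also have "\<dots> \<le> g u * ((1 + u) / geo d u)"
    using 2 g by (intro mult_left_mono) auto
  finally show ?thesis by (simp add: gap_def)
qed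

lemma gap_growth_down:
  assumes "0 < u" "u \<le> y"
  shows "gap y * ((u / (1 + u)) / (y / (1 + y))) ^ (2 * n * n) \<le> gap u"
proof -
  let ?r = "(u / (1 + u)) / (y / (1 + y))"
  have "u / (1 + u) \<le> y / (1 + y)" using assms by (simp add: field_simps)
  moreover have "0 < y / (1 + y)" using assms by simp
  ultimately have r1: "?r \<le> 1" by (intro divide_le_eq_1_pos[THEN iffD2])
  have r0: "0 \<le> ?r" using assms by simp
  have g: "0 \<le> g y" "0 \<le> g u" using assms by (auto simp: escape_nonneg)
  have pos: "0 < geo d y" "0 < geo d u" using assms by (auto simp: geo_pos)
  have "g y * ?r ^ (2 * n * n) \<le> g y * ?r ^ (2 * n * length ks)"
    using r0 r1 g len by (intro mult_left_mono power_decreasing) auto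
  also have "\<dots> \<le> g u" using escape_growth[of u y ks n] assms ks by auto
  finally have 1: "g y * ?r ^ (2 * n * n) \<le> g u" .
  have 2: "(1 + y) / geo d y \<le> (1 + u) / geo d u"
    using geo_over_1_mono[of d u y] d assms pos by (simp add: field_simps)
  have "gap y * ?r ^ (2 * n * n) = (g y * ?r ^ (2 * n * n)) * ((1 + y) / geo d y)"
    by (simp add: gap_def)
  also have "\<dots> \<le> g u * ((1 + u) / geo d u)"
    using 1 2 g assms pos by (intro mult_mono) auto
  finally show ?thesis by (simp add: gap_def)
qed

section \<open>Deviations of Maxine in one turn\<close>

text \<open>Maxine stakes too much, so that her fortune falls. For \<open>\<delta> < \<epsilon>\<close> the losses of \<open>gap\<close> and \<open>K\<close> between
  \<open>x\<close> and \<open>y\<close> are dominated by the growth of the total stake.\<close>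

lemma maxine_down:
  assumes x: "0 < x" and y: "0 \<le> y" "y < x" and s: "s = stake \<epsilon> d ks x"
  shows "turn_value \<epsilon> d ks y ((x - y * (1 - s)) / (x - y * (1 - s) + s)) < h x"
proof -
  have s0: "0 < s" "s \<le> \<epsilon>" "s * K x = \<epsilon>" using stake_bounds[of x] stake_K[of x] x s by auto
  define a where "a = x - y * (1 - s)"
  define \<delta> where "\<delta> = (x - y) / (1 + x)"
  define W where "W = \<delta> + s - s * \<delta>"
  have \<delta>: "0 < \<delta>" "\<delta> \<le> 1" "1 - \<delta> = (1 + y) / (1 + x)" using x y by (auto simp: \<delta>_def field_simps)
  have s1: "s < 1" using s0 eps_small by simp
  have "s * \<delta> \<le> 1 * \<delta>" using \<delta> s1 by (intro mult_right_mono) auto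
  then have W0: "s \<le> W" "0 < W" using s0 by (auto simp: W_def)
  have aW: "a + s = (1 + x) * W"
  proof -
    have "(1 + x) * W = (1 + x) * \<delta> * (1 - s) + (1 + x) * s" by (simp add: W_def algebra_simps)
    also have "(1 + x) * \<delta> = x - y" using x by (simp add: \<delta>_def)
    finally show ?thesis by (simp add: a_def algebra_simps)
  qed
  have as: "0 < a + s" using aW W0 x by simp
  show ?thesis
  proof (cases "\<epsilon> \<le> \<delta>")
    case True
    \<comment> \<open>The probability 1 / geo d of a fall at the current level increases by the factor 1 / (1 - \<delta>) at
      least, which is more than a move, made with probability \<epsilon>, can win back.\<close>
    define \<rho> where "\<rho> = (x - y) / (a + s)"
    have yas: "a + s = x - y + s * (1 + y)" by (simp add: a_def algebra_simps)
    have \<rho>: "0 < \<rho>" "\<rho> < 1" using yas s0 y by (auto simp: \<rho>_def add_pos_pos)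
    have q: "a / (a + s) - y / (1 + y) = \<rho> / (1 + y)"
    proof -
      have "a / (a + s) - y / (1 + y) = (a - y * s) / ((a + s) * (1 + y))"
        using as y by (simp add: field_simps)
      also have "a - y * s = x - y" by (simp add: a_def algebra_simps)
      finally show ?thesis by (simp add: \<rho>_def)
    qed
    have posy: "0 < geo d y" and posx: "0 < geo d x" using geo_pos x y by auto
    have "turn_value \<epsilon> d ks y (a / (a + s)) = climb d y * g y + \<epsilon> * (\<rho> * g y / geo d y)"
      unfolding turn_value_eq[OF y(1)] q using y by (simp add: gap_def escape_Cons)
    also have "\<dots> = g y * (1 - (1 - \<epsilon> * \<rho>) / geo d y)"
      by (simp add: climb_def algebra_simps diff_divide_distrib add_divide_distrib)
    also have "\<dots> \<le> g x * (1 - (1 - \<epsilon> * \<rho>) / geo d y)"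
    proof (rule mult_right_mono)
      show "g y \<le> g x" using escape_mono y by simp
      have "1 - \<epsilon> * \<rho> \<le> geo d y" using geo_ge_1[of y d] y \<rho> \<epsilon> mult_pos_pos[of \<epsilon> \<rho>] by linarith
      then show "0 \<le> 1 - (1 - \<epsilon> * \<rho>) / geo d y" using posy by simp
    qed
    also have "\<dots> < g x * (1 - 1 / geo d x)"
    proof -
      have "geo d y \<le> geo d x * (1 - \<delta>)"
        using geo_over_1_mono[of d y x] d x y unfolding \<delta>(3) by (simp add: field_simps)
      also have "\<dots> < geo d x * (1 - \<epsilon> * \<rho>)"
      proof -
        have "\<epsilon> * \<rho> < \<epsilon> * 1" using \<rho> \<epsilon> by (intro mult_strict_left_mono) auto
        then show ?thesis using True posx by (intro mult_strict_left_mono) auto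
      qed
      finally have "1 / geo d x < (1 - \<epsilon> * \<rho>) / geo d y" using posx posy by (simp add: field_simps)
      moreover have "0 < g x" using escape_pos x ks by auto
      ultimately show ?thesis by simp
    qed
    also have "\<dots> = h x" by (simp add: escape_Cons climb_def)
    finally show ?thesis by (simp add: a_def)
  next
    case False
    obtain u where u: "y < u" "u < x" and C: "h x - h y = gap u * K u * ((x - y) / ((1 + x) * (1 + y)))"
      using value_mean_slope[OF y] by blast
    have Ku: "K x * (1 - \<delta>) ^ (4 * n + 1) \<le> K u"
    proof -
      have "K x * (1 - \<delta>) ^ (4 * n + 1) \<le> K x * ((1 + u) / (1 + x)) ^ (4 * n + 1)"
        unfolding \<delta>(3) using u y x K_ge_1[of x] by (intro mult_left_mono power_mono divide_right_mono) auto
      also have "\<dots> \<le> K u" using K_growth u y by simp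
      finally show ?thesis .
    qed
    have gu: "gap y * (1 - \<delta>) ^ (2 * n) \<le> gap u"
      using gap_growth_up[of y u x] u y by (simp add: \<delta>(3))
    have key: "\<epsilon> * gap y < gap u * K u * W"
    proof (cases "gap y = 0")
      case True
      \<comment> \<open>Maxine has staked her whole fortune, y = 0, and there is a level above the current one.\<close>
      have "0 < gap u" "0 < K u" using gap_pos[of u] K_ge_1[of u] u y by auto
      with True W0 show ?thesis by simp
    next
      case False
      then have gy: "0 < gap y" using gap_nonneg[OF y(1)] by simp
      have "\<epsilon> * gap y = gap y * K x * s" using s0 by (simp add: mult_ac)
      also have "\<dots> < gap y * K x * ((1 - real n ^ 5 * \<delta>) * W)"
      proof (rule mult_strict_left_mono)
        show "s < (1 - real n ^ 5 * \<delta>) * W"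
          using dominate_up[of \<delta> s] \<delta>(1) \<open>\<not> \<epsilon> \<le> \<delta>\<close> s0 unfolding W_def by linarith
      qed (use gy K_ge_1[of x] x in auto)
      also have "\<dots> = gap y * K x * (1 - real n ^ 5 * \<delta>) * W" by simp
      also have "\<dots> \<le> gap y * K x * ((1 - \<delta>) ^ (2 * n) * (1 - \<delta>) ^ (4 * n + 1)) * W"
        using power_loss_maxine[OF less_imp_le[OF \<delta>(1)] \<delta>(2)] gy K_ge_1[of x] x W0
        by (intro mult_right_mono mult_left_mono) auto
      also have "\<dots> = (gap y * (1 - \<delta>) ^ (2 * n)) * (K x * (1 - \<delta>) ^ (4 * n + 1)) * W"
        by (simp add: mult_ac)
      also have "\<dots> \<le> gap u * K u * W"
        using Ku gu \<delta> W0 K_ge_1[of x] K_ge_1[of u] gap_nonneg[of u] gap_nonneg[of y] u y x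
        by (intro mult_right_mono mult_mono) (auto intro!: mult_nonneg_nonneg)
      finally show ?thesis .
    qed
    have "turn_value \<epsilon> d ks y (a / (a + s)) - h x
        = (x - y) / ((1 + x) * (1 + y)) * (\<epsilon> * gap y / W - gap u * K u)"
      using x y by (intro turn_value_diff as C aW) (auto simp: a_def)
    also have "\<dots> < 0"
    proof (rule mult_pos_neg)
      show "0 < (x - y) / ((1 + x) * (1 + y))" using x y by (intro divide_pos_pos) auto
      show "\<epsilon> * gap y / W - gap u * K u < 0" using key W0 by (simp add: field_simps)
    qed
    finally show ?thesis by (simp add: a_def)
  qed
qed

text \<open>Maxine stakes too little. As stakes are nonnegative, \<open>\<delta> < 2 * \<epsilon>\<close>, so that the estimate for small \<open>\<delta>\<close>
  covers all cases.\<close>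

lemma maxine_up:
  assumes x: "0 < x" and y: "x < y" "0 \<le> x - y * (1 - s)" and s: "s = stake \<epsilon> d ks x"
  shows "turn_value \<epsilon> d ks y ((x - y * (1 - s)) / (x - y * (1 - s) + s)) < h x"
proof -
  have s0: "0 < s" "s \<le> \<epsilon>" "s * K x = \<epsilon>" using stake_bounds[of x] stake_K[of x] x s by auto
  define a where "a = x - y * (1 - s)"
  define \<delta> where "\<delta> = (y - x) / (1 + x)"
  define W where "W = s - \<delta> * (1 - s)"
  have as: "0 < a + s" using s0 y by (simp add: a_def)
  have aW: "a + s = (1 + x) * W"
  proof -
    have "(1 + x) * W = (1 + x) * s - (1 + x) * \<delta> * (1 - s)" by (simp add: W_def algebra_simps)
    also have "(1 + x) * \<delta> = y - x" using x by (simp add: \<delta>_def)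
    finally show ?thesis by (simp add: a_def algebra_simps)
  qed
  have W0: "0 < W" using as x unfolding aW by (simp add: zero_less_mult_iff)
  have \<delta>0: "0 < \<delta>" using x y by (simp add: \<delta>_def)
  have \<delta>1: "\<delta> \<le> 1" using small_delta[of \<delta> s] \<delta>0 s0 W0 eps_small by (simp add: W_def)
  have r: "1 - \<delta> \<le> (1 + x) / (1 + y)"
  proof -
    have "\<delta> * (1 + x) = y - x" using x by (simp add: \<delta>_def)
    then have "1 + y = (1 + \<delta>) * (1 + x)" by (simp add: algebra_simps)
    then have "(1 + x) / (1 + y) = 1 / (1 + \<delta>)" using x by simp
    moreover have "(1 - \<delta>) * (1 + \<delta>) \<le> 1" using zero_le_power2[of \<delta>] by (simp add: algebra_simps power2_eq_square)
    ultimately show ?thesis using \<delta>0 by (simp add: pos_le_divide_eq)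
  qed
  obtain u where u: "x < u" "u < y" and C: "h x - h y = gap u * K u * ((x - y) / ((1 + x) * (1 + y)))"
    using value_mean_slope_up[of x y] x y by auto
  have Ku0: "0 < K u" and gu0: "0 < gap u" using K_ge_1[of u] gap_pos[of u] u x by auto
  have Ku: "K u * (1 - \<delta>) ^ (4 * n + 1) \<le> K x"
  proof -
    have "(1 + x) / (1 + y) \<le> (1 + x) / (1 + u)" using u x by (intro divide_left_mono) auto
    then have "K u * (1 - \<delta>) ^ (4 * n + 1) \<le> K u * ((1 + x) / (1 + u)) ^ (4 * n + 1)"
      using r \<delta>1 Ku0 by (intro mult_left_mono power_mono) auto
    also have "\<dots> \<le> K x" using K_growth u x by simp
    finally show ?thesis .
  qed
  have gu: "gap u * (1 - \<delta>) ^ (2 * n) \<le> gap y"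
  proof -
    have "gap u * (1 - \<delta>) ^ (2 * n) \<le> gap u * ((1 + u) / (1 + y)) ^ (2 * n)"
    proof (intro mult_left_mono power_mono)
      have "(1 + x) / (1 + y) \<le> (1 + u) / (1 + y)" using u x by (intro divide_right_mono) auto
      with r show "1 - \<delta> \<le> (1 + u) / (1 + y)" by simp
    qed (use \<delta>1 gu0 in auto)
    also have "\<dots> \<le> gap y" using gap_growth_up[of u y y] u x by simp
    finally show ?thesis .
  qed
  have "gap u * K u * W < gap u * K u * (s * (1 - real n ^ 5 * \<delta>))"
    using dominate_down[of \<delta> s] \<delta>0 s0 gu0 Ku0 by (intro mult_strict_left_mono) (auto simp: W_def)
  also have "\<dots> = s * (gap u * K u * (1 - real n ^ 5 * \<delta>))" by simp
  also have "\<dots> \<le> s * (gap u * K u * ((1 - \<delta>) ^ (2 * n) * (1 - \<delta>) ^ (4 * n + 1)))"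
    using power_loss_maxine[of \<delta>] \<delta>0 \<delta>1 s0 gu0 Ku0 by (intro mult_left_mono) auto
  also have "\<dots> = s * ((gap u * (1 - \<delta>) ^ (2 * n)) * (K u * (1 - \<delta>) ^ (4 * n + 1)))"
    by (simp add: mult_ac)
  also have "\<dots> \<le> s * (gap y * K x)"
    using Ku gu \<delta>1 s0 gu0 Ku0 gap_nonneg[of y] x y by (intro mult_left_mono mult_mono) auto
  also have "\<dots> = \<epsilon> * gap y" using s0 by (simp add: mult_ac)
  finally have key: "gap u * K u * W < \<epsilon> * gap y" .
  have "turn_value \<epsilon> d ks y (a / (a + s)) - h x
      = (x - y) / ((1 + x) * (1 + y)) * (\<epsilon> * gap y / W - gap u * K u)"
    using x y by (intro turn_value_diff as C aW) (auto simp: a_def)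
  also have "\<dots> < 0"
  proof (rule mult_neg_pos)
    show "(x - y) / ((1 + x) * (1 + y)) < 0" using x y by (intro divide_neg_pos) auto
    show "0 < \<epsilon> * gap y / W - gap u * K u" using key W0 by (simp add: field_simps)
  qed
  finally show ?thesis by (simp add: a_def)
qed

section \<open>Deviations of Mina in one turn\<close>

lemma mina_up_stakes:
  assumes x: "0 < x" and y: "x < y" and s: "s = stake \<epsilon> d ks x"
    and \<delta>: "\<delta> = (y - x) / (y * (1 + x))" and W: "W = \<delta> + s - s * \<delta>" and b: "b = 1 - x * (1 - s) / y"
  shows "0 < \<delta>" "\<delta> < 1" "1 - \<delta> = x / (1 + x) / (y / (1 + y))" "s \<le> W" "0 < W"
    "x - x * s = y * (1 - b)" "x * s + b = (1 + x) * W" "0 < x * s + b"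
proof -
  have s0: "0 < s" "s \<le> \<epsilon>" using stake_bounds[of x] x s by auto
  have y0: "0 < y" using x y by simp
  show \<delta>0: "0 < \<delta>" using x y by (simp add: \<delta>)
  show \<delta>r: "1 - \<delta> = x / (1 + x) / (y / (1 + y))"
  proof -
    have "\<delta> * (y * (1 + x)) = y - x" using x y0 by (simp add: \<delta>)
    then have "(1 - \<delta>) * (y * (1 + x)) = x * (1 + y)" by (simp add: algebra_simps)
    then have "1 - \<delta> = x * (1 + y) / (y * (1 + x))" using x y0 by (simp add: eq_divide_eq)
    then show ?thesis by (simp add: mult.commute)
  qed
  have "0 < 1 - \<delta>" unfolding \<delta>r using x y0 by simp
  then show "\<delta> < 1" by simp
  have s1: "s < 1" using s0 eps_small by simp
  have "s * \<delta> \<le> 1 * \<delta>" using \<delta>0 s1 by (intro mult_right_mono) auto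
  then show W0: "s \<le> W" "0 < W" using s0 by (auto simp: W)
  have "y * (1 - b) = x * (1 - s)" using y0 by (simp add: b)
  then show "x - x * s = y * (1 - b)" by (simp add: algebra_simps)
  show aW: "x * s + b = (1 + x) * W"
  proof -
    have "(1 + x) * W = (1 + x) * \<delta> * (1 - s) + (1 + x) * s" by (simp add: W algebra_simps)
    also have "(1 + x) * \<delta> = (y - x) / y" using x y0 by (simp add: \<delta>)
    also have "(y - x) / y = 1 - x / y" using y0 by (simp add: diff_divide_distrib)
    finally show ?thesis by (simp add: b algebra_simps)
  qed
  show "0 < x * s + b" using aW W0 x by simp
qed

text \<open>Mina stakes too much, but moderately so. The difference is bounded below in terms of the surplus
  of \<open>dominate_up\<close>, which allows the limit \<open>y \<rightarrow> \<infinity>\<close> to be taken with a strict inequality.\<close>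

lemma mina_up_local:
  assumes x: "0 < x" and y: "x < y" and s: "s = stake \<epsilon> d ks x"
    and \<delta>: "\<delta> = (y - x) / (y * (1 + x))" "\<delta> < \<epsilon>" and W: "W = \<delta> + s - s * \<delta>"
  shows "gap y * (K x * (((1 - real n ^ 5 * \<delta>) * W - s) / W)) * ((y - x) / ((1 + x) * (1 + y)))
    \<le> turn_value \<epsilon> d ks y (x * s / (x * s + (1 - x * (1 - s) / y))) - h x"
proof -
  have s0: "0 < s" "s \<le> \<epsilon>" "s * K x = \<epsilon>" using stake_bounds[of x] stake_K[of x] x s by auto
  have y0: "0 < y" using x y by simp
  define b where "b = 1 - x * (1 - s) / y"
  note S = mina_up_stakes[OF x y s \<delta>(1) W b_def]
  note \<delta>0 = S(1) and \<delta>1 = S(2) and \<delta>r = S(3) and W0 = S(4,5) and yb = S(6) and aW = S(7) and as = S(8)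
  obtain u where u: "x < u" "u < y" and C: "h x - h y = gap u * K u * ((x - y) / ((1 + x) * (1 + y)))"
    using value_mean_slope_up[of x y] x y by auto
  have pu: "x / (1 + x) \<le> u / (1 + u)" "u / (1 + u) \<le> y / (1 + y)" "y / (1 + y) \<le> 1"
    using u x by (auto simp: field_simps)
  have c: "8 * real n ^ 3 * \<delta> \<le> 1" using cube_small[of \<delta>] \<delta>0 \<delta>(2) \<epsilon> by simp
  have Kx0: "0 < K x" and Ku0: "0 < K u" and gu0: "0 < gap u" and gy0: "0 < gap y"
    using K_ge_1[of u] K_ge_1[of x] gap_pos u x by auto
  have Ku: "K x * ((1 - \<delta>) * (1 - 8 * real n ^ 3 * \<delta>)) \<le> K u"
  proof -
    define q where "q = 1 - 8 * real n ^ 3 * (u / (1 + u) - x / (1 + x))"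
    have "u / (1 + u) - x / (1 + x) \<le> y / (1 + y) - x / (1 + x)" using pu by simp
    also have "\<dots> = y / (1 + y) * \<delta>"
    proof -
      have "\<delta> = 1 - x / (1 + x) / (y / (1 + y))" using \<delta>r by simp
      then show ?thesis using y0 x by (simp add: right_diff_distrib)
    qed
    also have "\<dots> \<le> 1 * \<delta>" using pu \<delta>0 by (intro mult_right_mono) auto
    finally have q: "1 - 8 * real n ^ 3 * \<delta> \<le> q" unfolding q_def
      by (intro diff_left_mono mult_left_mono) auto
    have "1 - \<delta> \<le> x / (1 + x) / (u / (1 + u))"
      unfolding \<delta>r using pu x u y0 by (intro divide_left_mono) auto
    then have "(1 - \<delta>) * (1 - 8 * real n ^ 3 * \<delta>) \<le> x / (1 + x) / (u / (1 + u)) * q"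
      using q c \<delta>1 x u by (intro mult_mono) auto
    then have "K x * ((1 - \<delta>) * (1 - 8 * real n ^ 3 * \<delta>)) \<le> K x * (x / (1 + x) / (u / (1 + u)) * q)"
      using Kx0 by (intro mult_left_mono) auto
    also have "\<dots> = (P x * q) / (u / (1 + u))" using K_P[OF x] x by simp
    also have "\<dots> \<le> P u / (u / (1 + u))"
      using P_growth[of x u] x u unfolding q_def[symmetric] by (intro divide_right_mono) auto
    also have "\<dots> = K u" using K_P[of u] x u by simp
    finally show ?thesis .
  qed
  have gu: "gap y * (1 - \<delta>) ^ (2 * n * n) \<le> gap u"
  proof -
    have "1 - \<delta> \<le> u / (1 + u) / (y / (1 + y))"
      unfolding \<delta>r using pu y0 by (intro divide_right_mono) auto
    then have "gap y * (1 - \<delta>) ^ (2 * n * n) \<le> gap y * (u / (1 + u) / (y / (1 + y))) ^ (2 * n * n)"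
      using \<delta>1 gy0 by (intro mult_left_mono power_mono) auto
    also have "\<dots> \<le> gap u" using gap_growth_down[of u y] u x by simp
    finally show ?thesis .
  qed
  define m where "m = (y - x) / ((1 + x) * (1 + y))"
  have m0: "0 \<le> m" using x y by (simp add: m_def)
  have "gap y * (K x * (1 - real n ^ 5 * \<delta>))
      \<le> gap y * (K x * ((1 - \<delta>) ^ (2 * n * n) * ((1 - \<delta>) * (1 - 8 * real n ^ 3 * \<delta>))))"
    using power_loss_mina[of \<delta>] \<delta>0 c gy0 Kx0 by (intro mult_left_mono) auto
  also have "\<dots> = (gap y * (1 - \<delta>) ^ (2 * n * n)) * (K x * ((1 - \<delta>) * (1 - 8 * real n ^ 3 * \<delta>)))"
    by (simp only: mult_ac)
  also have "\<dots> \<le> gap u * K u"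
    using Ku gu \<delta>1 c Kx0 gy0 gu0 by (intro mult_mono) (auto intro!: mult_nonneg_nonneg)
  finally have key: "gap y * (K x * (1 - real n ^ 5 * \<delta>)) \<le> gap u * K u" .
  have "turn_value \<epsilon> d ks y (x * s / (x * s + b)) - h x
      = (x - y) / ((1 + x) * (1 + y)) * (\<epsilon> * gap y / W - gap u * K u)"
    using x y0 yb by (intro turn_value_diff as C aW) auto
  also have "(x - y) / ((1 + x) * (1 + y)) = - m"
    unfolding m_def minus_divide_left by simp
  also have "- m * (\<epsilon> * gap y / W - gap u * K u) = (gap u * K u - \<epsilon> * gap y / W) * m"
    by (simp add: algebra_simps)
  also have "\<epsilon> * gap y / W = gap y * (K x * (s / W))"
    unfolding s0(3)[symmetric] by simp
  finally have eq: "turn_value \<epsilon> d ks y (x * s / (x * s + b)) - h x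
      = (gap u * K u - gap y * (K x * (s / W))) * m" .
  have "gap y * (K x * (((1 - real n ^ 5 * \<delta>) * W - s) / W))
      = gap y * (K x * (1 - real n ^ 5 * \<delta>)) - gap y * (K x * (s / W))"
    using W0 by (simp add: diff_divide_distrib right_diff_distrib)
  also have "\<dots> \<le> gap u * K u - gap y * (K x * (s / W))" using key by simp
  finally have "gap y * (K x * (((1 - real n ^ 5 * \<delta>) * W - s) / W)) * m
      \<le> (gap u * K u - gap y * (K x * (s / W))) * m"
    using m0 by (rule mult_right_mono)
  then have "gap y * (K x * (((1 - real n ^ 5 * \<delta>) * W - s) / W)) * m
      \<le> turn_value \<epsilon> d ks y (x * s / (x * s + b)) - h x" unfolding eq .
  then show ?thesis unfolding b_def m_def .
qed

lemma mina_up: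
  assumes x: "0 < x" and y: "x < y" and s: "s = stake \<epsilon> d ks x"
  shows "h x < turn_value \<epsilon> d ks y (x * s / (x * s + (1 - x * (1 - s) / y)))"
proof -
  have s0: "0 < s" "s \<le> \<epsilon>" "s * K x = \<epsilon>" using stake_bounds[of x] stake_K[of x] x s by auto
  have y0: "0 < y" using x y by simp
  define b where "b = 1 - x * (1 - s) / y"
  define \<delta> where "\<delta> = (y - x) / (y * (1 + x))"
  define W where "W = \<delta> + s - s * \<delta>"
  note S = mina_up_stakes[OF x y s \<delta>_def W_def b_def]
  note \<delta>0 = S(1) and W0 = S(4,5) and yb = S(6) and as = S(8)
  show ?thesis
  proof (cases "\<epsilon> \<le> \<delta>")
    case True
    \<comment> \<open>The probability 1 / geo d of a fall at the current level shrinks so much that a move, made with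
      probability \<epsilon>, cannot compensate Mina.\<close>
    define \<sigma> where "\<sigma> = (y - x) / (y * (x * s + b))"
    have "y * (x * s + b) = (y - x) + x * s * (1 + y)" using yb by (simp add: algebra_simps)
    then have \<sigma>: "0 < \<sigma>" "\<sigma> < 1" using s0 x y y0 by (auto simp: \<sigma>_def add_pos_pos)
    have q: "x * s / (x * s + b) - y / (1 + y) = - (\<sigma> * y / (1 + y))"
    proof -
      have "x * s / (x * s + b) - y / (1 + y) = (x * s - y * b) / ((x * s + b) * (1 + y))"
        using as y0 by (simp add: field_simps)
      also have "x * s - y * b = - (\<sigma> * (y * (x * s + b)))"
      proof -
        have "\<sigma> * (y * (x * s + b)) = y - x" using as y0 by (simp add: \<sigma>_def)
        then show ?thesis using yb by (simp add: right_diff_distrib)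
      qed
      also have "- (\<sigma> * (y * (x * s + b))) / ((x * s + b) * (1 + y)) = - (\<sigma> * y / (1 + y))"
        using as by simp
      finally show ?thesis .
    qed
    have posy: "0 < geo d y" and posx: "0 < geo d x" using geo_pos x y by auto
    have "h x = g x * (1 - 1 / geo d x)" by (simp add: escape_Cons climb_def)
    also have "\<dots> \<le> g y * (1 - 1 / geo d x)"
      using escape_mono[of x y ks] x y geo_ge_1[of x d] by (intro mult_right_mono) auto
    also have "\<dots> < g y * (1 - (1 + \<epsilon> * \<sigma> * y) / geo d y)"
    proof -
      have "(1 + \<epsilon> * \<sigma> * y) * (1 + x) < 1 + y"
      proof -
        have "\<epsilon> * \<sigma> < \<epsilon> * 1" using \<sigma> \<epsilon> by (intro mult_strict_left_mono) auto
        then have "\<epsilon> * \<sigma> * (y * (1 + x)) < \<delta> * (y * (1 + x))"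
          using True x y0 by (intro mult_strict_right_mono) auto
        also have "\<dots> = y - x" using x y0 by (simp add: \<delta>_def)
        finally show ?thesis by (simp add: algebra_simps)
      qed
      then have "(1 + \<epsilon> * \<sigma> * y) * (1 + x) * geo d x < (1 + y) * geo d x"
        using posx by (intro mult_strict_right_mono) auto
      also have "\<dots> \<le> geo d y * (1 + x)"
        using geo_over_1_mono[of d x y] d x y by (simp add: mult.commute)
      finally have "((1 + \<epsilon> * \<sigma> * y) * geo d x) * (1 + x) < geo d y * (1 + x)" by (simp only: mult_ac)
      then have "(1 + \<epsilon> * \<sigma> * y) * geo d x < geo d y"
        using x by (simp only: mult_less_cancel_right_pos)
      then have "(1 + \<epsilon> * \<sigma> * y) / geo d y < 1 / geo d x" using posx posy by (simp add: field_simps)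
      moreover have "0 < g y" using escape_pos y0 ks by auto
      ultimately show ?thesis by simp
    qed
    also have "\<dots> = climb d y * g y - \<epsilon> * (\<sigma> * y * g y / geo d y)"
      by (simp add: climb_def algebra_simps diff_divide_distrib add_divide_distrib)
    also have "\<dots> = turn_value \<epsilon> d ks y (x * s / (x * s + b))"
      unfolding turn_value_eq[OF less_imp_le[OF y0]] q using y0 by (simp add: gap_def escape_Cons)
    finally show ?thesis by (simp add: b_def)
  next
    case False
    have gy0: "0 < gap y" and Kx0: "0 < K x" using gap_pos[OF y0] K_ge_1[of x] x by auto
    have dom: "s < (1 - real n ^ 5 * \<delta>) * W"
      using dominate_up[of \<delta> s] \<delta>0 False s0 unfolding W_def by linarith
    have "0 < gap y * (K x * (((1 - real n ^ 5 * \<delta>) * W - s) / W)) * ((y - x) / ((1 + x) * (1 + y)))"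
      using dom gy0 Kx0 W0 x y by (intro mult_pos_pos divide_pos_pos) auto
    also have "\<dots> \<le> turn_value \<epsilon> d ks y (x * s / (x * s + (1 - x * (1 - s) / y))) - h x"
      using False by (intro mina_up_local x y s \<delta>_def W_def) auto
    finally show ?thesis by simp
  qed
qed

text \<open>Mina stakes everything, and the only way for her to win is a move to a leaf at once. If
  \<open>\<epsilon> > 1 / (1 + x)\<close>, this is the limit of \<open>mina_up\<close> as \<open>y \<rightarrow> \<infinity>\<close>, in which the inequality stays strict
  because the surplus is bounded below by a constant \<open>c\<close> for large \<open>y\<close>.\<close>

lemma mina_bankrupt:
  assumes x: "0 < x" and d1: "d = 1" and s: "s = stake \<epsilon> d ks x"
  shows "h x < (1 - \<epsilon>) + \<epsilon> * (x * s / (x * s + 1))"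
proof -
  have s0: "0 < s" "s \<le> \<epsilon>" "s * K x = \<epsilon>" using stake_bounds[of x] stake_K[of x] x s by auto
  have q0: "0 < x * s / (x * s + 1)" using x s0 by (simp add: add_pos_pos)
  have geo1: "geo d y = 1 + y" for y using geo_Suc[of 0 y] d1 by simp
  show ?thesis
  proof (cases "\<epsilon> \<le> 1 / (1 + x)")
    case True
    have "h x \<le> climb d x * 1"
      unfolding escape_Cons using escape_le_1 x climb_nonneg by (intro mult_left_mono) auto
    also have "\<dots> \<le> 1 - \<epsilon>" using True by (simp add: climb_def geo1)
    also have "\<dots> < (1 - \<epsilon>) + \<epsilon> * (x * s / (x * s + 1))" using mult_pos_pos[OF \<epsilon>(1) q0] by linarith
    finally show ?thesis .
  next
    case False
    \<comment> \<open>Lower bounds, for y \<ge> 2 x + 1, of the gap, of K times the surplus \<delta> / 4 with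
      \<delta> \<ge> 1 / (2 (1 + x)), and of the increase of x / (1 + x).\<close>
    define c where "c = g x * (1 * (1 / (2 * (1 + x)) / 4)) * (1 / (4 * (1 + x)))"
    have gx: "0 < g x" using escape_pos x ks by auto
    have c0: "0 < c" using gx x by (simp add: c_def)
    have bound: "h x + c \<le> (1 - \<epsilon>) + \<epsilon> * (x * s / (x * s + (1 - x * (1 - s) / y)))" if y: "2 * x + 1 \<le> y" for y
    proof -
      have xy: "x < y" "0 < y" using x y by auto
      define \<delta> where "\<delta> = (y - x) / (y * (1 + x))"
      define W where "W = \<delta> + s - s * \<delta>"
      have "(y - x) / y < 1" using x xy by simp
      then have "(y - x) / y / (1 + x) < 1 / (1 + x)" using x by (intro divide_strict_right_mono) auto
      then have d_up: "\<delta> < 1 / (1 + x)" by (simp add: \<delta>_def)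
      have d_lo: "1 / (2 * (1 + x)) \<le> \<delta>"
      proof -
        have "1 / 2 \<le> (y - x) / y" using x y by (simp add: pos_le_divide_eq)
        then have "1 / 2 / (1 + x) \<le> (y - x) / y / (1 + x)" using x by (intro divide_right_mono) auto
        then show ?thesis by (simp add: \<delta>_def)
      qed
      have dpos: "0 < \<delta>" "\<delta> < \<epsilon>" using d_up d_lo False x xy by (auto simp: \<delta>_def)
      have s1: "s \<le> 1 / 4" "\<delta> \<le> 1 / 4" using s0 eps_small dpos by auto
      have "s * \<delta> \<le> 1 * \<delta>" using dpos s1 by (intro mult_right_mono) auto
      then have W0: "0 < W" "W \<le> 1"
        unfolding W_def using s0(1) s1 dpos mult_pos_pos[OF s0(1) dpos(1)] by linarith+
      have g1: "g x \<le> gap y"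
        using escape_mono[of x y ks] x xy by (simp add: gap_def geo1)
      have dom: "\<delta> / 4 \<le> ((1 - real n ^ 5 * \<delta>) * W - s) / W"
      proof -
        have "\<delta> / 4 \<le> (1 - real n ^ 5 * \<delta>) * W - s"
          using dominate_up[of \<delta> s] dpos s0 unfolding W_def by linarith
        moreover have "\<delta> / 4 * W \<le> \<delta> / 4 * 1" using W0 dpos by (intro mult_left_mono) auto
        ultimately show ?thesis using W0 by (simp add: pos_le_divide_eq)
      qed
      have m: "1 / (4 * (1 + x)) \<le> (y - x) / ((1 + x) * (1 + y))"
      proof -
        have "1 / 4 \<le> (y - x) / (1 + y)" using x y by (simp add: pos_le_divide_eq)
        then have "1 / 4 / (1 + x) \<le> (y - x) / (1 + y) / (1 + x)" using x by (intro divide_right_mono) auto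
        then show ?thesis by (simp add: mult.commute)
      qed
      have "c \<le> gap y * (K x * (((1 - real n ^ 5 * \<delta>) * W - s) / W)) * ((y - x) / ((1 + x) * (1 + y)))"
        unfolding c_def
      proof (intro mult_mono m g1 mult_nonneg_nonneg)
        show "1 / (2 * (1 + x)) / 4 \<le> ((1 - real n ^ 5 * \<delta>) * W - s) / W"
          by (rule order.trans[OF divide_right_mono[OF d_lo] dom]) simp
        show "0 \<le> ((1 - real n ^ 5 * \<delta>) * W - s) / W"
          by (rule order.trans[OF _ dom]) (use dpos in simp)
        show "1 \<le> K x" "0 \<le> K x" using K_ge_1[of x] x by auto
      qed (use gx x xy gap_pos[of y] K_ge_1[of x] in auto)
      also have "\<dots> \<le> turn_value \<epsilon> d ks y (x * s / (x * s + (1 - x * (1 - s) / y))) - h x"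
        using dpos by (intro mina_up_local x xy s \<delta>_def W_def) auto
      finally have 1: "h x + c \<le> turn_value \<epsilon> d ks y (x * s / (x * s + (1 - x * (1 - s) / y)))" by simp
      define q where "q = x * s / (x * s + (1 - x * (1 - s) / y))"
      have "x * (1 - s) \<le> y" using xy mult_pos_pos[OF x s0(1)] by (simp add: right_diff_distrib)
      then have "x * (1 - s) / y \<le> 1" using xy by simp
      then have "0 \<le> q" using x s0 by (simp add: q_def)
      have "turn_value \<epsilon> d ks y q = (1 - \<epsilon>) * h y + \<epsilon> * (q * g y)"
        by (simp add: turn_value_def d1)
      also have "\<dots> \<le> (1 - \<epsilon>) * 1 + \<epsilon> * (q * 1)"
        using escape_le_1[of y] xy \<epsilon> eps_small \<open>0 \<le> q\<close> by (intro add_mono mult_left_mono) auto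
      finally show ?thesis using 1 by (simp add: q_def)
    qed
    have "((\<lambda>y. (1 - \<epsilon>) + \<epsilon> * (x * s / (x * s + (1 - x * (1 - s) / y)))) \<longlongrightarrow>
        (1 - \<epsilon>) + \<epsilon> * (x * s / (x * s + (1 - 0)))) at_top"
    proof (intro tendsto_intros)
      show "((\<lambda>y. x * (1 - s) / y) \<longlongrightarrow> 0) at_top"
        by (rule tendsto_divide_0[OF tendsto_const filterlim_at_top_imp_at_infinity[OF filterlim_ident]])
      show "x * s + (1 - 0) \<noteq> 0" using mult_pos_pos[OF x s0(1)] by linarith
    qed
    moreover have "\<forall>\<^sub>F y in at_top. h x + c \<le> (1 - \<epsilon>) + \<epsilon> * (x * s / (x * s + (1 - x * (1 - s) / y)))"
      using eventually_ge_at_top[of "2 * x + 1"] by (rule eventually_mono) (rule bound)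
    ultimately have "h x + c \<le> (1 - \<epsilon>) + \<epsilon> * (x * s / (x * s + (1 - 0)))"
      by (rule tendsto_lowerbound) simp
    then show ?thesis using c0 by simp
  qed
qed

text \<open>Mina stakes too little. The number \<open>\<delta>\<close> measures the change of \<open>p = x / (1 + x)\<close>, as
  \<open>px = py * (1 + \<delta>)\<close>, which is why the growth bounds in \<open>p\<close> are the ones that apply.\<close>

lemma mina_down:
  assumes x: "0 < x" and y: "0 < y" "y < x" "0 \<le> 1 - x * (1 - s) / y" and s: "s = stake \<epsilon> d ks x"
  shows "h x < turn_value \<epsilon> d ks y (x * s / (x * s + (1 - x * (1 - s) / y)))"
proof -
  have s0: "0 < s" "s \<le> \<epsilon>" "s * K x = \<epsilon>" using stake_bounds[of x] stake_K[of x] x s by auto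
  define b where "b = 1 - x * (1 - s) / y"
  define \<delta> where "\<delta> = (x - y) / (y * (1 + x))"
  define W where "W = s - \<delta> * (1 - s)"
  have \<delta>0: "0 < \<delta>" using x y by (simp add: \<delta>_def)
  have "y * (1 - b) = x * (1 - s)" using y(1) by (simp add: b_def)
  then have yb: "x - x * s = y * (1 - b)" by (simp add: algebra_simps)
  have as: "0 < x * s + b" using s0 x y by (simp add: b_def add_pos_nonneg)
  have aW: "x * s + b = (1 + x) * W"
  proof -
    have "(1 + x) * W = (1 + x) * s - (1 + x) * \<delta> * (1 - s)" by (simp add: W_def algebra_simps)
    also have "(1 + x) * \<delta> = (x - y) / y" using x y by (simp add: \<delta>_def)
    also have "(x - y) / y = x / y - 1" using y by (simp add: diff_divide_distrib)
    finally show ?thesis by (simp add: b_def algebra_simps)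
  qed
  have W0: "0 < W" using as x unfolding aW by (simp add: zero_less_mult_iff)
  have \<delta>2: "\<delta> < 2 * \<epsilon>" using small_delta[of \<delta> s] \<delta>0 s0 W0 by (simp add: W_def)
  have \<delta>1: "\<delta> < 1" using \<delta>2 eps_small by simp
  have c: "8 * real n ^ 3 * \<delta> \<le> 1" using cube_small[of \<delta>] \<delta>0 \<delta>2 by simp
  define px py where "px = x / (1 + x)" and "py = y / (1 + y)"
  have p0: "0 < px" "0 < py" "px \<le> 1" "py \<le> 1" using x y by (auto simp: px_def py_def)
  have pd: "px = py * (1 + \<delta>)"
  proof -
    have "\<delta> * (y * (1 + x)) = x - y" using x y by (simp add: \<delta>_def)
    then have "y * (1 + \<delta>) * (1 + x) = x * (1 + y)" by (simp add: algebra_simps)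
    then show ?thesis using x y by (simp add: px_def py_def divide_eq_eq eq_divide_eq mult_ac)
  qed
  have r: "1 - \<delta> \<le> py / px"
  proof -
    have "py / px = 1 / (1 + \<delta>)" using p0 \<delta>0 by (simp add: pd)
    moreover have "(1 - \<delta>) * (1 + \<delta>) \<le> 1" using zero_le_power2[of \<delta>] by (simp add: algebra_simps power2_eq_square)
    ultimately show ?thesis using \<delta>0 by (simp add: pos_le_divide_eq)
  qed
  obtain u where u: "y < u" "u < x" and C: "h x - h y = gap u * K u * ((x - y) / ((1 + x) * (1 + y)))"
    using value_mean_slope[of y x] x y by auto
  define pu where "pu = u / (1 + u)"
  have pu: "py \<le> pu" "pu \<le> px" "0 < pu" using u x y by (auto simp: pu_def px_def py_def field_simps)
  have Kx0: "0 < K x" and Ku0: "0 < K u" and gu0: "0 < gap u" and gy0: "0 < gap y"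
    using K_ge_1[of u] K_ge_1[of x] gap_pos u x y by auto
  have Ku: "K u * ((1 - \<delta>) * (1 - 8 * real n ^ 3 * \<delta>)) \<le> K x"
  proof -
    define q where "q = 1 - 8 * real n ^ 3 * (px - pu)"
    have "px - pu \<le> px - py" using pu by simp
    also have "\<dots> = py * \<delta>" by (simp add: pd algebra_simps)
    also have "\<dots> \<le> 1 * \<delta>" using p0 \<delta>0 by (intro mult_right_mono) auto
    finally have q: "1 - 8 * real n ^ 3 * \<delta> \<le> q" unfolding q_def
      by (intro diff_left_mono mult_left_mono) auto
    have "py / px \<le> pu / px" using pu p0 by (intro divide_right_mono) auto
    with r have "1 - \<delta> \<le> pu / px" by simp
    then have "(1 - \<delta>) * (1 - 8 * real n ^ 3 * \<delta>) \<le> pu / px * q"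
      using q c \<delta>1 pu p0 by (intro mult_mono) auto
    then have "K u * ((1 - \<delta>) * (1 - 8 * real n ^ 3 * \<delta>)) \<le> K u * (pu / px * q)"
      using Ku0 by (intro mult_left_mono) auto
    also have "\<dots> = (P u * q) / px" using K_P[of u] u y pu by (simp add: pu_def[symmetric])
    also have "\<dots> \<le> P x / px"
      using P_growth[of u x] y u p0 unfolding q_def px_def pu_def by (intro divide_right_mono) auto
    also have "\<dots> = K x" using K_P[of x] x by (simp add: px_def)
    finally show ?thesis .
  qed
  have gu: "gap u * (1 - \<delta>) ^ (2 * n * n) \<le> gap y"
  proof -
    have "py / px \<le> py / pu" using pu p0 by (intro divide_left_mono) auto
    with r have "gap u * (1 - \<delta>) ^ (2 * n * n) \<le> gap u * (py / pu) ^ (2 * n * n)"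
      using \<delta>1 gu0 by (intro mult_left_mono power_mono) auto
    also have "\<dots> \<le> gap y" using gap_growth_down[of y u] u y by (simp add: py_def pu_def)
    finally show ?thesis .
  qed
  have "gap u * K u * W < gap u * K u * (s * (1 - real n ^ 5 * \<delta>))"
    using dominate_down[of \<delta> s] \<delta>0 s0 gu0 Ku0 by (intro mult_strict_left_mono) (auto simp: W_def)
  also have "\<dots> = s * (gap u * K u * (1 - real n ^ 5 * \<delta>))" by simp
  also have "\<dots> \<le> s * (gap u * K u * ((1 - \<delta>) ^ (2 * n * n) * ((1 - \<delta>) * (1 - 8 * real n ^ 3 * \<delta>))))"
    using power_loss_mina[of \<delta>] \<delta>0 c s0 gu0 Ku0 by (intro mult_left_mono) auto
  also have "\<dots> = s * ((gap u * (1 - \<delta>) ^ (2 * n * n)) * (K u * ((1 - \<delta>) * (1 - 8 * real n ^ 3 * \<delta>))))"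
    by (simp only: mult_ac)
  also have "\<dots> \<le> s * (gap y * K x)"
    using Ku gu \<delta>1 c s0 gu0 Ku0 gy0 by (intro mult_left_mono mult_mono) (auto intro!: mult_nonneg_nonneg)
  also have "\<dots> = \<epsilon> * gap y" using s0 by (simp add: mult_ac)
  finally have key: "gap u * K u * W < \<epsilon> * gap y" .
  have "turn_value \<epsilon> d ks y (x * s / (x * s + b)) - h x
      = (x - y) / ((1 + x) * (1 + y)) * (\<epsilon> * gap y / W - gap u * K u)"
    using x y yb by (intro turn_value_diff as C aW) auto
  also have "\<dots> > 0"
  proof (rule mult_pos_pos)
    show "0 < (x - y) / ((1 + x) * (1 + y))" using x y by (intro divide_pos_pos) auto
    show "0 < \<epsilon> * gap y / W - gap u * K u" using key W0 by (simp add: field_simps)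
  qed
  finally show ?thesis by (simp add: b_def)
qed

section \<open>The saddle point of one turn\<close>

lemma turn_value_equilibrium:
  assumes "0 \<le> x"
  shows "turn_value \<epsilon> d ks x (x / (1 + x)) = h x"
  using turn_value_eq[OF assms, of "x / (1 + x)"] by simp

text \<open>Every stake other than \<open>x * s\<close> changes Maxine's fortune, and both directions cost her.\<close>

theorem maxine_turn:
  assumes x: "0 \<le> x" and a: "0 \<le> a" "a \<le> x"
  defines "s \<equiv> stake \<epsilon> d ks x"
  shows "turn_value \<epsilon> d ks ((x - a) / (1 - s)) (a / (a + s)) \<le> h x"
    and "0 < x \<Longrightarrow> a \<noteq> x * s \<Longrightarrow> turn_value \<epsilon> d ks ((x - a) / (1 - s)) (a / (a + s)) < h x"
proof -
  have s: "0 < s" "s < 1" using stake_bounds[OF x] eps_small unfolding s_def by auto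
  define y where "y = (x - a) / (1 - s)"
  have y: "0 \<le> y" "a = x - y * (1 - s)" using a s by (auto simp: y_def)
  show *: "turn_value \<epsilon> d ks ((x - a) / (1 - s)) (a / (a + s)) < h x" if "0 < x" "a \<noteq> x * s"
  proof -
    have "y \<noteq> x" using that s by (auto simp: y_def field_simps)
    then consider "y < x" | "x < y" by linarith
    then show ?thesis
    proof cases
      case 1
      from maxine_down[OF that(1) y(1) this, of s] show ?thesis
        unfolding y(2)[symmetric] by (simp add: s_def y_def)
    next
      case 2
      from maxine_up[OF that(1) this, of s] a show ?thesis
        unfolding y(2)[symmetric] by (simp add: s_def y_def)
    qed
  qed
  show "turn_value \<epsilon> d ks ((x - a) / (1 - s)) (a / (a + s)) \<le> h x"
  proof (cases "0 < x \<and> a \<noteq> x * s")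
    case True then show ?thesis using * by simp
  next
    case False
    then have "a = x * s" using x a by auto
    moreover have "x * s / (x * s + s) = x / (1 + x)"
    proof -
      have "x * s + s = (1 + x) * s" by (simp add: algebra_simps)
      then show ?thesis using s by simp
    qed
    moreover have "(x - x * s) / (1 - s) = x"
    proof -
      have "x - x * s = x * (1 - s)" by (simp add: algebra_simps)
      then show ?thesis using s by simp
    qed
    ultimately show ?thesis using turn_value_equilibrium[OF x] by simp
  qed
qed

theorem mina_turn:
  assumes x: "0 \<le> x" and b: "0 \<le> b" "b < 1"
  defines "s \<equiv> stake \<epsilon> d ks x"
  shows "h x \<le> turn_value \<epsilon> d ks (x * (1 - s) / (1 - b)) (x * s / (x * s + b))"
    and "0 < x \<Longrightarrow> b \<noteq> s \<Longrightarrow> h x < turn_value \<epsilon> d ks (x * (1 - s) / (1 - b)) (x * s / (x * s + b))"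
proof -
  have s: "0 < s" "s < 1" using stake_bounds[OF x] eps_small unfolding s_def by auto
  define y where "y = x * (1 - s) / (1 - b)"
  show *: "h x < turn_value \<epsilon> d ks (x * (1 - s) / (1 - b)) (x * s / (x * s + b))" if "0 < x" "b \<noteq> s"
  proof -
    have y: "0 < y" "b = 1 - x * (1 - s) / y" using that s b by (auto simp: y_def)
    have "y \<noteq> x" using that s b by (auto simp: y_def field_simps)
    then consider "y < x" | "x < y" by linarith
    then show ?thesis
    proof cases
      case 1
      from mina_down[OF that(1) y(1) this, of s] b show ?thesis
        unfolding y(2)[symmetric] by (simp add: s_def y_def)
    next
      case 2
      from mina_up[OF that(1) this, of s] show ?thesis
        unfolding y(2)[symmetric] by (simp add: s_def y_def)
    qed
  qed
  show "h x \<le> turn_value \<epsilon> d ks (x * (1 - s) / (1 - b)) (x * s / (x * s + b))"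
  proof (cases "0 < x \<and> b \<noteq> s")
    case True then show ?thesis using * by simp
  next
    case False
    then consider "x = 0" | "0 < x" "b = s" by (cases "x = 0") (use x in auto)
    then show ?thesis
    proof cases
      case 1
      then show ?thesis using turn_value_equilibrium[of 0] by simp
    next
      case 2
      have "x * s + s = (1 + x) * s" by (simp add: algebra_simps)
      then have "x * s / (x * s + s) = x / (1 + x)" using s by simp
      then show ?thesis using turn_value_equilibrium[OF x] 2 s by simp
    qed
  qed
qed

end

section \<open>Markov chains with time-dependent kernels\<close>

lemma measurable_coordinate:
  assumes f: "f \<in> S \<rightarrow>\<^sub>M N" and n: "n \<in> I"
  shows "(\<lambda>\<omega>. f (\<omega> n)) \<in> Pi\<^sub>M I (\<lambda>_. S) \<rightarrow>\<^sub>M N"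
proof -
  have "(\<lambda>\<omega>. \<omega> n) \<in> Pi\<^sub>M I (\<lambda>_. S) \<rightarrow>\<^sub>M S"
    by (rule measurable_component_singleton[OF n])
  from measurable_compose[OF this f] show ?thesis .
qed

locale markov_chain =
  fixes S :: "'s measure" and x0 :: 's and K :: "nat \<Rightarrow> 's \<Rightarrow> 's measure"
  assumes K: "\<And>k. K k \<in> S \<rightarrow>\<^sub>M prob_algebra S" and x0: "x0 \<in> space S"
begin

abbreviation "steps \<equiv> chain_steps S x0 K"
abbreviation "law \<equiv> chain_law S x0 K"

lemma K_sub: "K k \<in> S \<rightarrow>\<^sub>M subprob_algebra S"
  using K by (rule measurable_prob_algebraD)

lemma sets_K: "x \<in> space S \<Longrightarrow> sets (K k x) = sets S"
  and prob_K: "x \<in> space S \<Longrightarrow> prob_space (K k x)"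
  using measurable_space[OF K, of x k] by (auto simp: space_prob_algebra dest: sets_eq_imp_space_eq)

lemma measurable_steps: "steps i \<in> Pi\<^sub>M {0..<i} (\<lambda>_. S) \<rightarrow>\<^sub>M subprob_algebra S"
proof (cases i)
  case 0
  have "return S x0 \<in> space (subprob_algebra S)"
    using x0 by (auto simp: space_subprob_algebra prob_space_return prob_space_imp_subprob_space)
  then show ?thesis by (simp add: 0 chain_steps_def[abs_def])
next
  case (Suc k)
  have "(\<lambda>\<omega>. K k (\<omega> k)) \<in> measurable (Pi\<^sub>M {0..<Suc k} (\<lambda>_. S)) (subprob_algebra S)"
    by (rule measurable_coordinate[OF K_sub]) simp
  then show ?thesis by (simp add: Suc chain_steps_def[abs_def])
qed

lemma prob_space_steps:
  assumes "\<omega> \<in> space (Pi\<^sub>M {0..<i} (\<lambda>_. S))"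
  shows "prob_space (steps i \<omega>)"
proof (cases i)
  case 0
  then show ?thesis using x0 by (simp add: chain_steps_def prob_space_return)
next
  case (Suc k)
  then have "\<omega> k \<in> space S" using assms by (auto simp: space_PiM PiE_iff)
  then show ?thesis by (simp add: Suc chain_steps_def prob_K)
qed

sublocale IT: Ionescu_Tulcea steps "\<lambda>_. S"
  by (rule Ionescu_Tulcea.intro) (rule measurable_steps, rule prob_space_steps)

lemma law_eq: "law = IT.PF.lim"
  by (simp add: chain_law_def)

lemma sets_law: "sets law = sets (Pi\<^sub>M UNIV (\<lambda>_. S))"
  by (simp add: law_eq)

lemma space_law: "space law = space (Pi\<^sub>M UNIV (\<lambda>_. S))"
  using sets_law by (rule sets_eq_imp_space_eq)

lemma measurable_law: "measurable law N = measurable (Pi\<^sub>M UNIV (\<lambda>_. S)) N"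
  by (rule measurable_cong_sets[OF sets_law refl])

lemma measurable_prefix: "(\<lambda>\<omega>. restrict \<omega> J) \<in> law \<rightarrow>\<^sub>M Pi\<^sub>M J (\<lambda>_. S)"
  unfolding measurable_law by (rule measurable_restrict_subset) simp

lemma undefined_space: "(\<lambda>_. undefined) \<in> space (Pi\<^sub>M {0..<0::nat} (\<lambda>_. S))"
  by (simp add: space_PiM)

lemma prefix_law:
  "distr law (Pi\<^sub>M {0..<n} (\<lambda>_. S)) (\<lambda>\<omega>. restrict \<omega> {0..<n}) = IT.C 0 n (\<lambda>_. undefined)"
proof -
  have fin: "finite {0..<n}" by simp
  have "\<not> IT.up_to {0..<n} < n"
    using IT.up_to_less[OF fin, of "IT.up_to {0..<n}"] by auto
  moreover have "IT.up_to {0..<n} \<le> n"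
    using IT.up_to_iff[OF fin] by auto
  ultimately have up: "IT.up_to {0..<n} = n" by linarith
  have "distr law (Pi\<^sub>M {0..<n} (\<lambda>_. S)) (\<lambda>\<omega>. restrict \<omega> {0..<n}) = IT.CI {0..<n}"
    unfolding law_eq by (rule IT.distr_lim[OF fin])
  also have "\<dots> = distr (IT.C 0 n (\<lambda>_. undefined)) (Pi\<^sub>M {0..<n} (\<lambda>_. S)) (\<lambda>\<omega>. restrict \<omega> {0..<n})"
    unfolding IT.CI_def up ..
  also have "\<dots> = IT.C 0 n (\<lambda>_. undefined)"
    using IT.distr_C[OF order_refl undefined_space, of n] by (simp only: add_0)
  finally show ?thesis .
qed

lemma prob_law: "prob_space law"
proof -
  have "prob_space (distr law (Pi\<^sub>M {0..<0} (\<lambda>_. S)) (\<lambda>\<omega>. restrict \<omega> {0..<0}))"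
    unfolding prefix_law by (rule IT.prob_space_C[OF undefined_space])
  then show "prob_space law"
    by (rule prob_space_distrD[OF measurable_prefix])
qed

lemma nn_integral_prefix:
  assumes "G \<in> borel_measurable (Pi\<^sub>M {0..<n} (\<lambda>_. S))"
  shows "(\<integral>\<^sup>+\<omega>. G (restrict \<omega> {0..<n}) \<partial>law) = (\<integral>\<^sup>+\<omega>. G \<omega> \<partial>IT.C 0 n (\<lambda>_. undefined))"
  unfolding prefix_law[symmetric]
  by (rule nn_integral_distr[OF measurable_prefix, symmetric]) (simp only: measurable_distr_eq1 assms)

lemma nn_integral_start:
  assumes f: "f \<in> borel_measurable S"
  shows "(\<integral>\<^sup>+\<omega>. f (\<omega> 0) \<partial>law) = f x0"
proof -
  have f0: "(\<lambda>\<omega>. f (\<omega> 0)) \<in> borel_measurable (Pi\<^sub>M {0..<Suc 0} (\<lambda>_. S))"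
    by (rule measurable_coordinate[OF f]) simp
  note und = undefined_space
  have "(\<integral>\<^sup>+\<omega>. f (\<omega> 0) \<partial>law) = (\<integral>\<^sup>+\<omega>. f (\<omega> 0) \<partial>IT.C 0 (Suc 0) (\<lambda>_. undefined))"
    using nn_integral_prefix[OF f0] by simp
  also have "\<dots> = (\<integral>\<^sup>+\<omega>. f (\<omega> 0) \<partial>IT.eP 0 (\<lambda>_. undefined))"
    using und IT.measurable_eP[of 0] by (simp add: bind_return)
  also have "\<dots> = (\<integral>\<^sup>+x. f x \<partial>return S x0)"
    using und f0 by (subst IT.nn_integral_eP) (auto simp: chain_steps_def)
  also have "\<dots> = f x0" using f x0 by (rule nn_integral_return[rotated])
  finally show ?thesis .
qed

text \<open>The Markov property: \<open>G\<close> is any function of the path up to time \<open>n\<close>.\<close>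

lemma nn_integral_step:
  assumes G: "G \<in> borel_measurable (Pi\<^sub>M {0..<Suc n} (\<lambda>_. S))" and f: "f \<in> borel_measurable S"
  shows "(\<integral>\<^sup>+\<omega>. G (restrict \<omega> {0..<Suc n}) * f (\<omega> (Suc n)) \<partial>law) =
    (\<integral>\<^sup>+\<omega>. G (restrict \<omega> {0..<Suc n}) * (\<integral>\<^sup>+y. f y \<partial>K n (\<omega> n)) \<partial>law)"
proof -
  let ?C = "IT.C 0 (Suc n) (\<lambda>_. undefined)"
  let ?H = "\<lambda>\<omega>. G (restrict \<omega> {0..<Suc n}) * f (\<omega> (Suc n))"
  note und = undefined_space
  have "(\<lambda>\<omega>. restrict \<omega> {0..<Suc n}) \<in> Pi\<^sub>M {0..<Suc (Suc n)} (\<lambda>_. S) \<rightarrow>\<^sub>M Pi\<^sub>M {0..<Suc n} (\<lambda>_. S)"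
    by (rule measurable_restrict_subset) auto
  then have H: "?H \<in> borel_measurable (Pi\<^sub>M {0..<Suc (Suc n)} (\<lambda>_. S))"
    by (intro borel_measurable_times_ennreal measurable_compose[OF _ G]
          measurable_coordinate[OF f]) auto
  have I: "(\<lambda>x. \<integral>\<^sup>+y. f y \<partial>K n x) \<in> borel_measurable S"
    by (rule measurable_compose[OF K_sub nn_integral_measurable_subprob_algebra[OF f]])
  have J: "(\<lambda>\<omega>. G \<omega> * (\<integral>\<^sup>+y. f y \<partial>K n (\<omega> n))) \<in> borel_measurable (Pi\<^sub>M {0..<Suc n} (\<lambda>_. S))"
    by (intro borel_measurable_times_ennreal G measurable_coordinate[OF I]) auto
  have "(\<integral>\<^sup>+\<omega>. ?H \<omega> \<partial>law) = (\<integral>\<^sup>+\<omega>. ?H (restrict \<omega> {0..<Suc (Suc n)}) \<partial>law)"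
    by (intro nn_integral_cong) (simp add: Int_absorb1 restrict_restrict)
  also have "\<dots> = (\<integral>\<^sup>+\<omega>. ?H \<omega> \<partial>IT.C 0 (Suc (Suc n)) (\<lambda>_. undefined))"
    by (rule nn_integral_prefix[OF H])
  also have "\<dots> = (\<integral>\<^sup>+\<omega>. ?H \<omega> \<partial>(?C \<bind> IT.eP (Suc n)))"
    by simp
  also have "\<dots> = (\<integral>\<^sup>+\<omega>. (\<integral>\<^sup>+\<omega>'. ?H \<omega>' \<partial>IT.eP (Suc n) \<omega>) \<partial>?C)"
  proof (rule nn_integral_bind[OF H])
    have "sets ?C = sets (Pi\<^sub>M {0..<Suc n} (\<lambda>_. S))" using IT.sets_C[OF und, of "Suc n"] by simp
    then show "IT.eP (Suc n) \<in> ?C \<rightarrow>\<^sub>M subprob_algebra (Pi\<^sub>M {0..<Suc (Suc n)} (\<lambda>_. S))"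
      using IT.measurable_eP[of "Suc n"] by (simp cong: measurable_cong_sets)
  qed
  also have "\<dots> = (\<integral>\<^sup>+\<omega>. G \<omega> * (\<integral>\<^sup>+y. f y \<partial>K n (\<omega> n)) \<partial>?C)"
  proof (rule nn_integral_cong)
    fix \<omega> assume "\<omega> \<in> space ?C"
    then have \<omega>: "\<omega> \<in> space (Pi\<^sub>M {0..<Suc n} (\<lambda>_. S))"
      using IT.space_C[OF und, of "Suc n"] by simp
    then have \<omega>n: "\<omega> n \<in> space S" and ext: "restrict \<omega> {0..<Suc n} = \<omega>"
      by (auto simp: space_PiM PiE_iff extensional_restrict)
    have r: "restrict (fun_upd \<omega> (Suc n) x) {0..<Suc n} = \<omega>" for x
    proof -
      have "restrict (fun_upd \<omega> (Suc n) x) {0..<Suc n} = restrict \<omega> {0..<Suc n}"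
        by (intro restrict_ext) auto
      then show ?thesis using ext by simp
    qed
    have "(\<integral>\<^sup>+\<omega>'. ?H \<omega>' \<partial>IT.eP (Suc n) \<omega>) = (\<integral>\<^sup>+x. G \<omega> * f x \<partial>K n (\<omega> n))"
      using IT.nn_integral_eP[OF \<omega> H] by (simp add: r chain_steps_def)
    also have "\<dots> = G \<omega> * (\<integral>\<^sup>+y. f y \<partial>K n (\<omega> n))"
      using f \<omega>n by (intro nn_integral_cmult) (simp cong: measurable_cong_sets add: sets_K)
    finally show "(\<integral>\<^sup>+\<omega>'. ?H \<omega>' \<partial>IT.eP (Suc n) \<omega>) = G \<omega> * (\<integral>\<^sup>+y. f y \<partial>K n (\<omega> n))" .
  qed
  also have "\<dots> = (\<integral>\<^sup>+\<omega>. G (restrict \<omega> {0..<Suc n}) * (\<integral>\<^sup>+y. f y \<partial>K n (restrict \<omega> {0..<Suc n} n)) \<partial>law)"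
    using nn_integral_prefix[OF J] by simp
  finally show ?thesis by simp
qed

abbreviation "E n f \<equiv> (\<integral>\<^sup>+\<omega>. f (\<omega> n) \<partial>law)"

lemma expectation_step:
  assumes f: "f \<in> borel_measurable S"
  shows "E (Suc n) f = E n (\<lambda>x. \<integral>\<^sup>+y. f y \<partial>K n x)"
  using nn_integral_step[of "\<lambda>_. 1", OF _ f] by simp

lemma measurable_coord: "f \<in> S \<rightarrow>\<^sub>M N \<Longrightarrow> (\<lambda>\<omega>. f (\<omega> n)) \<in> law \<rightarrow>\<^sub>M N"
  unfolding measurable_law by (rule measurable_coordinate) auto

lemma coord_space: "\<omega> \<in> space law \<Longrightarrow> \<omega> n \<in> space S"
  by (auto simp: space_law space_PiM)

text \<open>By the Markov property, the probability of \<open>P\<close> at time \<open>n\<close> without \<open>Q\<close> at time \<open>n + 1\<close> is the mean of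
  a function that vanishes.\<close>

lemma AE_step:
  assumes P: "Measurable.pred S P" and Q: "Measurable.pred S Q"
    and n: "\<And>x. x \<in> space S \<Longrightarrow> P x \<Longrightarrow> AE y in K n x. Q y"
  shows "AE \<omega> in law. P (\<omega> n) \<longrightarrow> Q (\<omega> (Suc n))"
proof -
  let ?G = "\<lambda>\<omega>. indicator {x\<in>space S. P x} (\<omega> n) :: ennreal"
  let ?f = "indicator {x\<in>space S. \<not> Q x} :: _ \<Rightarrow> ennreal"
  have f: "?f \<in> borel_measurable S" using Q by simp
  have G: "?G \<in> borel_measurable (Pi\<^sub>M {0..<Suc n} (\<lambda>_. S))"
    using P by (intro measurable_coordinate[of "indicator {x\<in>space S. P x}" S borel]) auto
  have "(\<integral>\<^sup>+\<omega>. ?G (restrict \<omega> {0..<Suc n}) * ?f (\<omega> (Suc n)) \<partial>law) =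
      (\<integral>\<^sup>+\<omega>. ?G (restrict \<omega> {0..<Suc n}) * (\<integral>\<^sup>+y. ?f y \<partial>K n (\<omega> n)) \<partial>law)"
    by (rule nn_integral_step[OF G f])
  also have "\<dots> = (\<integral>\<^sup>+\<omega>. 0 \<partial>law)"
  proof (rule nn_integral_cong)
    fix \<omega> assume \<omega>: "\<omega> \<in> space law"
    show "?G (restrict \<omega> {0..<Suc n}) * (\<integral>\<^sup>+y. ?f y \<partial>K n (\<omega> n)) = 0"
    proof (cases "P (\<omega> n)")
      case True
      from n[OF coord_space[OF \<omega>] True] have "(\<integral>\<^sup>+y. ?f y \<partial>K n (\<omega> n)) = (\<integral>\<^sup>+y. 0 \<partial>K n (\<omega> n))"
        by (intro nn_integral_cong_AE) (auto split: split_indicator)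
      then show ?thesis by simp
    qed simp
  qed
  finally have "(\<integral>\<^sup>+\<omega>. ?G \<omega> * ?f (\<omega> (Suc n)) \<partial>law) = 0" by simp
  moreover have "(\<lambda>\<omega>. ?G \<omega> * ?f (\<omega> (Suc n))) \<in> borel_measurable law"
    using P f by (intro borel_measurable_times_ennreal measurable_coord[of "indicator {x\<in>space S. P x}"]
        measurable_coord[of ?f]) auto
  ultimately have "AE \<omega> in law. ?G \<omega> * ?f (\<omega> (Suc n)) = 0"
    by (simp add: nn_integral_0_iff_AE)
  moreover have "AE \<omega> in law. \<omega> n \<in> space S \<and> \<omega> (Suc n) \<in> space S"
    using coord_space by (auto intro: AE_I2)
  ultimately show ?thesis
    by eventually_elim (auto split: split_indicator_asm)
qed

end

section \<open>Root-reward trees\<close>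

lemma adj_commute: "adj T u v \<longleftrightarrow> adj T v u"
  by (simp add: adj_def insert_commute)

locale reward_tree =
  fixes T :: "'v rooted_graph"
  assumes root_reward: "root_reward_tree T"
begin

abbreviation "V \<equiv> verts T"
abbreviation "r \<equiv> rootv T"
abbreviation "B \<equiv> boundary T"
abbreviation "O\<^sub>p \<equiv> open_play T"
abbreviation "depth v \<equiv> gdist T r v"

lemma finite_V: "finite V" and tree: "is_tree T" and r_B: "r \<in> B" and O_ne: "O\<^sub>p \<noteq> {}"
  using root_reward by (auto simp: root_reward_tree_def)

lemma r_V: "r \<in> V"
  using r_B by (simp add: boundary_def)

lemma adjD: assumes "adj T u v" shows "u \<in> V" "v \<in> V" "u \<noteq> v"
proof -
  obtain a b where "a \<in> V" "b \<in> V" "a \<noteq> b" "{u, v} = {a, b}"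
    using tree assms unfolding is_tree_def adj_def by blast
  then show "u \<in> V" "v \<in> V" "u \<noteq> v" by (auto simp: doubleton_eq_iff)
qed

lemma connected: "u \<in> V \<Longrightarrow> v \<in> V \<Longrightarrow> \<exists>p. is_path T p \<and> hd p = u \<and> last p = v"
  using tree unfolding is_tree_def by blast

lemma acyclic: "is_path T p \<Longrightarrow> 3 \<le> length p \<Longrightarrow> \<not> adj T (last p) (hd p)"
  using tree unfolding is_tree_def by blast

lemma is_path_length: "is_path T p \<Longrightarrow> length p \<le> card V"
  using card_mono[OF finite_V, of "set p"] by (simp add: is_path_def distinct_card)

lemma depth_path: assumes "v \<in> V"
  obtains p where "is_path T p" "hd p = r" "last p = v" "length p = Suc (depth v)"
proof -
  obtain p where p: "is_path T p" "hd p = r" "last p = v" using connected[OF r_V assms] by blast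
  have "\<exists>n p. is_path T p \<and> hd p = r \<and> last p = v \<and> length p = Suc n"
    using p by (intro exI[of _ "length p - 1"] exI[of _ p]) (cases p; auto simp: is_path_def)
  then have "\<exists>p. is_path T p \<and> hd p = r \<and> last p = v \<and> length p = Suc (depth v)"
    unfolding gdist_def by (rule LeastI_ex)
  then show ?thesis using that by blast
qed

lemma depth_le: "is_path T p \<Longrightarrow> hd p = r \<Longrightarrow> depth (last p) < length p"
proof -
  assume p: "is_path T p" "hd p = r"
  then have "length p = Suc (length p - 1)" by (cases p) (auto simp: is_path_def)
  then have "depth (last p) \<le> length p - 1"
    unfolding gdist_def using p by (intro Least_le) blast
  with p show ?thesis by (cases p) (auto simp: is_path_def)
qed

lemma is_path_prefix: "is_path T (p @ q) \<Longrightarrow> p \<noteq> [] \<Longrightarrow> is_path T p"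
  by (auto simp: is_path_def successively_append_iff)

lemma depth_on_path:
  assumes "is_path T p" "hd p = r" "w \<in> set p" "w \<noteq> last p"
  shows "Suc (depth w) < length p"
proof -
  obtain p1 p2 where p: "p = p1 @ w # p2" using assms by (meson split_list)
  have "p2 \<noteq> []" using p assms by auto
  have "is_path T (p1 @ [w])" using assms p is_path_prefix[of "p1 @ [w]" p2] by simp
  moreover have "hd (p1 @ [w]) = r" using assms p by (cases p1) auto
  ultimately have "depth w < length (p1 @ [w])" using depth_le by fastforce
  with p \<open>p2 \<noteq> []\<close> show ?thesis by (cases p2) auto
qed

lemma depth_root [simp]: "depth r = 0"
  using depth_le[of "[r]"] r_V by (simp add: is_path_def)

lemma depth_0_iff: "v \<in> V \<Longrightarrow> depth v = 0 \<longleftrightarrow> v = r"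
proof
  assume v: "v \<in> V" "depth v = 0"
  obtain p where "is_path T p" "hd p = r" "last p = v" "length p = Suc (depth v)"
    using depth_path[OF v(1)] by blast
  with v(2) show "v = r" by (cases p) auto
qed simp

lemma depth_less: "v \<in> V \<Longrightarrow> depth v < card V"
  by (metis depth_path is_path_length Suc_le_lessD)

text \<open>Cut at their last common vertex and closed up through \<open>v\<close>, the two paths would form a cycle. This
  is the source of the uniqueness of parents and of the different depths of neighbours.\<close>

lemma two_paths:
  assumes p: "is_path T p" "hd p = r" and q: "is_path T q" "hd q = r"
    and ne: "last p \<noteq> last q" and v: "v \<notin> set p" "v \<notin> set q"
    and a: "adj T (last p) v" "adj T (last q) v"
  shows False
proof -
  have "\<exists>x\<in>set p. x \<in> set q"
    using p q by (intro bexI[of _ r]) (auto simp: is_path_def dest: hd_in_set)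
  then obtain p1 w p2 where P: "p = p1 @ w # p2" "w \<in> set q" "\<forall>x\<in>set p2. x \<notin> set q"
    using split_list_last_prop[of p "\<lambda>x. x \<in> set q"] by auto
  then obtain q1 q2 where Q: "q = q1 @ w # q2" by (meson split_list)
  let ?c = "rev (w # p2) @ q2 @ [v]"
  have sp: "successively (adj T) (w # p2)" and sq: "successively (adj T) (w # q2)"
    using p q unfolding is_path_def P(1) Q by (auto simp: successively_append_iff)
  have "last (w # q2) = last q" using Q by simp
  then have "successively (adj T) ((w # q2) @ [v])"
    using sq a(2) unfolding successively_append_iff by simp
  then have "successively (adj T) ?c"
    using sp by (auto simp: successively_append_iff successively_Cons successively_rev adj_commute[of T]
        last_rev hd_append split: if_splits)
  moreover have "distinct ?c"
    using p q v P Q unfolding is_path_def by auto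
  moreover have "set ?c \<subseteq> V"
    using p q adjD(2)[OF a(1)] unfolding is_path_def P(1) Q by auto
  ultimately have c: "is_path T ?c" by (simp add: is_path_def)
  have "3 \<le> length ?c" using ne P Q by (cases p2; cases q2) auto
  from acyclic[OF c this] have "\<not> adj T v (hd ?c)" by simp
  moreover have "hd ?c = last p" using P by (auto simp: hd_append hd_rev)
  ultimately show False using a(1) adj_commute[of T] by metis
qed

lemma depth_adj: assumes "adj T u v" shows "depth v \<le> Suc (depth u)"
proof -
  note uv = adjD[OF assms]
  obtain p where p: "is_path T p" "hd p = r" "last p = u" "length p = Suc (depth u)"
    using depth_path uv by blast
  show ?thesis
  proof (cases "v \<in> set p")
    case True
    then show ?thesis using depth_on_path[of p v] p uv by (cases "v = last p") auto
  next
    case False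
    then have "is_path T (p @ [v])" using p assms uv by (auto simp: is_path_def successively_append_iff)
    moreover have "hd (p @ [v]) = r" using p by (cases p) (auto simp: is_path_def)
    ultimately show ?thesis using depth_le[of "p @ [v]"] p by simp
  qed
qed

lemma ex_closer: assumes "v \<in> V" "v \<noteq> r" shows "\<exists>u. away T u v"
proof -
  obtain p where p: "is_path T p" "hd p = r" "last p = v" "length p = Suc (depth v)"
    using depth_path assms by blast
  obtain q where q: "p = q @ [v]" using p by (metis is_path_def append_butlast_last_id)
  have qn: "q \<noteq> []" using q p assms by auto
  have "is_path T q" using is_path_prefix q qn p by blast
  moreover have "hd q = r" using p q qn by auto
  ultimately have "depth (last q) < length q" by (rule depth_le)
  moreover have "adj T (last q) v" using p q qn by (auto simp: is_path_def successively_append_iff)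
  ultimately show ?thesis using p q by (auto simp: away_def)
qed

lemma closer_unique: assumes "away T u v" "away T u' v" shows "u = u'"
proof (rule ccontr)
  assume ne: "u \<noteq> u'"
  have uv: "u \<in> V" "u' \<in> V" using assms adjD unfolding away_def by blast+
  obtain p where p: "is_path T p" "hd p = r" "last p = u" "length p = Suc (depth u)"
    using depth_path uv by blast
  obtain q where q: "is_path T q" "hd q = r" "last q = u'" "length q = Suc (depth u')"
    using depth_path uv by blast
  have "v \<notin> set p" using depth_on_path[of p v] p assms by (auto simp: away_def)
  moreover have "v \<notin> set q" using depth_on_path[of q v] q assms by (auto simp: away_def)
  ultimately show False using two_paths[of p q v] p q ne assms by (auto simp: away_def)
qed

lemma depth_ne: assumes a: "adj T u v" shows "depth u \<noteq> depth v"
proof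
  assume eq: "depth u = depth v"
  note uv = adjD[OF a]
  have "v \<noteq> r"
  proof
    assume "v = r"
    with eq depth_0_iff[of u] uv show False by simp
  qed
  then obtain v' where v': "away T v' v" using ex_closer uv by blast
  then have "v' \<in> V" using adjD by (auto simp: away_def)
  obtain p where p: "is_path T p" "hd p = r" "last p = u" "length p = Suc (depth u)"
    using depth_path uv by blast
  obtain q where q: "is_path T q" "hd q = r" "last q = v'" "length q = Suc (depth v')"
    using depth_path \<open>v' \<in> V\<close> by blast
  have "v \<notin> set p" using depth_on_path[of p v] p eq uv by auto
  moreover have "v \<notin> set q" using depth_on_path[of q v] q v' by (auto simp: away_def)
  moreover have "u \<noteq> v'" using v' eq by (auto simp: away_def)
  ultimately show False using two_paths[of p q v] p q a v' by (auto simp: away_def)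
qed

lemma away_parent: "v \<in> V \<Longrightarrow> v \<noteq> r \<Longrightarrow> away T (parent T v) v"
  unfolding parent_def using ex_closer closer_unique by (metis theI)

lemma parent_unique: "away T u v \<Longrightarrow> u = parent T v"
  unfolding parent_def using closer_unique by (metis the_equality)

lemma adj_cases: "adj T v w \<Longrightarrow> away T v w \<or> (v \<noteq> r \<and> w = parent T v)"
proof -
  assume a: "adj T v w"
  show ?thesis
  proof (cases "depth v < depth w")
    case True with a show ?thesis by (simp add: away_def)
  next
    case False
    with depth_ne[OF a] have "depth w < depth v" by simp
    then have "away T w v" "v \<noteq> r" using a adj_commute[of T] by (auto simp: away_def)
    then show ?thesis using parent_unique by auto
  qed
qed

lemma awayD: assumes "away T v w" shows "v \<in> V" "w \<in> V" "w \<noteq> r" "depth w = Suc (depth v)" "adj T v w" "parent T w = v"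
  using assms adjD[of v w] depth_adj[of v w] parent_unique[OF assms] by (auto simp: away_def)

lemma finite_nbrs: "finite {u. adj T v u}"
  using finite_V adjD(2) by (rule_tac finite_subset) auto

lemma O_V: "v \<in> O\<^sub>p \<Longrightarrow> v \<in> V" and O_not_B: "v \<in> O\<^sub>p \<Longrightarrow> v \<notin> B" and O_not_r: "v \<in> O\<^sub>p \<Longrightarrow> v \<noteq> r"
  using r_B by (auto simp: open_play_def)

lemma finite_open: "finite O\<^sub>p"
  using finite_V O_V by (rule_tac finite_subset) auto

lemma V_cases: "v \<in> V \<Longrightarrow> v \<in> O\<^sub>p \<or> v \<in> B"
  by (auto simp: open_play_def)

lemma B_V: "v \<in> B \<Longrightarrow> v \<in> V"
  by (simp add: boundary_def)

lemma parent_of: assumes "v \<in> V" "v \<noteq> r"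
  shows "parent T v \<in> V" "adj T v (parent T v)" "depth v = Suc (depth (parent T v))"
  using awayD[OF away_parent[OF assms]] adj_commute[of T] by auto

lemma ex_child: assumes v: "v \<in> O\<^sub>p" shows "\<exists>w. away T v w"
proof (rule ccontr)
  assume no: "\<nexists>w. away T v w"
  have "{u. adj T v u} = {parent T v}"
    using adj_cases no parent_of(2)[OF O_V[OF v] O_not_r[OF v]] by auto
  then show False using v by (auto simp: open_play_def boundary_def)
qed

lemma child_O: assumes "away T v w" "v \<noteq> r" shows "v \<in> O\<^sub>p"
proof -
  note w = awayD[OF assms(1)]
  have "parent T v \<noteq> w" using parent_of(3)[OF w(1) assms(2)] w(4) by auto
  moreover have "{parent T v, w} \<subseteq> {u. adj T v u}" using parent_of(2)[OF w(1) assms(2)] w(5) by auto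
  ultimately have "2 \<le> card {u. adj T v u}" using card_mono[OF finite_nbrs, of "{parent T v, w}" v] by simp
  then show ?thesis using w by (auto simp: open_play_def boundary_def)
qed

lemma parent_O: assumes "v \<in> V" "v \<noteq> r" shows "parent T v \<in> O\<^sub>p \<or> parent T v = r"
  using child_O[OF away_parent[OF assms]] by blast

text \<open>This makes paths that lead away from the root simple, so that a path to a leaf can be built child by
  child.\<close>

lemma away_path_depth: "successively (away T) (v # p) \<Longrightarrow> w \<in> set p \<Longrightarrow> depth v < depth w"
  by (induction p arbitrary: v) (auto simp: successively_Cons away_def intro: order.strict_trans)

lemma away_path_Cons:
  assumes "away T v (hd p)" "is_path T p" "successively (away T) p"
  shows "is_path T (v # p)" "successively (away T) (v # p)"
proof -
  have p: "p \<noteq> []" using assms by (simp add: is_path_def)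
  show s: "successively (away T) (v # p)" using assms p by (cases p) (auto simp: successively_Cons)
  have "v \<notin> set p" using away_path_depth[OF s] by auto
  then show "is_path T (v # p)"
    using assms p awayD[OF assms(1)] by (cases p) (auto simp: is_path_def successively_Cons)
qed

abbreviation (input) "out_path v p \<equiv> is_path T p \<and> successively (away T) p \<and> hd p = v \<and> last p \<in> B - {r}"

lemma ex_out_path: "v \<in> V \<Longrightarrow> v \<noteq> r \<Longrightarrow> \<exists>p. out_path v p"
proof (induction "card V - depth v" arbitrary: v rule: less_induct)
  case less
  show ?case
  proof (cases "v \<in> O\<^sub>p")
    case True
    then obtain w where w: "away T v w" using ex_child by blast
    note W = awayD[OF w]
    have "card V - depth w < card V - depth v" using W depth_less[of v] less.prems by simp
    from less.hyps[OF this] W obtain p where p: "out_path w p" by blast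
    with away_path_Cons[of v p] w have "is_path T (v # p)" "successively (away T) (v # p)" by auto
    with p show ?thesis by (intro exI[of _ "v # p"]) (auto simp: is_path_def)
  next
    case False
    then show ?thesis using less.prems V_cases[of v]
      by (intro exI[of _ "[v]"]) (auto simp: is_path_def)
  qed
qed

lemma d_out_path: assumes "v \<in> V" "v \<noteq> r"
  obtains p where "out_path v p" "length p = Suc (d_out T v)"
proof -
  obtain p where p: "out_path v p" using ex_out_path assms by blast
  have "\<exists>n p. is_path T p \<and> successively (away T) p \<and> hd p = v \<and> last p \<in> B - {r} \<and> length p = Suc n"
    using p by (intro exI[of _ "length p - 1"] exI[of _ p]) (cases p; auto simp: is_path_def)
  then have "\<exists>p. is_path T p \<and> successively (away T) p \<and> hd p = v \<and> last p \<in> B - {r} \<and> length p = Suc (d_out T v)"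
    unfolding d_out_def by (rule LeastI_ex)
  then show ?thesis using that by blast
qed

lemma d_out_le: "out_path v p \<Longrightarrow> d_out T v < length p"
proof -
  assume p: "out_path v p"
  then have "length p = Suc (length p - 1)" by (cases p) (auto simp: is_path_def)
  then have "d_out T v \<le> length p - 1"
    unfolding d_out_def using p by (intro Least_le) blast
  with p show ?thesis by (cases p) (auto simp: is_path_def)
qed

lemma d_out_less: "v \<in> V \<Longrightarrow> v \<noteq> r \<Longrightarrow> d_out T v < card V"
  by (metis d_out_path is_path_length Suc_le_lessD)

lemma d_out_leaf: "v \<in> B \<Longrightarrow> v \<noteq> r \<Longrightarrow> d_out T v = 0"
  using d_out_le[where v=v and p="[v]"] by (auto simp: is_path_def B_V)

lemma d_out_child: assumes "away T v w" shows "d_out T v \<le> Suc (d_out T w)"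
proof -
  note W = awayD[OF assms]
  obtain p where p: "out_path w p" "length p = Suc (d_out T w)" using d_out_path W by blast
  with away_path_Cons[of v p] assms have "is_path T (v # p)" "successively (away T) (v # p)" by auto
  with p have "out_path v (v # p)" by (auto simp: is_path_def)
  from d_out_le[OF this] p show ?thesis by simp
qed

lemma d_out_pos: assumes "v \<in> O\<^sub>p" shows "1 \<le> d_out T v"
proof (rule ccontr)
  assume "\<not> 1 \<le> d_out T v"
  moreover obtain p where "out_path v p" "length p = Suc (d_out T v)"
    using d_out_path[OF O_V O_not_r] assms by blast
  ultimately show False using O_not_B[OF assms] by (cases p; cases "tl p") auto
qed

text \<open>The second vertex of a shortest path to a leaf lies in \<open>V_minus T v\<close>.\<close>

lemma V_minus_ne: assumes v: "v \<in> O\<^sub>p" shows "V_minus T v \<noteq> {}"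
proof -
  obtain p where p: "out_path v p" "length p = Suc (d_out T v)"
    using d_out_path[OF O_V O_not_r] v by blast
  obtain w p' where P: "p = v # w # p'"
    using p d_out_pos[OF v] by (cases p; cases "tl p") auto
  then have w: "away T v w" using p by (auto simp: successively_Cons)
  have "out_path w (w # p')" using p P by (auto simp: is_path_def successively_Cons)
  from d_out_le[OF this] p P d_out_child[OF w] have "Suc (d_out T w) = d_out T v" by simp
  with w show ?thesis by (auto simp: V_minus_def)
qed

lemma V_minusD: "u \<in> V_minus T v \<Longrightarrow> away T v u" "u \<in> V_minus T v \<Longrightarrow> Suc (d_out T u) = d_out T v"
  by (auto simp: V_minus_def)

lemma card_V: "3 \<le> card V"
proof -
  obtain v where v: "v \<in> O\<^sub>p" using O_ne by blast
  obtain w where w: "away T v w" using ex_child v by blast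
  note W = awayD[OF w] and P = parent_of[OF O_V[OF v] O_not_r[OF v]]
  have "depth (parent T v) < depth v" "depth v < depth w" using W(4) P(3) by linarith+
  then have "v \<noteq> w" "v \<noteq> parent T v" "w \<noteq> parent T v" by (metis less_irrefl order.strict_trans)+
  then have "card {v, w, parent T v} = 3" by simp
  moreover have "{v, w, parent T v} \<subseteq> V" using W P by auto
  ultimately show ?thesis using card_mono[OF finite_V] by metis
qed

lemma finite_B: "finite B"
  using finite_V by (rule finite_subset[rotated]) (auto simp: boundary_def)

lemma card_B: "2 \<le> card B"
proof -
  obtain v where v: "v \<in> O\<^sub>p" using O_ne by blast
  obtain p where "out_path v p" using ex_out_path[OF O_V O_not_r] v by blast
  then have "card {r, last p} = 2" "{r, last p} \<subseteq> B" using r_B by auto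
  then show ?thesis using card_mono[OF finite_B] by metis
qed

definition levels_at :: "'v \<Rightarrow> nat list" where
  "levels_at v = map (\<lambda>i. d_out T ((parent T ^^ i) v)) [0..<depth v]"

lemma levels_at_root [simp]: "levels_at r = []"
  by (simp add: levels_at_def)

lemma levels_at_step: assumes "v \<in> V" "v \<noteq> r"
  shows "levels_at v = d_out T v # levels_at (parent T v)"
proof -
  have "levels_at v = map (\<lambda>i. d_out T ((parent T ^^ i) v)) [0..<Suc (depth (parent T v))]"
    using parent_of(3)[OF assms] by (simp add: levels_at_def)
  also have "\<dots> = d_out T v # map (\<lambda>i. d_out T ((parent T ^^ Suc i) v)) [0..<depth (parent T v)]"
    by (subst upt_conv_Cons) (auto simp: map_Suc_upt[symmetric] simp del: upt_Suc)
  also have "(\<lambda>i. d_out T ((parent T ^^ Suc i) v)) = (\<lambda>i. d_out T ((parent T ^^ i) (parent T v)))"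
    by (simp add: funpow_swap1)
  finally show ?thesis by (simp add: levels_at_def)
qed

lemma length_levels_at: "length (levels_at v) = depth v"
  by (simp add: levels_at_def)

lemma levels_at_range:
  assumes "v \<in> O\<^sub>p \<or> v = r" "k \<in> set (levels_at v)"
  shows "1 \<le> k \<and> k \<le> card V"
  using assms
proof (induction "depth v" arbitrary: v rule: less_induct)
  case less
  then have vr: "v \<noteq> r" by auto
  with less.prems have v: "v \<in> O\<^sub>p" by auto
  note step = levels_at_step[OF O_V[OF v] vr]
  from less.prems(2) consider "k = d_out T v" | "k \<in> set (levels_at (parent T v))"
    unfolding step by auto
  then show ?case
  proof cases
    case 1 then show ?thesis using d_out_pos[OF v] d_out_less[OF O_V[OF v] vr] by simp
  next
    case 2
    then show ?thesis
      using less.hyps[of "parent T v"] parent_of(3)[OF O_V[OF v] vr] parent_O[OF O_V[OF v] vr] by simp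
  qed
qed

end

section \<open>Strategies and coin tosses\<close>

text \<open>The line is second countable, so the complement of the support is a null set.\<close>

lemma msupport_AE:
  assumes p: "\<mu> \<in> space (prob_algebra halfline)" and c: "Sup (ereal ` msupport \<mu>) \<le> ereal c"
  shows "AE a in \<mu>. 0 \<le> a \<and> a \<le> c"
proof -
  have sets: "sets \<mu> = sets halfline" using p by (simp add: space_prob_algebra)
  then have space: "space \<mu> = {0..}" by (simp add: sets_eq_imp_space_eq space_restrict_space)
  define F where "F = {U. open U \<and> emeasure \<mu> (U \<inter> {0..}) = 0}"
  have "\<And>U. U \<in> F \<Longrightarrow> open U" by (simp add: F_def)
  from Lindelof[OF this] obtain F' where F': "F' \<subseteq> F" "countable F'" "\<Union>F' = \<Union>F" by metis
  have "(\<Union>U\<in>F'. U \<inter> {0..}) \<in> null_sets \<mu>"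
  proof (intro null_sets_UN' F'(2))
    fix U assume "U \<in> F'"
    then have "open U" "emeasure \<mu> (U \<inter> {0..}) = 0" using F' by (auto simp: F_def)
    moreover have "U \<inter> {0..} \<in> sets \<mu>"
      unfolding sets sets_restrict_space using \<open>open U\<close> by (auto simp: Int_commute)
    ultimately show "U \<inter> {0..} \<in> null_sets \<mu>" by (simp add: null_sets_def)
  qed
  then have "AE a in \<mu>. a \<notin> (\<Union>U\<in>F'. U \<inter> {0..})" by (rule AE_not_in)
  moreover have "AE a in \<mu>. 0 \<le> a" using space by (auto intro: AE_I2)
  ultimately show ?thesis
  proof eventually_elim
    case (elim a)
    show ?case
    proof (rule ccontr)
      assume n: "\<not> (0 \<le> a \<and> a \<le> c)"
      have "a \<notin> msupport \<mu>"
      proof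
        assume "a \<in> msupport \<mu>"
        then have "ereal a \<le> Sup (ereal ` msupport \<mu>)" by (intro SUP_upper)
        from this c have "ereal a \<le> ereal c" by (rule order.trans)
        with n elim show False by simp
      qed
      then obtain U where U: "open U" "a \<in> U" "emeasure \<mu> (U \<inter> {0..}) = 0"
        using elim by (auto simp: msupport_def)
      then have "a \<in> \<Union>F'" unfolding F'(3) by (auto simp: F_def)
      then show False using elim by auto
    qed
  qed
qed

lemma msupport_return: "0 \<le> c \<Longrightarrow> msupport (return halfline c) \<subseteq> {c}"
proof
  fix x assume c: "0 \<le> c" and x: "x \<in> msupport (return halfline c)"
  show "x \<in> {c}"
  proof (rule ccontr)
    assume "x \<notin> {c}"
    then have "open (- {c})" "x \<in> - {c}" by auto
    then have "0 < emeasure (return halfline c) ((- {c}) \<inter> {0..})"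
      using x by (auto simp: msupport_def)
    moreover have "(- {c}) \<inter> {0..} \<in> sets halfline"
      unfolding sets_restrict_space by (auto simp: Int_commute)
    ultimately show False by (simp add: emeasure_return)
  qed
qed

lemma Sup_msupport_return: "0 \<le> c \<Longrightarrow> c \<le> b \<Longrightarrow> Sup (ereal ` msupport (return halfline c)) \<le> ereal b"
  using msupport_return[of c] by (intro SUP_least) auto

lemma space_halfline: "space halfline = {0..}"
  by (simp add: space_restrict_space)

lemma return_halfline_eqI:
  assumes p: "\<mu> \<in> space (prob_algebra halfline)" and c: "0 \<le> c" and ae: "AE a in \<mu>. a = c"
  shows "\<mu> = return halfline c"
proof (rule measure_eqI)
  have sets: "sets \<mu> = sets halfline" using p by (simp add: space_prob_algebra)
  then show "sets \<mu> = sets (return halfline c)" by simp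
  interpret prob_space \<mu> using p by (simp add: space_prob_algebra)
  fix A assume A: "A \<in> sets \<mu>"
  show "emeasure \<mu> A = emeasure (return halfline c) A"
  proof (cases "c \<in> A")
    case True
    have "emeasure \<mu> A = 1"
      using ae True A by (intro emeasure_eq_1_AE) auto
    then show ?thesis using A sets True by (simp add: emeasure_return)
  next
    case False
    have "A \<in> null_sets \<mu>"
      using ae False A by (subst AE_iff_null_sets) (auto elim: eventually_mono)
    then show ?thesis using A sets False by (simp add: emeasure_return null_setsD1)
  qed
qed

lemma nn_integral_turn_pmf:
  assumes "0 \<le> \<epsilon>" "\<epsilon> \<le> 1" "0 \<le> q" "q \<le> 1"
  shows "(\<integral>\<^sup>+z. f z \<partial>measure_pmf (turn_pmf \<epsilon> q w u d)) =
    ennreal (1 - \<epsilon>) * f w + ennreal \<epsilon> * (ennreal q * f u + ennreal (1 - q) * f d)"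
proof -
  have b: "(\<integral>\<^sup>+z. g z \<partial>measure_pmf (bernoulli_pmf p)) = ennreal p * g True + ennreal (1 - p) * g False"
    if "0 \<le> p" "p \<le> 1" for g :: "bool \<Rightarrow> ennreal" and p
  proof -
    have "(\<integral>\<^sup>+z. g z \<partial>measure_pmf (bernoulli_pmf p))
        = (\<Sum>z\<in>UNIV. g z * ennreal (pmf (bernoulli_pmf p) z))"
      by (rule nn_integral_measure_pmf_support) auto
    then show ?thesis using that by (simp add: UNIV_bool mult.commute add.commute)
  qed
  have q1: "ennreal q + ennreal (1 - q) = 1" using assms by (simp add: ennreal_plus[symmetric] del: ennreal_plus)
  have w: "ennreal q * f w + ennreal (1 - q) * f w = f w"
    unfolding distrib_right[symmetric] q1 by simp
  have "(\<integral>\<^sup>+z. f z \<partial>measure_pmf (turn_pmf \<epsilon> q w u d)) =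
      ennreal \<epsilon> * (ennreal q * f u + ennreal (1 - q) * f d)
      + ennreal (1 - \<epsilon>) * (ennreal q * f w + ennreal (1 - q) * f w)"
    unfolding turn_pmf_def using assms by (simp add: nn_integral_bind_pmf b mult.commute)
  then show ?thesis unfolding w by (simp add: add.commute)
qed

text \<open>Only finitely many vertices matter, so that measurability in the state reduces to measurability in
  the fortune.\<close>

lemma measurable_state_cases:
  fixes F :: "ennreal \<Rightarrow> 'v \<Rightarrow> 'b"
  assumes fin: "finite A" and F: "\<And>w. w \<in> A \<Longrightarrow> (\<lambda>x. F x w) \<in> borel \<rightarrow>\<^sub>M N"
    and G: "G \<in> game_space \<rightarrow>\<^sub>M N"
  shows "(\<lambda>(x, w). if w \<notin> A then G (x, w) else F x w) \<in> game_space \<rightarrow>\<^sub>M N"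
  using fin F
proof (induction A rule: finite_induct)
  case empty
  then show ?case using G by simp
next
  case (insert v A)
  have "(\<lambda>p. if snd p = v then F (fst p) v else (\<lambda>(x, w). if w \<notin> A then G (x, w) else F x w) p)
      \<in> game_space \<rightarrow>\<^sub>M N"
  proof (rule measurable_If)
    show "(\<lambda>p. F (fst p) v) \<in> game_space \<rightarrow>\<^sub>M N"
      unfolding game_space_def by (rule measurable_compose[OF measurable_fst]) (use insert in auto)
    have "snd \<in> game_space \<rightarrow>\<^sub>M count_space UNIV"
      unfolding game_space_def by (rule measurable_snd)
    then have "snd -` {v} \<inter> space game_space \<in> sets game_space" by (rule measurable_sets) simp
    moreover have "snd -` {v} \<inter> space game_space = {p \<in> space game_space. snd p = v}" by auto
    ultimately show "{p \<in> space game_space. snd p = v} \<in> sets game_space" by simp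
  qed (use insert in auto)
  moreover have "(\<lambda>p. if snd p = v then F (fst p) v else (\<lambda>(x, w). if w \<notin> A then G (x, w) else F x w) p)
    = (\<lambda>(x, w). if w \<notin> insert v A then G (x, w) else F x w)"
    using insert by (auto simp: fun_eq_iff)
  ultimately show ?case by simp
qed

lemma space_game_space: "space game_space = UNIV"
  by (simp add: game_space_def space_pair_measure)

lemma measurable_next_fortune:
  assumes "f \<in> borel_measurable M" "g \<in> borel_measurable M" "h \<in> borel_measurable M"
  shows "(\<lambda>z. next_fortune (f z) (g z) (h z)) \<in> M \<rightarrow>\<^sub>M borel"
  using assms unfolding next_fortune_def by measurable

lemma measurable_win_prob:
  assumes "f \<in> borel_measurable M" "g \<in> borel_measurable M" "h \<in> borel_measurable M"
  shows "(\<lambda>z. win_prob (f z) (g z) (h z)) \<in> borel_measurable M"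
  using assms unfolding win_prob_def by measurable

lemma win_prob_01: "0 \<le> x \<Longrightarrow> 0 \<le> a \<Longrightarrow> 0 \<le> b \<Longrightarrow> 0 \<le> win_prob x a b \<and> win_prob x a b \<le> 1"
  by (auto simp: win_prob_def divide_le_eq_1)

lemma strategy_stake_measurable:
  assumes S: "S \<in> strategies T cap" and w: "w \<in> open_play T" and i: "1 \<le> i"
  shows "(\<lambda>x. fst S x w i) \<in> halfline \<rightarrow>\<^sub>M prob_algebra halfline"
proof -
  have m: "(\<lambda>(x, w, i). fst S x w i) \<in>
       measurable (halfline \<Otimes>\<^sub>M count_space (open_play T) \<Otimes>\<^sub>M count_space {1..}) (prob_algebra halfline)"
    using S by (auto simp: strategies_def)
  have "(\<lambda>x. (x, w, i)) \<in> halfline \<rightarrow>\<^sub>M halfline \<Otimes>\<^sub>M count_space (open_play T) \<Otimes>\<^sub>M count_space {1..}"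
    using w i by (intro measurable_Pair measurable_ident_sets refl measurable_const) (auto simp: space_pair_measure)
  from measurable_compose[OF this m] show ?thesis by simp
qed

lemma strategy_move_measurable:
  assumes S: "S \<in> strategies T cap" and w: "w \<in> open_play T" and i: "1 \<le> i"
  shows "(\<lambda>x. snd S x w i) \<in> borel \<rightarrow>\<^sub>M count_space UNIV"
proof -
  have m: "(\<lambda>(x, w, i). snd S x w i) \<in>
       measurable (borel \<Otimes>\<^sub>M count_space (open_play T) \<Otimes>\<^sub>M count_space {1..}) (count_space (verts T))"
    using S by (auto simp: strategies_def)
  have "(\<lambda>x. (x, w, i)) \<in> borel \<rightarrow>\<^sub>M borel \<Otimes>\<^sub>M count_space (open_play T) \<Otimes>\<^sub>M count_space {1..}"
    using w i by (intro measurable_Pair measurable_ident_sets refl measurable_const) (auto simp: space_pair_measure)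
  from measurable_compose[OF this m] have "(\<lambda>x. snd S x w i) \<in> borel \<rightarrow>\<^sub>M count_space (verts T)" by simp
  from measurable_compose[OF this, of "\<lambda>x. x" "count_space UNIV"] show ?thesis by simp
qed

lemma strategy_stake_space:
  assumes S: "S \<in> strategies T cap" and w: "w \<in> open_play T" and i: "1 \<le> i" and x: "0 \<le> x"
  shows "fst S x w i \<in> space (prob_algebra halfline)" "AE a in fst S x w i. 0 \<le> a \<and> a \<le> cap x"
proof -
  show 1: "fst S x w i \<in> space (prob_algebra halfline)"
    using measurable_space[OF strategy_stake_measurable[OF S w i], of x] x by (simp add: space_halfline)
  show "AE a in fst S x w i. 0 \<le> a \<and> a \<le> cap x"
    using S w i x by (intro msupport_AE[OF 1]) (auto simp: strategies_def)
qed

lemma strategy_move_adj: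
  "S \<in> strategies T cap \<Longrightarrow> w \<in> open_play T \<Longrightarrow> 1 \<le> i \<Longrightarrow> adj T w (snd S x w i)"
  by (auto simp: strategies_def)

lemma measurable_pair_countable:
  assumes C: "countable C" and f: "\<And>y. y \<in> C \<Longrightarrow> (\<lambda>x. f (x, y)) \<in> M \<rightarrow>\<^sub>M N"
  shows "f \<in> M \<Otimes>\<^sub>M count_space C \<rightarrow>\<^sub>M N"
proof -
  have "(\<lambda>p. f (fst p, snd p)) \<in> M \<Otimes>\<^sub>M count_space C \<rightarrow>\<^sub>M N"
  proof (rule measurable_compose_countable'[where f = "\<lambda>y p. f (fst p, y)" and g = snd and I = C])
    show "(\<lambda>p. f (fst p, y)) \<in> M \<Otimes>\<^sub>M count_space C \<rightarrow>\<^sub>M N" if "y \<in> C" for y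
      by (rule measurable_compose[OF measurable_fst f[OF that]])
  qed (rule measurable_snd C)+
  then show ?thesis by simp
qed

text \<open>The equilibrium strategies are of this kind: deterministic stakes, and moves that ignore the fortune.\<close>

lemma strategyI:
  assumes O: "finite (open_play T)"
    and s: "\<And>w. w \<in> open_play T \<Longrightarrow> g w \<in> borel_measurable borel"
    and cap: "\<And>x w. 0 \<le> x \<Longrightarrow> w \<in> open_play T \<Longrightarrow> 0 \<le> g w x \<and> g w x \<le> cap x"
    and m: "\<And>w i. w \<in> open_play T \<Longrightarrow> 1 \<le> i \<Longrightarrow> adj T w (m w i)"
    and V: "\<And>w u. adj T w u \<Longrightarrow> u \<in> verts T"
  shows "((\<lambda>x w i. return halfline (g w x)), (\<lambda>x w i. m w i)) \<in> strategies T cap"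
proof -
  have C: "count_space (open_play T) \<Otimes>\<^sub>M count_space {1::nat..} = count_space (open_play T \<times> {1..})"
    using O by (intro pair_measure_countable) (auto intro: countable_finite)
  have cnt: "countable (open_play T \<times> {1::nat..})" using O by (auto intro: countable_finite)
  have 1: "(\<lambda>p. return halfline (g (fst (snd p)) (fst p))) \<in>
       measurable (halfline \<Otimes>\<^sub>M count_space (open_play T \<times> {1::nat..})) (prob_algebra halfline)"
  proof (rule measurable_pair_countable[OF cnt])
    fix y :: "'a \<times> nat" assume y: "y \<in> open_play T \<times> {1..}"
    have "(\<lambda>x. g (fst y) x) \<in> halfline \<rightarrow>\<^sub>M halfline"
    proof (rule measurable_restrict_space2)
      show "(\<lambda>x. g (fst y) x) \<in> space halfline \<rightarrow> {0..}" using cap y by (auto simp: space_halfline)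
      show "(\<lambda>x. g (fst y) x) \<in> halfline \<rightarrow>\<^sub>M borel" using s y by (intro measurable_restrict_space1) auto
    qed
    from measurable_compose[OF this measurable_return_prob_space]
    show "(\<lambda>x. return halfline (g (fst (snd (x, y))) (fst (x, y)))) \<in> halfline \<rightarrow>\<^sub>M prob_algebra halfline"
      by simp
  qed
  have 2: "(\<lambda>p. m (fst (snd p)) (snd (snd p))) \<in>
       measurable ((borel :: ennreal measure) \<Otimes>\<^sub>M count_space (open_play T \<times> {1::nat..})) (count_space (verts T))"
  proof (rule measurable_pair_countable[OF cnt])
    fix y :: "'a \<times> nat" assume y: "y \<in> open_play T \<times> {1..}"
    then have "m (fst y) (snd y) \<in> verts T" using m[of "fst y" "snd y"] V by auto
    then show "(\<lambda>x::ennreal. m (fst (snd (x, y))) (snd (snd (x, y)))) \<in> borel \<rightarrow>\<^sub>M count_space (verts T)"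
      by simp
  qed
  show ?thesis
    unfolding strategies_def C
    using 1 2 m Sup_msupport_return cap by (auto simp: case_prod_beta')
qed

section \<open>The value of a state\<close>

locale equilibrium = reward_tree T for T :: "'v rooted_graph" +
  fixes \<epsilon> :: real
  assumes eps: "0 < \<epsilon>" "4 * \<epsilon> * real (card (verts T)) ^ 5 \<le> 1"
begin

definition val :: "'v \<Rightarrow> real \<Rightarrow> real" where
  "val w x = escape (levels_at w) x"

definition share :: "'v \<Rightarrow> real \<Rightarrow> real" where
  "share w x = stake \<epsilon> (d_out T w) (levels_at (parent T w)) x"

lemma levels_open:
  assumes w: "w \<in> O\<^sub>p"
  shows "levels (card V) (d_out T w) (levels_at (parent T w)) \<epsilon>"
proof
  note P = parent_of[OF O_V[OF w] O_not_r[OF w]]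
  show "3 \<le> card V" by (rule card_V)
  show "1 \<le> d_out T w" by (rule d_out_pos[OF w])
  show "d_out T w \<le> card V" using d_out_less[OF O_V[OF w] O_not_r[OF w]] by simp
  show "\<forall>k\<in>set (levels_at (parent T w)). 1 \<le> k \<and> k \<le> card V"
    using levels_at_range[of "parent T w"] parent_O[OF O_V[OF w] O_not_r[OF w]] by blast
  show "length (levels_at (parent T w)) < card V"
    using depth_less[OF P(1)] by (simp add: length_levels_at)
qed (rule eps)+

lemma val_open: "w \<in> O\<^sub>p \<Longrightarrow> val w x = escape (d_out T w # levels_at (parent T w)) x"
  unfolding val_def using levels_at_step[OF O_V O_not_r] by simp

lemma val_root [simp]: "val r x = 1"
  by (simp add: val_def)

lemma val_leaf: "w \<in> B \<Longrightarrow> w \<noteq> r \<Longrightarrow> val w x = 0"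
  unfolding val_def by (subst levels_at_step) (auto simp: B_V d_out_leaf escape_Cons)

lemma val_child: "away T w u \<Longrightarrow> val u x = climb (d_out T u) x * val w x"
  unfolding val_def using levels_at_step[of u] awayD[of w u] by (simp add: escape_Cons)

lemma val_nonneg: "0 \<le> x \<Longrightarrow> 0 \<le> val w x"
  by (simp add: val_def escape_nonneg)

lemma val_le_1: "0 \<le> x \<Longrightarrow> val w x \<le> 1"
  by (simp add: val_def escape_le_1)

lemma val_pos: "0 < x \<Longrightarrow> w \<in> O\<^sub>p \<or> w = r \<Longrightarrow> 0 < val w x"
  unfolding val_def using levels_at_range[of w] by (intro escape_pos) auto

lemma val_at_0: "w \<in> O\<^sub>p \<Longrightarrow> val w 0 = 0"
  by (simp add: val_open escape_Cons)

lemma val_lower: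
  assumes "0 \<le> x" "w \<in> O\<^sub>p"
  shows "(x / (1 + x)) ^ card V \<le> val w x"
proof -
  have "(x / (1 + x)) ^ card V \<le> (x / (1 + x)) ^ length (levels_at w)"
    using assms depth_less[OF O_V, of w] by (intro power_decreasing) (auto simp: length_levels_at)
  also have "\<dots> \<le> val w x"
    unfolding val_def using assms levels_at_range[of w] by (intro escape_lower) auto
  finally show ?thesis .
qed

lemma val_parent: "w \<in> O\<^sub>p \<Longrightarrow> val w x = climb (d_out T w) x * val (parent T w) x"
  by (simp add: val_open escape_Cons) (simp add: val_def)

text \<open>Each further level costs a factor less than one, so the parent is the best neighbour for Maxine.\<close>

lemma val_nbr_le:
  assumes w: "w \<in> O\<^sub>p" and u: "adj T w u" and x: "0 \<le> x"
  shows "val u x \<le> val (parent T w) x"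
    and "0 < x \<Longrightarrow> u \<noteq> parent T w \<Longrightarrow> val u x < val (parent T w) x"
proof -
  have child: "val u x \<le> val w x" if "away T w u"
    using that x mult_right_mono[OF less_imp_le[OF climb_less_1[OF x, of "d_out T u"]] val_nonneg[OF x, of w]]
    by (simp add: val_child)
  have p: "val w x \<le> val (parent T w) x"
    using x mult_right_mono[OF less_imp_le[OF climb_less_1[OF x, of "d_out T w"]] val_nonneg[OF x, of "parent T w"]] w
    by (simp add: val_parent)
  show "val u x \<le> val (parent T w) x"
    using adj_cases[OF u] child p by auto
  assume x': "0 < x" and ne: "u \<noteq> parent T w"
  have "0 < val (parent T w) x" using val_pos[OF x'] parent_O[OF O_V[OF w] O_not_r[OF w]] by blast
  then have "val w x < val (parent T w) x"
    using mult_strict_right_mono[OF climb_less_1[OF x, of "d_out T w"]] w by (simp add: val_parent)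
  then show "val u x < val (parent T w) x" using adj_cases[OF u] child ne by auto
qed

lemma val_V_minus:
  "u \<in> V_minus T w \<Longrightarrow> val u x = climb (d_out T w - 1) x * val w x"
  using V_minusD[of u w] by (auto simp: val_child dest: sym)

text \<open>A child of \<open>w\<close> has \<open>d_out\<close> at least \<open>d_out T w - 1\<close>, with equality exactly on \<open>V_minus\<close>, and
  \<open>climb k x\<close> increases with \<open>k\<close>.\<close>

lemma val_nbr_ge:
  assumes w: "w \<in> O\<^sub>p" and u: "adj T w u" and x: "0 \<le> x"
  shows "climb (d_out T w - 1) x * val w x \<le> val u x"
    and "0 < x \<Longrightarrow> u \<notin> V_minus T w \<Longrightarrow> climb (d_out T w - 1) x * val w x < val u x"
proof -
  have v0: "0 \<le> val w x" by (rule val_nonneg[OF x])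
  have le: "climb (d_out T w - 1) x * val w x \<le> val w x"
    using x mult_right_mono[OF less_imp_le[OF climb_less_1[OF x]] v0] by simp
  show 1: "climb (d_out T w - 1) x * val w x \<le> val u x"
  proof (cases "away T w u")
    case True
    then show ?thesis using d_out_child[OF True] x v0
      by (auto simp: val_child intro!: mult_right_mono climb_mono_index)
  next
    case False
    then have "u = parent T w" using adj_cases[OF u] by auto
    then have "val w x \<le> val u x"
      using x mult_right_mono[OF less_imp_le[OF climb_less_1[OF x, of "d_out T w"]] val_nonneg[OF x, of u]] w
      by (simp add: val_parent)
    with le show ?thesis by simp
  qed
  assume x': "0 < x" and n: "u \<notin> V_minus T w"
  have vp: "0 < val w x" using val_pos[OF x'] w by blast
  show "climb (d_out T w - 1) x * val w x < val u x"
  proof (cases "away T w u")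
    case True
    then have "d_out T w - 1 < d_out T u" using d_out_child[OF True] n d_out_pos[OF w] by (auto simp: V_minus_def)
    then show ?thesis using True x' vp
      by (auto simp: val_child intro!: mult_strict_right_mono climb_strict_mono_index)
  next
    case False
    then have "u = parent T w" using adj_cases[OF u] by auto
    moreover have "0 < val (parent T w) x" using val_pos[OF x'] parent_O[OF O_V[OF w] O_not_r[OF w]] by blast
    ultimately have "val w x < val u x"
      using mult_strict_right_mono[OF climb_less_1[OF x, of "d_out T w"]] w by (simp add: val_parent)
    with le show ?thesis by simp
  qed
qed

lemma share_bounds:
  assumes "w \<in> O\<^sub>p" "0 \<le> x"
  shows "0 < share w x" "share w x \<le> \<epsilon>" "share w x < 1" "\<epsilon> < 1" "0 < 1 - share w x"
  using levels.stake_bounds[OF levels_open[OF assms(1)] assms(2)]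
    levels.eps_small(1)[OF levels_open[OF assms(1)]]
  unfolding share_def by auto

lemma eps_1: "\<epsilon> < 1"
  using O_ne share_bounds(4)[of _ 0] by auto

text \<open>A bankrupt Mina loses every later move, so that Maxine can walk to the root unless the game is over.\<close>

definition state_val :: "ennreal \<times> 'v \<Rightarrow> real" where
  "state_val = (\<lambda>(x, w). if w = r then 1 else if w \<in> O\<^sub>p then (if x = \<infinity> then 1 else val w (enn2real x)) else 0)"

lemma state_val_bounds: "0 \<le> state_val p" "state_val p \<le> 1"
  by (auto simp: state_val_def val_nonneg val_le_1 split: prod.split)

lemma state_val_finite: "w \<in> V \<Longrightarrow> 0 \<le> y \<Longrightarrow> state_val (ennreal y, w) = val w y"
  using V_cases[of w] val_leaf[of w] by (auto simp: state_val_def O_not_r)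

lemma state_val_infinite: "w \<in> O\<^sub>p \<or> w = r \<Longrightarrow> state_val (\<infinity>, w) = 1"
  by (auto simp: state_val_def)

definition staked_val :: "real \<Rightarrow> 'v \<Rightarrow> (ennreal \<Rightarrow> 'v) \<Rightarrow> (ennreal \<Rightarrow> 'v) \<Rightarrow> real \<Rightarrow> real \<Rightarrow> real" where
  "staked_val x w m m' a b = (let x' = next_fortune x a b; q = win_prob x a b in
     (1 - \<epsilon>) * state_val (x', w) + \<epsilon> * (q * state_val (x', m x') + (1 - q) * state_val (x', m' x')))"

text \<open>Against Mina's equilibrium play. Any move of Maxine is at most as good as the parent, and then
  \<open>maxine_turn\<close> applies. Equality leaves no alternative to the stake; the
  fortune is then unchanged and her win probability positive, so that her move matters and has to be the
  parent.\<close>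

lemma staked_val_upper:
  assumes w: "w \<in> O\<^sub>p" and x: "0 \<le> x" and a: "0 \<le> a" "a \<le> x"
    and m: "\<And>x'. adj T w (m x')" and m': "\<And>x'. m' x' \<in> V_minus T w"
  shows "staked_val x w m m' a (share w x) \<le> val w x"
    and "0 < x \<Longrightarrow> staked_val x w m m' a (share w x) = val w x \<Longrightarrow> a = x * share w x \<and> m (ennreal x) = parent T w"
proof -
  interpret L: levels "card V" "d_out T w" "levels_at (parent T w)" \<epsilon> by (rule levels_open[OF w])
  define s where "s = share w x"
  note s = share_bounds[OF w x, folded s_def]
  define y where "y = (x - a) / (1 - s)"
  define q where "q = a / (a + s)"
  define x' where "x' = ennreal y"
  have y: "0 \<le> y" using a s by (simp add: y_def)
  have nf: "next_fortune x a s = x'" using s by (simp add: next_fortune_def x'_def y_def)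
  have wp: "win_prob x a s = q" using s by (simp add: win_prob_def q_def)
  have q: "0 \<le> q" "q \<le> 1" using a s by (auto simp: q_def)
  have wV: "w \<in> V" "m x' \<in> V" "m' x' \<in> V"
    using O_V[OF w] adjD(2)[OF m] awayD(2)[OF V_minusD(1)[OF m']] by auto
  have rt: "staked_val x w m m' a s = (1 - \<epsilon>) * val w y + \<epsilon> * (q * val (m x') y + (1 - q) * val (m' x') y)"
    unfolding staked_val_def Let_def nf wp x'_def using wV y by (simp add: state_val_finite x'_def)
  have tv: "turn_value \<epsilon> (d_out T w) (levels_at (parent T w)) y q
      = (1 - \<epsilon>) * val w y + \<epsilon> * (q * val (parent T w) y + (1 - q) * (climb (d_out T w - 1) y * val w y))"
    unfolding turn_value_def val_open[OF w] by (simp add: val_def)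
  have m'v: "val (m' x') y = climb (d_out T w - 1) y * val w y" by (rule val_V_minus[OF m'])
  have le: "staked_val x w m m' a s \<le> turn_value \<epsilon> (d_out T w) (levels_at (parent T w)) y q"
    unfolding rt tv m'v using val_nbr_le(1)[OF w m y] q eps
    by (intro add_left_mono mult_left_mono add_right_mono) auto
  have tv_le: "turn_value \<epsilon> (d_out T w) (levels_at (parent T w)) y q \<le> val w x"
    using L.maxine_turn(1)[OF x a] unfolding share_def[symmetric] s_def[symmetric] y_def q_def val_open[OF w] .
  show "staked_val x w m m' a (share w x) \<le> val w x" using le tv_le by (simp add: s_def)
  assume x0: "0 < x" and eq: "staked_val x w m m' a (share w x) = val w x"
  have as: "a = x * s"
  proof (rule ccontr)
    assume ne: "a \<noteq> x * s"
    have "turn_value \<epsilon> (d_out T w) (levels_at (parent T w)) y q < val w x"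
      using L.maxine_turn(2)[OF x a x0] ne unfolding share_def[symmetric] s_def[symmetric] y_def q_def val_open[OF w] by blast
    then show False using le eq by (simp add: s_def)
  qed
  have "x - a = x * (1 - s)" using as by (simp add: right_diff_distrib)
  then have yx: "y = x" using s unfolding y_def by simp
  have q0: "0 < q" using as x0 s by (simp add: q_def add_pos_pos)
  have "m x' = parent T w"
  proof (rule ccontr)
    assume "m x' \<noteq> parent T w"
    then have "val (m x') y < val (parent T w) y" using val_nbr_le(2)[OF w m] x0 yx by simp
    then have "staked_val x w m m' a s < turn_value \<epsilon> (d_out T w) (levels_at (parent T w)) y q"
      unfolding rt tv m'v using q0 eps by simp
    then show False using tv_le eq by (simp add: s_def)
  qed
  then show "a = x * share w x \<and> m (ennreal x) = parent T w" using as yx by (simp add: s_def x'_def)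
qed

text \<open>Against Maxine's equilibrium play. If Mina does not stake everything, the argument is that
  of \<open>staked_val_upper\<close>.\<close>

lemma staked_val_lower:
  assumes w: "w \<in> O\<^sub>p" and x: "0 \<le> x" and b: "0 \<le> b" "b \<le> 1"
    and m': "\<And>x'. adj T w (m' x')"
  shows "val w x \<le> staked_val x w (\<lambda>_. parent T w) m' (x * share w x) b"
    and "0 < x \<Longrightarrow> staked_val x w (\<lambda>_. parent T w) m' (x * share w x) b = val w x
      \<Longrightarrow> b = share w x \<and> m' (ennreal x) \<in> V_minus T w"
proof -
  interpret L: levels "card V" "d_out T w" "levels_at (parent T w)" \<epsilon> by (rule levels_open[OF w])
  define s where "s = share w x"
  note s = share_bounds[OF w x, folded s_def]
  define q where "q = win_prob x (x * s) b"
  have q: "0 \<le> q" "q \<le> 1" using win_prob_01[of x "x * s" b] x s b by (auto simp: q_def)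
  have pV: "parent T w \<in> V" using parent_of(1)[OF O_V[OF w] O_not_r[OF w]] .
  let ?t = "staked_val x w (\<lambda>_. parent T w) m' (x * s) b"
  have nonneg: "0 \<le> ?t"
    unfolding staked_val_def Let_def q_def[symmetric] using q eps eps_1 state_val_bounds
    by (intro add_nonneg_nonneg mult_nonneg_nonneg) auto
  have main: "val w x \<le> ?t \<and> (?t = val w x \<longrightarrow> b = s \<and> m' (ennreal x) \<in> V_minus T w)" if x0: "0 < x"
  proof (cases "b = 1")
    case False
    then have b1: "b < 1" using b by simp
    define y where "y = x * (1 - s) / (1 - b)"
    define x' where "x' = ennreal y"
    have y: "0 < y" using x0 s b1 by (simp add: y_def)
    have nf: "next_fortune x (x * s) b = x'"
      using b1 by (simp add: next_fortune_def x'_def y_def right_diff_distrib)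
    have as: "0 < x * s" using x0 s by simp
    then have "x * s \<noteq> 0" by linarith
    then have wp: "q = x * s / (x * s + b)"
      unfolding q_def win_prob_def by (simp del: mult_eq_0_iff)
    have wV: "w \<in> V" "m' x' \<in> V" using O_V[OF w] adjD(2)[OF m'] by auto
    have rt: "?t = (1 - \<epsilon>) * val w y + \<epsilon> * (q * val (parent T w) y + (1 - q) * val (m' x') y)"
      unfolding staked_val_def Let_def nf q_def[symmetric] x'_def using wV y pV by (simp add: state_val_finite x'_def)
    have tv: "turn_value \<epsilon> (d_out T w) (levels_at (parent T w)) y q
        = (1 - \<epsilon>) * val w y + \<epsilon> * (q * val (parent T w) y + (1 - q) * (climb (d_out T w - 1) y * val w y))"
      unfolding turn_value_def val_open[OF w] by (simp add: val_def)
    have ge: "turn_value \<epsilon> (d_out T w) (levels_at (parent T w)) y q \<le> ?t"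
      unfolding rt tv using val_nbr_ge(1)[OF w m'] q eps y
      by (intro add_left_mono mult_left_mono) auto
    have tv_ge: "val w x \<le> turn_value \<epsilon> (d_out T w) (levels_at (parent T w)) y q"
      using L.mina_turn(1)[OF x b(1) b1] unfolding share_def[symmetric] s_def[symmetric] y_def wp val_open[OF w] .
    have "b = s \<and> m' (ennreal x) \<in> V_minus T w" if eq: "?t = val w x"
    proof
      show bs: "b = s"
      proof (rule ccontr)
        assume ne: "b \<noteq> s"
        have "val w x < turn_value \<epsilon> (d_out T w) (levels_at (parent T w)) y q"
          using L.mina_turn(2)[OF x b(1) b1 x0] ne unfolding share_def[symmetric] s_def[symmetric] y_def wp val_open[OF w] by blast
        then show False using ge eq by simp
      qed
      have yx: "y = x" using bs s by (simp add: y_def)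
      have q1: "q < 1" unfolding wp using bs s as by simp
      show "m' (ennreal x) \<in> V_minus T w"
      proof (rule ccontr)
        assume "m' (ennreal x) \<notin> V_minus T w"
        then have "climb (d_out T w - 1) y * val w y < val (m' x') y"
          using val_nbr_ge(2)[OF w m' _ _ , of y] y by (simp add: x'_def yx)
        then have "turn_value \<epsilon> (d_out T w) (levels_at (parent T w)) y q < ?t"
          unfolding rt tv using q1 eps by simp
        then show False using tv_ge eq by simp
      qed
    qed
    then show ?thesis using ge tv_ge by auto
  next
    case True
    \<comment> \<open>Mina stakes everything. Unless she wins the move and finishes at a leaf, Maxine wins the game.\<close>
    have as: "0 < x * s" "x * s \<noteq> x" using x0 s by auto
    have nf: "next_fortune x (x * s) b = \<infinity>" using True as by (simp add: next_fortune_def)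
    have wp: "q = x * s / (x * s + 1)" using as True by (simp add: win_prob_def q_def)
    define c where "c = state_val (\<infinity>, m' \<infinity>)"
    have c: "0 \<le> c" by (simp add: c_def state_val_bounds)
    have rt: "?t = (1 - \<epsilon>) + \<epsilon> * (q + (1 - q) * c)"
      unfolding staked_val_def Let_def nf q_def[symmetric]
      using w state_val_infinite[of w] state_val_infinite[of "parent T w"] parent_O[OF O_V[OF w] O_not_r[OF w]]
      by (simp add: c_def)
    have "val w x < ?t"
    proof (cases "d_out T w = 1")
      case True
      have "val w x < (1 - \<epsilon>) + \<epsilon> * q"
        unfolding wp val_open[OF w] s_def share_def by (rule L.mina_bankrupt[OF x0 True refl])
      also have "\<dots> \<le> ?t" unfolding rt using c q eps by (simp add: mult_left_mono)
      finally show ?thesis .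
    next
      case False
      have "m' \<infinity> \<in> O\<^sub>p \<or> m' \<infinity> = r"
      proof -
        have "m' \<infinity> \<notin> B - {r}"
        proof
          assume l: "m' \<infinity> \<in> B - {r}"
          then have "d_out T (m' \<infinity>) = 0" using d_out_leaf by blast
          moreover have "away T w (m' \<infinity>)"
            using adj_cases[OF m', of \<infinity>] parent_O[OF O_V[OF w] O_not_r[OF w]] l O_not_B by auto
          ultimately have "d_out T w \<le> 1" using d_out_child by fastforce
          then show False using False d_out_pos[OF w] by simp
        qed
        then show ?thesis using V_cases adjD(2)[OF m'] by auto
      qed
      then have "c = 1" unfolding c_def by (rule state_val_infinite)
      then have "?t = 1" by (simp add: rt)
      moreover have "val w x < 1"
      proof -
        have "val w x \<le> climb (d_out T w) x * 1"
          unfolding val_parent[OF w] using val_le_1[OF x] climb_nonneg[OF x] by (intro mult_left_mono) auto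
        then show ?thesis using climb_less_1[OF x, of "d_out T w"] by simp
      qed
      ultimately show ?thesis by simp
    qed
    then show ?thesis by simp
  qed
  show "val w x \<le> staked_val x w (\<lambda>_. parent T w) m' (x * share w x) b"
    using main nonneg val_at_0[OF w] x by (cases "x = 0") (auto simp: s_def)
  show "0 < x \<Longrightarrow> staked_val x w (\<lambda>_. parent T w) m' (x * share w x) b = val w x
      \<Longrightarrow> b = share w x \<and> m' (ennreal x) \<in> V_minus T w"
    using main by (simp add: s_def)
qed

lemma equilibrium_turn:
  assumes "w \<in> O\<^sub>p" "0 < x"
  shows "next_fortune x (x * share w x) (share w x) = ennreal x"
    and "win_prob x (x * share w x) (share w x) = x / (1 + x)"
proof -
  note s = share_bounds[OF assms(1), of x]
  have "x - x * share w x = x * (1 - share w x)" by (simp add: algebra_simps)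
  then show "next_fortune x (x * share w x) (share w x) = ennreal x"
    using s assms by (simp add: next_fortune_def)
  have "x * share w x + share w x = (1 + x) * share w x" by (simp add: algebra_simps)
  then show "win_prob x (x * share w x) (share w x) = x / (1 + x)"
    using s assms by (simp add: win_prob_def)
qed

end

section \<open>The game as a Markov chain\<close>

lemma measurable_halfline_borel: "f \<in> M \<rightarrow>\<^sub>M halfline \<Longrightarrow> f \<in> M \<rightarrow>\<^sub>M borel"
  by (simp add: measurable_restrict_space2_iff)

lemma measurable_Pair_pmf: "Pair x \<in> measure_pmf P \<rightarrow>\<^sub>M game_space"
  by (simp add: space_game_space)

locale play = equilibrium T \<epsilon> for T :: "'v rooted_graph" and \<epsilon> :: real +
  fixes Sm Sp :: "'v strategy"
  assumes Sm: "Sm \<in> mina_strategies T" and Sp: "Sp \<in> maxine_strategies T"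
begin

lemmas Sm' = Sm[unfolded mina_strategies_def] and Sp' = Sp[unfolded maxine_strategies_def]

definition turn_law :: "'v \<Rightarrow> nat \<Rightarrow> real \<Rightarrow> real \<Rightarrow> real \<Rightarrow> (ennreal \<times> 'v) measure" where
  "turn_law w i z a b = (let x' = next_fortune z a b in
     distr (measure_pmf (turn_pmf \<epsilon> (win_prob z a b) w (snd Sp x' w i) (snd Sm x' w i))) game_space (Pair x'))"

definition turn_mean :: "(ennreal \<times> 'v \<Rightarrow> ennreal) \<Rightarrow> 'v \<Rightarrow> nat \<Rightarrow> real \<Rightarrow> real \<Rightarrow> real \<Rightarrow> ennreal" where
  "turn_mean f w i z a b = (let x' = next_fortune z a b; q = win_prob z a b in
     ennreal (1 - \<epsilon>) * f (x', w) + ennreal \<epsilon> * (ennreal q * f (x', snd Sp x' w i) + ennreal (1 - q) * f (x', snd Sm x' w i)))"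

lemma nn_integral_distr_pair:
  assumes "f \<in> borel_measurable game_space"
  shows "(\<integral>\<^sup>+p. f p \<partial>distr (measure_pmf P) game_space (Pair x)) = (\<integral>\<^sup>+y. f (x, y) \<partial>measure_pmf P)"
  using assms by (intro nn_integral_distr measurable_Pair_pmf) simp

lemma nn_integral_turn_law:
  assumes f: "f \<in> borel_measurable game_space" and "0 \<le> z" "0 \<le> a" "0 \<le> b"
  shows "(\<integral>\<^sup>+p. f p \<partial>turn_law w i z a b) = turn_mean f w i z a b"
  unfolding turn_law_def turn_mean_def Let_def nn_integral_distr_pair[OF f]
  using win_prob_01[of z a b] assms eps eps_1 by (intro nn_integral_turn_pmf) auto

lemma prob_space_turn_law: "prob_space (turn_law w i z a b)"
  unfolding turn_law_def Let_def
  by (intro prob_space.prob_space_distr prob_space_measure_pmf measurable_Pair_pmf)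

lemma sets_turn_law: "sets (turn_law w i z a b) = sets game_space"
  by (simp add: turn_law_def Let_def)

lemma measurable_turn_mean:
  assumes f: "f \<in> borel_measurable game_space" and w: "w \<in> O\<^sub>p" and i: "1 \<le> i"
    and zab: "z \<in> borel_measurable M" "a \<in> borel_measurable M" "b \<in> borel_measurable M"
  shows "(\<lambda>p. turn_mean f w i (z p) (a p) (b p)) \<in> borel_measurable M"
proof -
  define X' where "X' p = next_fortune (z p) (a p) (b p)" for p
  have X': "X' \<in> M \<rightarrow>\<^sub>M borel" unfolding X'_def using zab by (rule measurable_next_fortune)
  have q: "(\<lambda>p. win_prob (z p) (a p) (b p)) \<in> borel_measurable M" using zab by (rule measurable_win_prob)
  have pair: "(\<lambda>p. f (X' p, g (X' p))) \<in> borel_measurable M" if g: "g \<in> borel \<rightarrow>\<^sub>M count_space UNIV" for g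
  proof (rule measurable_compose[OF _ f])
    show "(\<lambda>p. (X' p, g (X' p))) \<in> M \<rightarrow>\<^sub>M game_space"
      unfolding game_space_def by (intro measurable_Pair X' measurable_compose[OF X' g])
  qed
  note [measurable] = q pair[of "\<lambda>_. w"] pair[OF strategy_move_measurable[OF Sm' w i]]
    pair[OF strategy_move_measurable[OF Sp' w i]]
  show ?thesis unfolding turn_mean_def Let_def X'_def[symmetric] by measurable
qed

lemma measurable_turn_law:
  assumes w: "w \<in> O\<^sub>p" and i: "1 \<le> i"
  shows "(\<lambda>p. turn_law w i (fst (fst p)) (snd (fst p)) (snd p))
    \<in> (halfline \<Otimes>\<^sub>M halfline) \<Otimes>\<^sub>M halfline \<rightarrow>\<^sub>M prob_algebra game_space"
proof (rule measurable_prob_algebraI)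
  let ?M = "(halfline \<Otimes>\<^sub>M halfline) \<Otimes>\<^sub>M halfline"
  show "prob_space (turn_law w i (fst (fst p)) (snd (fst p)) (snd p))" for p
    by (rule prob_space_turn_law)
  show "(\<lambda>p. turn_law w i (fst (fst p)) (snd (fst p)) (snd p)) \<in> ?M \<rightarrow>\<^sub>M subprob_algebra game_space"
  proof (rule measurable_subprob_algebra)
    show "subprob_space (turn_law w i (fst (fst p)) (snd (fst p)) (snd p))" for p
      by (rule prob_space_imp_subprob_space[OF prob_space_turn_law])
    show "sets (turn_law w i (fst (fst p)) (snd (fst p)) (snd p)) = sets game_space" for p
      by (rule sets_turn_law)
    fix A assume A: "A \<in> sets (game_space :: (ennreal \<times> 'v) measure)"
    have m: "(\<lambda>p. fst (fst p)) \<in> ?M \<rightarrow>\<^sub>M borel" "(\<lambda>p. snd (fst p)) \<in> ?M \<rightarrow>\<^sub>M borel" "snd \<in> ?M \<rightarrow>\<^sub>M borel"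
      by (intro measurable_halfline_borel measurable_compose[OF measurable_fst] measurable_fst measurable_snd)+
    have "(\<lambda>p. turn_mean (indicator A) w i (fst (fst p)) (snd (fst p)) (snd p)) \<in> borel_measurable ?M"
      using A by (intro measurable_turn_mean w i m) auto
    moreover have "emeasure (turn_law w i (fst (fst p)) (snd (fst p)) (snd p)) A
        = turn_mean (indicator A) w i (fst (fst p)) (snd (fst p)) (snd p)" if "p \<in> space ?M" for p
    proof -
      have "0 \<le> fst (fst p)" "0 \<le> snd (fst p)" "0 \<le> snd p"
        using that by (auto simp: space_pair_measure space_halfline)
      then show ?thesis using A
        by (subst nn_integral_turn_law[symmetric]) (auto simp: sets_turn_law)
    qed
    ultimately show "(\<lambda>p. emeasure (turn_law w i (fst (fst p)) (snd (fst p)) (snd p)) A) \<in> borel_measurable ?M"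
      by (simp cong: measurable_cong)
  qed
qed

definition finite_turn :: "'v \<Rightarrow> nat \<Rightarrow> real \<Rightarrow> (ennreal \<times> 'v) measure" where
  "finite_turn w i z = fst Sp z w i \<bind> (\<lambda>a. fst Sm z w i \<bind> turn_law w i z a)"

lemma measurable_inner_turn:
  assumes w: "w \<in> O\<^sub>p" and i: "1 \<le> i"
  shows "(\<lambda>p. fst Sm (fst p) w i \<bind> turn_law w i (fst p) (snd p)) \<in> halfline \<Otimes>\<^sub>M halfline \<rightarrow>\<^sub>M prob_algebra game_space"
proof (rule measurable_bind_prob_space2)
  show "(\<lambda>p. fst Sm (fst p) w i) \<in> halfline \<Otimes>\<^sub>M halfline \<rightarrow>\<^sub>M prob_algebra halfline"
    by (rule measurable_compose[OF measurable_fst strategy_stake_measurable[OF Sm' w i]])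
  show "(\<lambda>(p, b). turn_law w i (fst p) (snd p) b) \<in> (halfline \<Otimes>\<^sub>M halfline) \<Otimes>\<^sub>M halfline \<rightarrow>\<^sub>M prob_algebra game_space"
    using measurable_turn_law[OF w i] by (simp add: case_prod_beta')
qed

lemma measurable_finite_turn:
  assumes w: "w \<in> O\<^sub>p" and i: "1 \<le> i"
  shows "finite_turn w i \<in> halfline \<rightarrow>\<^sub>M prob_algebra game_space"
  unfolding finite_turn_def
proof (rule measurable_bind_prob_space2)
  show "(\<lambda>z. fst Sp z w i) \<in> halfline \<rightarrow>\<^sub>M prob_algebra halfline"
    by (rule strategy_stake_measurable[OF Sp' w i])
  show "(\<lambda>(z, a). fst Sm z w i \<bind> turn_law w i z a) \<in> halfline \<Otimes>\<^sub>M halfline \<rightarrow>\<^sub>M prob_algebra game_space"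
    using measurable_inner_turn[OF w i] by (simp add: case_prod_beta')
qed

abbreviation "kern i \<equiv> game_kernel T \<epsilon> Sm Sp i"

lemma kern_closed: "w \<notin> O\<^sub>p \<Longrightarrow> kern i (x, w) = return game_space (x, w)"
  by (simp add: game_kernel_def)

lemma kern_infinite: "w \<in> O\<^sub>p \<Longrightarrow> kern i (\<infinity>, w) =
    distr (measure_pmf (turn_pmf \<epsilon> 1 w (snd Sp \<infinity> w i) (snd Sm \<infinity> w i))) game_space (Pair \<infinity>)"
  by (simp add: game_kernel_def)

lemma kern_finite: "w \<in> O\<^sub>p \<Longrightarrow> x \<noteq> \<infinity> \<Longrightarrow> kern i (x, w) = finite_turn w i (enn2real x)"
  by (simp add: game_kernel_def finite_turn_def turn_law_def[abs_def])

lemma measurable_kern: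
  assumes i: "1 \<le> i"
  shows "kern i \<in> game_space \<rightarrow>\<^sub>M prob_algebra game_space"
proof -
  let ?F = "\<lambda>x w. if x = \<infinity> then kern i (\<infinity>, w) else finite_turn w i (enn2real x)"
  have "(\<lambda>x. ?F x w) \<in> borel \<rightarrow>\<^sub>M prob_algebra game_space" if w: "w \<in> O\<^sub>p" for w
  proof (rule measurable_If)
    have "prob_space (kern i (\<infinity>, w))" unfolding kern_infinite[OF w]
      by (intro prob_space.prob_space_distr prob_space_measure_pmf measurable_Pair_pmf)
    moreover have "sets (kern i (\<infinity>, w)) = sets game_space" unfolding kern_infinite[OF w] by simp
    ultimately show "(\<lambda>x. kern i (\<infinity>, w)) \<in> borel \<rightarrow>\<^sub>M prob_algebra game_space"
      by (intro measurable_const) (simp add: space_prob_algebra)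
    have "enn2real \<in> borel \<rightarrow>\<^sub>M halfline"
      by (rule measurable_restrict_space2) auto
    from measurable_compose[OF this measurable_finite_turn[OF w i]]
    show "(\<lambda>x. finite_turn w i (enn2real x)) \<in> borel \<rightarrow>\<^sub>M prob_algebra game_space" .
  qed auto
  from measurable_state_cases[OF finite_open this measurable_return_prob_space]
  have "(\<lambda>(x, w). if w \<notin> O\<^sub>p then return game_space (x, w) else ?F x w) \<in> game_space \<rightarrow>\<^sub>M prob_algebra game_space"
    by simp
  also have "(\<lambda>(x, w). if w \<notin> O\<^sub>p then return game_space (x, w) else ?F x w) = kern i"
    using kern_closed kern_finite by (auto simp: fun_eq_iff)
  finally show ?thesis .
qed

lemma nn_integral_kern_closed:
  "f \<in> borel_measurable game_space \<Longrightarrow> w \<notin> O\<^sub>p \<Longrightarrow> (\<integral>\<^sup>+p. f p \<partial>kern i (x, w)) = f (x, w)"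
  by (simp add: kern_closed nn_integral_return space_game_space)

lemma nn_integral_kern_infinite:
  assumes "f \<in> borel_measurable game_space" "w \<in> O\<^sub>p"
  shows "(\<integral>\<^sup>+p. f p \<partial>kern i (\<infinity>, w)) = ennreal (1 - \<epsilon>) * f (\<infinity>, w) + ennreal \<epsilon> * f (\<infinity>, snd Sp \<infinity> w i)"
  unfolding kern_infinite[OF assms(2)] nn_integral_distr_pair[OF assms(1)]
  using eps eps_1 by (subst nn_integral_turn_pmf) auto

lemma nn_integral_kern_finite:
  assumes f: "f \<in> borel_measurable game_space" and w: "w \<in> O\<^sub>p" and i: "1 \<le> i" and z: "0 \<le> z"
  shows "(\<integral>\<^sup>+p. f p \<partial>kern i (ennreal z, w)) =
    (\<integral>\<^sup>+a. (\<integral>\<^sup>+b. turn_mean f w i z a b \<partial>fst Sm z w i) \<partial>fst Sp z w i)"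
proof -
  note P = strategy_stake_space(1)[OF Sp' w i z] and M = strategy_stake_space(1)[OF Sm' w i z]
  have sP: "sets (fst Sp z w i) = sets halfline" and sM: "sets (fst Sm z w i) = sets halfline"
    using P M by (auto simp: space_prob_algebra)
  have z': "z \<in> space halfline" using z by (simp add: space_halfline)
  have "(\<lambda>a. (z, a)) \<in> halfline \<rightarrow>\<^sub>M halfline \<Otimes>\<^sub>M halfline" using z' by simp
  from measurable_compose[OF this measurable_inner_turn[OF w i]]
  have 1: "(\<lambda>a. fst Sm z w i \<bind> turn_law w i z a) \<in> halfline \<rightarrow>\<^sub>M subprob_algebra game_space"
    by (simp add: measurable_prob_algebraD)
  have 2: "turn_law w i z a \<in> halfline \<rightarrow>\<^sub>M subprob_algebra game_space" if "0 \<le> a" for a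
  proof -
    have "(\<lambda>b. ((z, a), b)) \<in> halfline \<rightarrow>\<^sub>M (halfline \<Otimes>\<^sub>M halfline) \<Otimes>\<^sub>M halfline"
      using z' that by (intro measurable_Pair) (auto simp: space_pair_measure space_halfline)
    from measurable_compose[OF this measurable_turn_law[OF w i]]
    show ?thesis by (simp add: measurable_prob_algebraD)
  qed
  have "(\<integral>\<^sup>+p. f p \<partial>kern i (ennreal z, w)) = (\<integral>\<^sup>+p. f p \<partial>finite_turn w i z)"
    using kern_finite[OF w, of "ennreal z" i] z by simp
  also have "\<dots> = (\<integral>\<^sup>+a. (\<integral>\<^sup>+p. f p \<partial>(fst Sm z w i \<bind> turn_law w i z a)) \<partial>fst Sp z w i)"
    unfolding finite_turn_def using 1 by (intro nn_integral_bind[OF f]) (simp cong: measurable_cong_sets add: sP)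
  also have "\<dots> = (\<integral>\<^sup>+a. (\<integral>\<^sup>+b. turn_mean f w i z a b \<partial>fst Sm z w i) \<partial>fst Sp z w i)"
  proof (rule nn_integral_cong)
    fix a assume "a \<in> space (fst Sp z w i)"
    then have a: "0 \<le> a" using sets_eq_imp_space_eq[OF sP] by (simp add: space_halfline)
    have "(\<integral>\<^sup>+p. f p \<partial>(fst Sm z w i \<bind> turn_law w i z a)) = (\<integral>\<^sup>+b. (\<integral>\<^sup>+p. f p \<partial>turn_law w i z a b) \<partial>fst Sm z w i)"
      using 2[OF a] by (intro nn_integral_bind[OF f]) (simp cong: measurable_cong_sets add: sM)
    also have "\<dots> = (\<integral>\<^sup>+b. turn_mean f w i z a b \<partial>fst Sm z w i)"
      using sets_eq_imp_space_eq[OF sM] a z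
      by (intro nn_integral_cong nn_integral_turn_law f) (auto simp: space_halfline)
    finally show "(\<integral>\<^sup>+p. f p \<partial>(fst Sm z w i \<bind> turn_law w i z a)) = (\<integral>\<^sup>+b. turn_mean f w i z a b \<partial>fst Sm z w i)" .
  qed
  finally show ?thesis .
qed

lemma measurable_snd_pred: "Measurable.pred game_space (\<lambda>p. snd p \<in> A)" for A :: "'v set"
proof -
  have "snd \<in> (game_space :: (ennreal \<times> 'v) measure) \<rightarrow>\<^sub>M count_space UNIV"
    unfolding game_space_def by (rule measurable_snd)
  from measurable_compose[OF this, of "\<lambda>w. w \<in> A" "count_space UNIV"] show ?thesis by simp
qed

lemma sets_snd: "{p. snd p \<in> A} \<in> sets game_space" for A :: "'v set"
  using measurable_snd_pred[of A] by (simp add: pred_def space_game_space)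

lemma kern_V:
  assumes w: "w \<in> V" and i: "1 \<le> i"
  shows "AE p in kern i (x, w). snd p \<in> V"
proof -
  have pr: "kern i (x, w) \<in> space (prob_algebra game_space)"
    using measurable_space[OF measurable_kern[OF i]] by (simp add: space_game_space)
  let ?f = "indicator {p :: ennreal \<times> 'v. snd p \<in> - V} :: _ \<Rightarrow> ennreal"
  have f: "?f \<in> borel_measurable game_space" by (rule borel_measurable_indicator[OF sets_snd])
  have mv: "snd Sp y w i \<in> V" "snd Sm y w i \<in> V" if "w \<in> O\<^sub>p" for y
    using adjD(2) strategy_move_adj[OF Sp' that i] strategy_move_adj[OF Sm' that i] by blast+
  have "(\<integral>\<^sup>+p. ?f p \<partial>kern i (x, w)) = 0"
  proof (cases "w \<in> O\<^sub>p")
    case False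
    show ?thesis unfolding nn_integral_kern_closed[OF f False] using w by simp
  next
    case True
    show ?thesis
    proof (cases "x = \<infinity>")
      case inf: True
      show ?thesis unfolding inf nn_integral_kern_infinite[OF f True] using w mv[OF True] by simp
    next
      case False
      then obtain z where z: "0 \<le> z" "x = ennreal z" by (cases x) auto
      have zero: "turn_mean ?f w i z a b = 0" for a b
        using w mv[OF True] by (simp add: turn_mean_def Let_def)
      show ?thesis unfolding z(2) nn_integral_kern_finite[OF f True i z(1)] zero by simp
    qed
  qed
  then have "AE p in kern i (x, w). ?f p = 0"
    using f pr by (subst (asm) nn_integral_0_iff_AE) (auto simp: space_prob_algebra cong: measurable_cong_sets)
  then show ?thesis by (rule eventually_mono) (auto split: split_indicator_asm)
qed

end

locale play_from = play T \<epsilon> Sm Sp for T :: "'v rooted_graph" and \<epsilon> :: real and Sm Sp :: "'v strategy" +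
  fixes lam :: real and v :: 'v
  assumes lam: "0 \<le> lam" and v: "v \<in> open_play T"
begin

sublocale MC: markov_chain game_space "(ennreal lam, v)" "\<lambda>k. game_kernel T \<epsilon> Sm Sp (Suc k)"
  by standard (auto simp: space_game_space intro: measurable_kern)

lemma game_law_eq: "game_law T \<epsilon> lam v Sm Sp = MC.law"
  by (simp add: game_law_def)

abbreviation "law \<equiv> MC.law"
abbreviation "pos \<omega> k \<equiv> snd (\<omega> k)"

lemma AE_start: "AE \<omega> in law. \<omega> 0 = (ennreal lam, v)"
proof -
  have "{ennreal lam} \<times> {v} \<in> sets game_space" unfolding game_space_def by (intro pair_measureI) auto
  then have f: "indicator (- {(ennreal lam, v)}) \<in> borel_measurable game_space"
    by (intro borel_measurable_indicator) (auto simp: space_game_space[symmetric] Compl_eq_Diff_UNIV)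
  have "(\<integral>\<^sup>+\<omega>. indicator (- {(ennreal lam, v)}) (\<omega> 0) \<partial>law) = 0"
    using MC.nn_integral_start[OF f] by simp
  then have "AE \<omega> in law. indicator (- {(ennreal lam, v)}) (\<omega> 0) = (0::ennreal)"
    by (subst (asm) nn_integral_0_iff_AE) (auto intro: MC.measurable_coord[OF f])
  then show ?thesis by (rule eventually_mono) (auto split: split_indicator_asm)
qed

lemma AE_paths:
  "AE \<omega> in law. pos \<omega> 0 = v \<and> (\<forall>n. pos \<omega> n \<in> V) \<and> (\<forall>n. \<forall>b\<in>B. pos \<omega> n = b \<longrightarrow> pos \<omega> (Suc n) = b)"
proof -
  \<comment> \<open>The kernels keep the counter on the tree and at a boundary vertex once it is there.\<close>
  have "AE \<omega> in law. \<forall>n. pos \<omega> n \<in> V \<longrightarrow> pos \<omega> (Suc n) \<in> V"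
    unfolding AE_all_countable
    by (intro allI MC.AE_step measurable_snd_pred) (auto intro: kern_V)
  moreover have "AE \<omega> in law. \<forall>n. \<forall>b\<in>B. pos \<omega> n = b \<longrightarrow> pos \<omega> (Suc n) = b"
    unfolding AE_all_countable
  proof (intro allI AE_finite_allI finite_B)
    fix n b assume b: "b \<in> B"
    have "AE \<omega> in law. pos \<omega> n \<in> {b} \<longrightarrow> pos \<omega> (Suc n) \<in> {b}"
    proof (rule MC.AE_step[OF measurable_snd_pred measurable_snd_pred])
      fix p :: "ennreal \<times> 'v" assume "snd p \<in> {b}"
      then have "kern (Suc n) p = return game_space p"
        using kern_closed[of b "Suc n" "fst p"] b O_not_B by (cases p) auto
      then show "AE y in kern (Suc n) p. snd y \<in> {b}"
        using AE_return[OF _ measurable_snd_pred, of p "{b}"] \<open>snd p \<in> {b}\<close>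
        by (simp only: space_game_space UNIV_I simp_thms)
    qed
    then show "AE \<omega> in law. pos \<omega> n = b \<longrightarrow> pos \<omega> (Suc n) = b" by simp
  qed
  ultimately show ?thesis using AE_start
  proof eventually_elim
    case (elim \<omega>)
    have "pos \<omega> n \<in> V" for n
      by (induction n) (use elim O_V[OF v] in auto)
    with elim show ?case by simp
  qed
qed

text \<open>The payment without the least index, a form whose measurability is evident.\<close>

lemma Pay_eq: "Pay T X = (if \<exists>i. 1 \<le> i \<and> X i \<in> B - {r} \<and> (\<forall>j. 1 \<le> j \<and> j < i \<longrightarrow> X j \<notin> B) then 0 else 1)"
  (is "_ = (if ?Z then 0 else 1)")
proof (cases "\<exists>i\<ge>1. X i \<in> B")
  case False
  then show ?thesis by (auto simp: Pay_def)
next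
  case True
  define k where "k = (LEAST i. 1 \<le> i \<and> X i \<in> B)"
  have k: "1 \<le> k" "X k \<in> B" using True LeastI_ex[of "\<lambda>i. 1 \<le> i \<and> X i \<in> B"] by (auto simp: k_def)
  have less: "X j \<notin> B" if "1 \<le> j" "j < k" for j
    using not_less_Least[of j "\<lambda>i. 1 \<le> i \<and> X i \<in> B"] that by (auto simp: k_def)
  have "?Z \<longleftrightarrow> X k \<noteq> r"
  proof
    assume ?Z
    then obtain i where i: "1 \<le> i" "X i \<in> B - {r}" "\<forall>j. 1 \<le> j \<and> j < i \<longrightarrow> X j \<notin> B" by blast
    then have "i = k" using k less[of i] by (meson DiffD1 linorder_neqE_nat)
    with i show "X k \<noteq> r" by simp
  next
    assume "X k \<noteq> r"
    with k less show ?Z by blast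
  qed
  moreover have "Pay T X = payment T (X k)"
    unfolding Pay_def k_def using True by (rule if_P)
  ultimately show ?thesis by (simp add: payment_def split: split_indicator)
qed

lemma measurable_Pay: "Pay T \<in> borel_measurable (Pi\<^sub>M UNIV (\<lambda>_. count_space UNIV))"
proof -
  let ?M = "Pi\<^sub>M UNIV (\<lambda>_. count_space UNIV) :: (nat \<Rightarrow> 'v) measure"
  have [measurable]: "Measurable.pred ?M (\<lambda>X. X i \<in> A)" for i A
    by (rule measurable_compose[OF measurable_component_singleton, of i]) auto
  show ?thesis unfolding Pay_eq[abs_def] by measurable
qed

lemma measurable_pos: "(\<lambda>\<omega> k. pos \<omega> k) \<in> law \<rightarrow>\<^sub>M Pi\<^sub>M UNIV (\<lambda>_. count_space UNIV)"
proof (rule measurable_PiM_single')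
  have "snd \<in> (game_space :: (ennreal \<times> 'v) measure) \<rightarrow>\<^sub>M count_space UNIV"
    unfolding game_space_def by (rule measurable_snd)
  then show "(\<lambda>\<omega>. pos \<omega> i) \<in> law \<rightarrow>\<^sub>M count_space UNIV" for i
    by (rule MC.measurable_coord)
qed auto

text \<open>Maxine has not lost by time \<open>n\<close>.\<close>

definition alive :: "nat \<Rightarrow> (nat \<Rightarrow> ennreal \<times> 'v) set" where
  "alive n = {\<omega> \<in> space law. pos \<omega> n \<in> insert r O\<^sub>p}"

lemma sets_alive: "alive n \<in> sets law"
  using MC.measurable_coord[OF measurable_snd_pred[of "insert r O\<^sub>p"], of n] by (simp add: alive_def pred_def)

lemma E_alive: "MC.E n (indicator {p. snd p \<in> insert r O\<^sub>p}) = ennreal (measure law (alive n))"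
proof -
  interpret prob_space law by (rule MC.prob_law)
  have "MC.E n (indicator {p. snd p \<in> insert r O\<^sub>p}) = (\<integral>\<^sup>+\<omega>. indicator (alive n) \<omega> \<partial>law)"
    by (intro nn_integral_cong) (auto simp: alive_def split: split_indicator)
  then show ?thesis using sets_alive by (simp add: emeasure_eq_measure)
qed

lemma AE_alive_antimono: "AE \<omega> in law. \<forall>n. \<omega> \<in> alive (Suc n) \<longrightarrow> \<omega> \<in> alive n"
  using AE_paths
proof eventually_elim
  case (elim \<omega>)
  show ?case
  proof (intro allI impI)
    fix n assume a: "\<omega> \<in> alive (Suc n)"
    show "\<omega> \<in> alive n"
    proof (rule ccontr)
      assume "\<omega> \<notin> alive n"
      then have "pos \<omega> n \<in> B" "pos \<omega> n \<noteq> r" using a elim V_cases by (auto simp: alive_def)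
      then have "pos \<omega> (Suc n) = pos \<omega> n" using elim by blast
      then show False using a \<open>pos \<omega> n \<in> B\<close> \<open>pos \<omega> n \<noteq> r\<close> O_not_B by (auto simp: alive_def)
    qed
  qed
qed

text \<open>The counter stays at a leaf that it has reached. So the payment is one exactly if the counter is
  never at a leaf other than the root, which includes the games that do not end.\<close>

lemma mean_pay_eq: "mean_pay T \<epsilon> lam v Sm Sp = measure law (\<Inter>n. alive n)"
proof -
  interpret prob_space law by (rule MC.prob_law)
  have "mean_pay T \<epsilon> lam v Sm Sp = (\<integral>\<omega>. Pay T (\<lambda>k. pos \<omega> k) \<partial>law)"
    unfolding mean_pay_def gameplay_law_def game_law_eq
    by (rule integral_distr[OF measurable_pos measurable_Pay])
  also have "\<dots> = (\<integral>\<omega>. indicator (\<Inter>n. alive n) \<omega> \<partial>law)"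
  proof (rule integral_cong_AE)
    show "(\<lambda>\<omega>. Pay T (\<lambda>k. pos \<omega> k)) \<in> borel_measurable law"
      by (rule measurable_compose[OF measurable_pos measurable_Pay])
    show "indicator (\<Inter>n. alive n) \<in> borel_measurable law" using sets_alive by auto
    have "AE \<omega> in law. \<omega> \<in> space law" by simp
    with AE_paths show "AE \<omega> in law. Pay T (\<lambda>k. pos \<omega> k) = indicator (\<Inter>n. alive n) \<omega>"
    proof eventually_elim
      case (elim \<omega>)
      let ?Z = "\<exists>i. 1 \<le> i \<and> pos \<omega> i \<in> B - {r} \<and> (\<forall>j. 1 \<le> j \<and> j < i \<longrightarrow> pos \<omega> j \<notin> B)"
      have "?Z \<longleftrightarrow> \<omega> \<notin> (\<Inter>n. alive n)"
      proof
        assume ?Z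
        then obtain i where "pos \<omega> i \<in> B - {r}" by blast
        then have "\<omega> \<notin> alive i" using O_not_B by (auto simp: alive_def)
        then show "\<omega> \<notin> (\<Inter>n. alive n)" by blast
      next
        assume "\<omega> \<notin> (\<Inter>n. alive n)"
        then obtain n where "\<omega> \<notin> alive n" by blast
        then have n: "pos \<omega> n \<in> B" "pos \<omega> n \<noteq> r" using elim V_cases by (auto simp: alive_def)
        then have n0: "n \<noteq> 0" using elim v O_not_B by (cases n) auto
        define k where "k = (LEAST i. 1 \<le> i \<and> pos \<omega> i \<in> B)"
        have ex: "1 \<le> n \<and> pos \<omega> n \<in> B" using n n0 by simp
        have k: "1 \<le> k" "pos \<omega> k \<in> B" "k \<le> n"
          using LeastI[of "\<lambda>i. 1 \<le> i \<and> pos \<omega> i \<in> B", OF ex] Least_le[of "\<lambda>i. 1 \<le> i \<and> pos \<omega> i \<in> B", OF ex]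
          unfolding k_def by blast+
        have "pos \<omega> (k + m) = pos \<omega> k" for m
          using elim k(2) by (induction m) auto
        from this[of "n - k"] k have "pos \<omega> n = pos \<omega> k" by simp
        moreover have "pos \<omega> j \<notin> B" if "1 \<le> j" "j < k" for j
          using not_less_Least[of j "\<lambda>i. 1 \<le> i \<and> pos \<omega> i \<in> B"] that by (auto simp: k_def)
        ultimately show ?Z using k n by (intro exI[of _ k]) auto
      qed
      then show ?case unfolding Pay_eq by (auto split: split_indicator)
    qed
  qed
  also have "\<dots> = measure law (\<Inter>n. alive n)" using sets_alive by (auto simp: integral_indicator)
  finally show ?thesis .
qed

lemma mean_pay_upper: "mean_pay T \<epsilon> lam v Sm Sp \<le> measure law (alive n)"
proof -
  interpret prob_space law by (rule MC.prob_law)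
  show ?thesis unfolding mean_pay_eq using sets_alive by (intro finite_measure_mono) auto
qed

lemma mean_pay_lower:
  assumes "\<And>n. c \<le> measure law (alive n)"
  shows "c \<le> mean_pay T \<epsilon> lam v Sm Sp"
proof -
  interpret prob_space law by (rule MC.prob_law)
  \<comment> \<open>The events alive n decrease only almost surely.\<close>
  define D where "D n = (\<Inter>k\<in>{..n}. alive k)" for n
  have D: "D n \<in> sets law" for n unfolding D_def using sets_alive by (intro sets.finite_INT) auto
  have "measure law (D n) = measure law (alive n)" for n
  proof (rule measure_eq_AE)
    show "AE \<omega> in law. \<omega> \<in> D n \<longleftrightarrow> \<omega> \<in> alive n"
      using AE_alive_antimono
    proof eventually_elim
      case (elim \<omega>)
      have "\<omega> \<in> alive k" if "\<omega> \<in> alive n" "k \<le> n" for k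
        using that(2,1) by (induction n rule: dec_induct) (use elim in auto)
      then show ?case by (auto simp: D_def)
    qed
  qed (use D sets_alive in auto)
  then have c: "c \<le> measure law (D n)" for n using assms by simp
  have "decseq D" by (auto simp: decseq_def D_def)
  with D have "(\<lambda>n. measure law (D n)) \<longlonglongrightarrow> measure law (\<Inter>n. D n)"
    by (intro finite_Lim_measure_decseq) auto
  moreover have "(\<Inter>n. D n) = (\<Inter>n. alive n)" by (auto simp: D_def)
  ultimately show ?thesis unfolding mean_pay_eq using c by (intro LIMSEQ_le_const) auto
qed

end

section \<open>The value as a supermartingale and submartingale\<close>

lemma nn_integral_eq_imp_AE_eq:
  fixes f g :: "'a \<Rightarrow> ennreal"
  assumes f: "f \<in> borel_measurable M" and g: "g \<in> borel_measurable M" and le: "AE x in M. f x \<le> g x"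
    and eq: "(\<integral>\<^sup>+x. f x \<partial>M) = (\<integral>\<^sup>+x. g x \<partial>M)" and fin: "(\<integral>\<^sup>+x. f x \<partial>M) \<noteq> \<infinity>"
  shows "AE x in M. f x = g x"
proof -
  have "(\<integral>\<^sup>+x. g x - f x \<partial>M) = (\<integral>\<^sup>+x. g x \<partial>M) - (\<integral>\<^sup>+x. f x \<partial>M)"
    using f g le fin by (intro nn_integral_diff) auto
  also have "\<dots> = 0" using fin by (simp add: eq[symmetric] diff_eq_0_ennreal less_top)
  finally have z: "AE x in M. g x - f x = 0" using f g by (subst (asm) nn_integral_0_iff_AE) auto
  have "AE x in M. g x \<noteq> \<infinity>" using g eq fin by (intro nn_integral_noteq_infinite) auto
  with le z show ?thesis
  proof eventually_elim
    case (elim x)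
    then show ?case using diff_eq_0_iff_ennreal[of "g x" "f x"] by (auto intro: antisym)
  qed
qed

lemma measurable_geo [measurable]: "geo k \<in> borel_measurable borel"
  unfolding geo_def[abs_def] by measurable

lemma measurable_dgeo [measurable]: "dgeo k \<in> borel_measurable borel"
  unfolding dgeo_def[abs_def] by measurable

lemma measurable_escape: "escape ks \<in> borel_measurable borel"
proof (induction ks)
  case Nil
  have "escape [] = (\<lambda>_. 1)" by auto
  then show ?case by simp
next
  case (Cons k ks)
  note [measurable] = Cons.IH
  show ?case unfolding escape_Cons[abs_def] climb_def by measurable
qed

lemma borel_measurable_sum_list:
  fixes F :: "'b \<Rightarrow> 'a \<Rightarrow> real"
  assumes F: "\<And>k. F k \<in> borel_measurable M"
  shows "(\<lambda>x. \<Sum>k\<leftarrow>l. F k x) \<in> borel_measurable M"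
  by (induction l) (auto intro!: borel_measurable_add F)

lemma measurable_stake: "stake \<epsilon> d ks \<in> borel_measurable borel"
proof -
  have [measurable]: "(\<lambda>x. \<Sum>k\<leftarrow>d # ks. dgeo k x / geo k x * (geo (d - 1) x / geo (k - 1) x)) \<in> borel_measurable borel"
    by (rule borel_measurable_sum_list) measurable
  show ?thesis unfolding stake_def[abs_def] stake_den_def by measurable
qed

lemma ennreal_eq_pos: "ennreal a = ennreal b \<Longrightarrow> 0 < b \<Longrightarrow> a = b"
  by (cases "0 \<le> a") (auto simp: ennreal_neg)

context equilibrium
begin

text \<open>Mina has one optimal strategy for each choice \<open>\<theta>\<close> of moves in \<open>V_minus\<close>.\<close>

definition mina_eq :: "('v \<Rightarrow> nat \<Rightarrow> 'v) \<Rightarrow> 'v strategy" where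
  "mina_eq \<theta> = ((\<lambda>x w i. return halfline (share w x)), (\<lambda>x w i. \<theta> w i))"

definition maxine_eq :: "'v strategy" where
  "maxine_eq = ((\<lambda>x w i. return halfline (x * share w x)), (\<lambda>x w i. parent T w))"

abbreviation "Val p \<equiv> ennreal (state_val p)"

lemma measurable_val: "val w \<in> borel_measurable borel"
  unfolding val_def[abs_def] by (rule measurable_escape)

lemma measurable_share: "share w \<in> borel_measurable borel"
  unfolding share_def[abs_def] by (rule measurable_stake)

lemma measurable_Val: "(\<lambda>p. Val p) \<in> borel_measurable game_space"
proof -
  have "(\<lambda>x. if x = \<infinity> then 1 else ennreal (val w (enn2real x))) \<in> borel_measurable borel" for w
    using measurable_val[of w] by measurable
  moreover have "(\<lambda>p. if snd p = r then 1 else 0 :: ennreal) \<in> borel_measurable game_space"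
  proof -
    have "snd \<in> (game_space :: (ennreal \<times> 'v) measure) \<rightarrow>\<^sub>M count_space UNIV"
      unfolding game_space_def by (rule measurable_snd)
    from measurable_compose[OF this, of "\<lambda>w. if w = r then 1 else 0" borel] show ?thesis by simp
  qed
  ultimately have "(\<lambda>(x, w). if w \<notin> O\<^sub>p then (if snd (x, w) = r then 1 else 0) else
      if x = \<infinity> then 1 else ennreal (val w (enn2real x))) \<in> borel_measurable game_space"
    by (intro measurable_state_cases finite_open)
  also have "(\<lambda>(x, w). if w \<notin> O\<^sub>p then (if snd (x, w) = r then 1 else 0) else
      if x = \<infinity> then 1 else ennreal (val w (enn2real x))) = (\<lambda>p. Val p)"
    using O_not_r by (auto simp: fun_eq_iff state_val_def)
  finally show ?thesis .
qed

lemma measurable_bounded_open: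
  "(indicator {p. snd p \<in> O\<^sub>p \<and> fst p \<le> ennreal L} :: _ \<Rightarrow> ennreal) \<in> borel_measurable (game_space :: (ennreal \<times> 'v) measure)"
proof -
  have "(\<lambda>(x, w). if w \<notin> O\<^sub>p then (\<lambda>_. 0 :: ennreal) (x, w) else indicator {..ennreal L} x) \<in> borel_measurable game_space"
    by (rule measurable_state_cases[OF finite_open]) auto
  also have "(\<lambda>(x, w). if w \<notin> O\<^sub>p then (\<lambda>_. 0 :: ennreal) (x, w) else indicator {..ennreal L} x)
      = indicator {p. snd p \<in> O\<^sub>p \<and> fst p \<le> ennreal L}"
    by (auto simp: fun_eq_iff split: split_indicator)
  finally show ?thesis .
qed

lemma state_val_dead: "snd p \<notin> insert r O\<^sub>p \<Longrightarrow> state_val p = 0"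
  by (cases p) (auto simp: state_val_def)

lemma mina_eq_strategy:
  assumes "\<And>w i. w \<in> O\<^sub>p \<Longrightarrow> 1 \<le> i \<Longrightarrow> \<theta> w i \<in> V_minus T w"
  shows "mina_eq \<theta> \<in> mina_strategies T"
  unfolding mina_eq_def mina_strategies_def
proof (rule strategyI[OF finite_open measurable_share])
  fix x :: real and w assume "0 \<le> x" "w \<in> O\<^sub>p"
  then show "0 \<le> share w x \<and> share w x \<le> 1" using share_bounds[of w x] by simp
next
  fix w i assume "w \<in> O\<^sub>p" "1 \<le> (i::nat)"
  then show "adj T w (\<theta> w i)" using awayD(5)[OF V_minusD(1)[OF assms]] by blast
qed (rule adjD(2))

lemma maxine_eq_strategy: "maxine_eq \<in> maxine_strategies T"
  unfolding maxine_eq_def maxine_strategies_def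
proof (rule strategyI[OF finite_open, where m = "\<lambda>w i. parent T w"])
  fix w show "(\<lambda>x. x * share w x) \<in> borel_measurable borel" using measurable_share by measurable
next
  fix x :: real and w assume *: "0 \<le> x" "w \<in> O\<^sub>p"
  then show "0 \<le> x * share w x \<and> x * share w x \<le> x"
    using share_bounds[OF *(2,1)] mult_left_mono[of "share w x" 1 x] by simp
next
  fix w i assume "w \<in> O\<^sub>p"
  then show "adj T w (parent T w)" using parent_of(2)[OF O_V O_not_r] by blast
qed (rule adjD(2))

end

context play
begin

lemma turn_mean_Val:
  assumes "0 \<le> z" "0 \<le> a" "0 \<le> b"
  shows "turn_mean (\<lambda>p. Val p) w i z a b = ennreal (staked_val z w (\<lambda>x. snd Sp x w i) (\<lambda>x. snd Sm x w i) a b)"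
  unfolding turn_mean_def staked_val_def Let_def
  using win_prob_01[of z a b] assms eps eps_1 state_val_bounds
  by (simp add: ennreal_mult[symmetric] ennreal_plus[symmetric] del: ennreal_plus)

lemma measurable_turn_mean_stakes:
  assumes f: "f \<in> borel_measurable game_space" and w: "w \<in> O\<^sub>p" and i: "1 \<le> i"
  shows "(\<lambda>a. turn_mean f w i z a b) \<in> borel_measurable halfline"
    and "(\<lambda>b. turn_mean f w i z a b) \<in> borel_measurable halfline"
  by (intro measurable_turn_mean[OF f w i] measurable_const measurable_halfline_borel measurable_ident_sets refl; simp)+

lemma mina_turn_integral:
  assumes f: "f \<in> borel_measurable game_space" and w: "w \<in> O\<^sub>p" and i: "1 \<le> i" and z: "0 \<le> z"
    and Sm: "fst Sm z w i = return halfline s" "0 \<le> s"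
  shows "(\<integral>\<^sup>+p. f p \<partial>kern i (ennreal z, w)) = (\<integral>\<^sup>+a. turn_mean f w i z a s \<partial>fst Sp z w i)"
  unfolding nn_integral_kern_finite[OF f w i z] Sm(1)
  using measurable_turn_mean_stakes(2)[OF f w i] Sm(2)
  by (intro nn_integral_cong nn_integral_return) (auto simp: space_halfline)

lemma maxine_turn_integral:
  assumes f: "f \<in> borel_measurable game_space" and w: "w \<in> O\<^sub>p" and i: "1 \<le> i" and z: "0 \<le> z"
    and Sp: "fst Sp z w i = return halfline s" "0 \<le> s"
  shows "(\<integral>\<^sup>+p. f p \<partial>kern i (ennreal z, w)) = (\<integral>\<^sup>+b. turn_mean f w i z s b \<partial>fst Sm z w i)"
proof -
  note M = strategy_stake_space(1)[OF Sm' w i z]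
  have z': "z \<in> space halfline" using z by (simp add: space_halfline)
  have sM: "sets (fst Sm z w i) = sets halfline" using M by (auto simp: space_prob_algebra)
  interpret M: prob_space "fst Sm z w i" using M by (simp add: space_prob_algebra)
  have "(\<lambda>p. turn_mean f w i z (fst p) (snd p)) \<in> borel_measurable (halfline \<Otimes>\<^sub>M fst Sm z w i)"
  proof (intro measurable_turn_mean[OF f w i] measurable_const measurable_halfline_borel)
    show "fst \<in> halfline \<Otimes>\<^sub>M fst Sm z w i \<rightarrow>\<^sub>M halfline" by (rule measurable_fst)
    show "snd \<in> halfline \<Otimes>\<^sub>M fst Sm z w i \<rightarrow>\<^sub>M halfline"
      using measurable_snd[of halfline "fst Sm z w i"] sM by (simp cong: measurable_cong_sets)
  qed simp
  then have "(\<lambda>a. \<integral>\<^sup>+b. turn_mean f w i z a b \<partial>fst Sm z w i) \<in> borel_measurable halfline"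
    using M.borel_measurable_nn_integral[of "\<lambda>a b. turn_mean f w i z a b" halfline] by (simp add: case_prod_beta')
  then show ?thesis
    unfolding nn_integral_kern_finite[OF f w i z] Sp(1)
    using Sp(2) by (intro nn_integral_return) (auto simp: space_halfline)
qed

lemma moves_adj: "w \<in> O\<^sub>p \<Longrightarrow> 1 \<le> i \<Longrightarrow> adj T w (snd Sp x w i)" "w \<in> O\<^sub>p \<Longrightarrow> 1 \<le> i \<Longrightarrow> adj T w (snd Sm x w i)"
  using strategy_move_adj[OF Sp'] strategy_move_adj[OF Sm'] by blast+

text \<open>The average of \<open>staked_val_upper\<close> over Maxine's mixed stake. Equality of the means forces
  equality for almost every stake, so that the stake is deterministic.\<close>

lemma upper_turn:
  assumes Sm: "Sm = mina_eq \<theta>" and \<theta>: "\<And>w i. w \<in> O\<^sub>p \<Longrightarrow> 1 \<le> i \<Longrightarrow> \<theta> w i \<in> V_minus T w"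
    and w: "w \<in> O\<^sub>p" and i: "1 \<le> i" and z: "0 \<le> z"
  shows "(\<integral>\<^sup>+p. Val p \<partial>kern i (ennreal z, w)) \<le> ennreal (val w z)"
    and "0 < z \<Longrightarrow> (\<integral>\<^sup>+p. Val p \<partial>kern i (ennreal z, w)) = ennreal (val w z)
      \<Longrightarrow> fst Sp z w i = return halfline (z * share w z) \<and> snd Sp (ennreal z) w i = parent T w"
proof -
  let ?s = "share w z"
  have s: "0 \<le> ?s" using share_bounds[OF w z] by simp
  note P = strategy_stake_space[OF Sp' w i z]
  interpret P: prob_space "fst Sp z w i" using P(1) by (simp add: space_prob_algebra)
  have sets: "sets (fst Sp z w i) = sets halfline" using P(1) by (simp add: space_prob_algebra)
  let ?R = "\<lambda>a. staked_val z w (\<lambda>x. snd Sp x w i) (\<lambda>x. \<theta> w i) a ?s"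
  note R = staked_val_upper[where m = "\<lambda>x. snd Sp x w i" and m' = "\<lambda>x. \<theta> w i", OF w z _ _ moves_adj(1)[OF w i] \<theta>[OF w i]]
  have I: "(\<integral>\<^sup>+p. Val p \<partial>kern i (ennreal z, w)) = (\<integral>\<^sup>+a. turn_mean (\<lambda>p. Val p) w i z a ?s \<partial>fst Sp z w i)"
    using s by (intro mina_turn_integral measurable_Val w i z) (auto simp: Sm mina_eq_def)
  have T: "turn_mean (\<lambda>p. Val p) w i z a ?s = ennreal (?R a)" if "0 \<le> a" for a
    using turn_mean_Val[OF z that s] by (simp add: Sm mina_eq_def)
  have le: "AE a in fst Sp z w i. turn_mean (\<lambda>p. Val p) w i z a ?s \<le> ennreal (val w z)"
    using P(2)
  proof eventually_elim
    case (elim a)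
    then show ?case using R(1)[of a] by (simp add: T ennreal_leI)
  qed
  have "(\<integral>\<^sup>+a. turn_mean (\<lambda>p. Val p) w i z a ?s \<partial>fst Sp z w i) \<le> (\<integral>\<^sup>+a. ennreal (val w z) \<partial>fst Sp z w i)"
    by (rule nn_integral_mono_AE[OF le])
  then show "(\<integral>\<^sup>+p. Val p \<partial>kern i (ennreal z, w)) \<le> ennreal (val w z)"
    unfolding I by (simp add: P.emeasure_space_1)
  assume z0: "0 < z" and eq: "(\<integral>\<^sup>+p. Val p \<partial>kern i (ennreal z, w)) = ennreal (val w z)"
  have "AE a in fst Sp z w i. turn_mean (\<lambda>p. Val p) w i z a ?s = ennreal (val w z)"
    using measurable_turn_mean_stakes(1)[OF measurable_Val w i] eq unfolding I
    by (intro nn_integral_eq_imp_AE_eq le) (auto cong: measurable_cong_sets simp: sets P.emeasure_space_1)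
  with P(2) have ae: "AE a in fst Sp z w i. a = z * ?s \<and> snd Sp (ennreal z) w i = parent T w"
  proof eventually_elim
    case (elim a)
    then have "ennreal (?R a) = ennreal (val w z)" by (simp add: T)
    moreover have "0 < val w z" using val_pos[OF z0] w by blast
    ultimately have "?R a = val w z" by (rule ennreal_eq_pos)
    then show ?case using R(2)[of a] elim z0 by blast
  qed
  then have "fst Sp z w i = return halfline (z * ?s)"
    using s z by (intro return_halfline_eqI[OF P(1)]) (auto elim: eventually_mono)
  moreover have "snd Sp (ennreal z) w i = parent T w"
    using ae P.AE_const[of "snd Sp (ennreal z) w i = parent T w"] by (auto elim: eventually_mono)
  ultimately show "fst Sp z w i = return halfline (z * share w z) \<and> snd Sp (ennreal z) w i = parent T w" by simp
qed

lemma lower_turn: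
  assumes Sp: "Sp = maxine_eq" and w: "w \<in> O\<^sub>p" and i: "1 \<le> i" and z: "0 \<le> z"
  shows "ennreal (val w z) \<le> (\<integral>\<^sup>+p. Val p \<partial>kern i (ennreal z, w))"
    and "0 < z \<Longrightarrow> (\<integral>\<^sup>+p. Val p \<partial>kern i (ennreal z, w)) = ennreal (val w z)
      \<Longrightarrow> fst Sm z w i = return halfline (share w z) \<and> snd Sm (ennreal z) w i \<in> V_minus T w"
proof -
  let ?s = "share w z"
  have s: "0 \<le> ?s" "0 \<le> z * ?s" using share_bounds[OF w z] z by auto
  note P = strategy_stake_space[OF Sm' w i z]
  interpret P: prob_space "fst Sm z w i" using P(1) by (simp add: space_prob_algebra)
  have sets: "sets (fst Sm z w i) = sets halfline" using P(1) by (simp add: space_prob_algebra)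
  let ?R = "\<lambda>b. staked_val z w (\<lambda>x. parent T w) (\<lambda>x. snd Sm x w i) (z * ?s) b"
  note R = staked_val_lower[where m' = "\<lambda>x. snd Sm x w i", OF w z _ _ moves_adj(2)[OF w i]]
  have I: "(\<integral>\<^sup>+p. Val p \<partial>kern i (ennreal z, w)) = (\<integral>\<^sup>+b. turn_mean (\<lambda>p. Val p) w i z (z * ?s) b \<partial>fst Sm z w i)"
    using s by (intro maxine_turn_integral measurable_Val w i z) (auto simp: Sp maxine_eq_def)
  have T: "turn_mean (\<lambda>p. Val p) w i z (z * ?s) b = ennreal (?R b)" if "0 \<le> b" for b
    using turn_mean_Val[OF z s(2) that] by (simp add: Sp maxine_eq_def)
  have ge: "AE b in fst Sm z w i. ennreal (val w z) \<le> turn_mean (\<lambda>p. Val p) w i z (z * ?s) b"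
    using P(2)
  proof eventually_elim
    case (elim b)
    then show ?case using R(1)[of b] by (simp add: T ennreal_leI)
  qed
  have "(\<integral>\<^sup>+b. ennreal (val w z) \<partial>fst Sm z w i) \<le> (\<integral>\<^sup>+b. turn_mean (\<lambda>p. Val p) w i z (z * ?s) b \<partial>fst Sm z w i)"
    by (rule nn_integral_mono_AE[OF ge])
  then show "ennreal (val w z) \<le> (\<integral>\<^sup>+p. Val p \<partial>kern i (ennreal z, w))"
    unfolding I by (simp add: P.emeasure_space_1)
  assume z0: "0 < z" and eq: "(\<integral>\<^sup>+p. Val p \<partial>kern i (ennreal z, w)) = ennreal (val w z)"
  have "AE b in fst Sm z w i. ennreal (val w z) = turn_mean (\<lambda>p. Val p) w i z (z * ?s) b"
    using measurable_turn_mean_stakes(2)[OF measurable_Val w i] eq unfolding I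
    by (intro nn_integral_eq_imp_AE_eq ge) (auto cong: measurable_cong_sets simp: sets P.emeasure_space_1)
  with P(2) have ae: "AE b in fst Sm z w i. b = ?s \<and> snd Sm (ennreal z) w i \<in> V_minus T w"
  proof eventually_elim
    case (elim b)
    then have "ennreal (?R b) = ennreal (val w z)" by (simp add: T)
    moreover have "0 < val w z" using val_pos[OF z0] w by blast
    ultimately have "?R b = val w z" by (rule ennreal_eq_pos)
    then show ?case using R(2)[of b] elim z0 by blast
  qed
  then have "fst Sm z w i = return halfline ?s"
    using s by (intro return_halfline_eqI[OF P(1)]) (auto elim: eventually_mono)
  moreover have "snd Sm (ennreal z) w i \<in> V_minus T w"
    using ae P.AE_const[of "snd Sm (ennreal z) w i \<in> V_minus T w"] by (auto elim: eventually_mono)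
  ultimately show "fst Sm z w i = return halfline (share w z) \<and> snd Sm (ennreal z) w i \<in> V_minus T w" by simp
qed

lemma Val_infinite: "w \<in> O\<^sub>p \<Longrightarrow> Val (\<infinity>, w) = 1"
  using state_val_infinite[of w] by simp

lemma upper_step:
  assumes Sm: "Sm = mina_eq \<theta>" and \<theta>: "\<And>w i. w \<in> O\<^sub>p \<Longrightarrow> 1 \<le> i \<Longrightarrow> \<theta> w i \<in> V_minus T w"
    and i: "1 \<le> i"
  shows "(\<integral>\<^sup>+p. Val p \<partial>kern i q) \<le> Val q"
proof (cases q)
  case (Pair x w)
  consider "w \<notin> O\<^sub>p" | "w \<in> O\<^sub>p" "x = \<infinity>" | z where "w \<in> O\<^sub>p" "0 \<le> z" "x = ennreal z" by (cases x) auto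
  then show ?thesis
  proof cases
    case 1
    then show ?thesis using Pair by (simp add: nn_integral_kern_closed[OF measurable_Val])
  next
    case 2
    have "(\<integral>\<^sup>+p. Val p \<partial>kern i (\<infinity>, w)) \<le> ennreal (1 - \<epsilon>) * 1 + ennreal \<epsilon> * 1"
      unfolding nn_integral_kern_infinite[OF measurable_Val 2(1)]
      using state_val_bounds by (intro add_mono mult_left_mono) (auto simp: ennreal_le_1)
    also have "\<dots> = 1" using eps eps_1 by (simp add: ennreal_plus[symmetric] del: ennreal_plus)
    finally show ?thesis using Pair 2 Val_infinite[OF 2(1)] by simp
  next
    case 3
    then show ?thesis
      using upper_turn(1)[OF Sm \<theta> 3(1) i 3(2)] state_val_finite[OF O_V[OF 3(1)] 3(2)] Pair by simp
  qed
qed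

lemma lower_step:
  assumes Sp: "Sp = maxine_eq" and i: "1 \<le> i"
  shows "Val q \<le> (\<integral>\<^sup>+p. Val p \<partial>kern i q)"
proof (cases q)
  case (Pair x w)
  consider "w \<notin> O\<^sub>p" | "w \<in> O\<^sub>p" "x = \<infinity>" | z where "w \<in> O\<^sub>p" "0 \<le> z" "x = ennreal z" by (cases x) auto
  then show ?thesis
  proof cases
    case 1
    then show ?thesis using Pair by (simp add: nn_integral_kern_closed[OF measurable_Val])
  next
    case 2
    have "Val (\<infinity>, parent T w) = 1"
      using state_val_infinite parent_O[OF O_V[OF 2(1)] O_not_r[OF 2(1)]] by auto
    then have "(\<integral>\<^sup>+p. Val p \<partial>kern i (\<infinity>, w)) = ennreal (1 - \<epsilon>) + ennreal \<epsilon>"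
      unfolding nn_integral_kern_infinite[OF measurable_Val 2(1)]
      using Val_infinite[OF 2(1)] by (simp add: Sp maxine_eq_def)
    also have "\<dots> = 1" using eps eps_1 by (simp add: ennreal_plus[symmetric] del: ennreal_plus)
    finally show ?thesis using Pair 2 Val_infinite[OF 2(1)] by simp
  next
    case 3
    then show ?thesis
      using lower_turn(1)[OF Sp 3(1) i 3(2)] state_val_finite[OF O_V[OF 3(1)] 3(2)] Pair by simp
  qed
qed

end

section \<open>The payment secured by each player\<close>

context play_from
begin

lemma E_mono: "(\<And>p. f p \<le> g p) \<Longrightarrow> MC.E n f \<le> MC.E n g"
  by (rule nn_integral_mono) simp

lemma E_start_Val: "MC.E 0 (\<lambda>p. Val p) = ennreal (val v lam)"
  using MC.nn_integral_start[OF measurable_Val] state_val_finite[OF O_V[OF v] lam] by simp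

lemma E_Val_le_1: "MC.E n (\<lambda>p. Val p) \<le> 1"
proof -
  interpret prob_space law by (rule MC.prob_law)
  have "MC.E n (\<lambda>p. Val p) \<le> (\<integral>\<^sup>+\<omega>. 1 \<partial>law)"
    using state_val_bounds by (intro nn_integral_mono) (simp add: ennreal_le_1)
  then show ?thesis by (simp add: emeasure_space_1)
qed

lemma lower_mono:
  assumes Sp: "Sp = maxine_eq" and nm: "n \<le> m"
  shows "MC.E n (\<lambda>p. Val p) \<le> MC.E m (\<lambda>p. Val p)"
  using nm
proof (induction m rule: dec_induct)
  case (step m)
  note step.IH
  also have "MC.E m (\<lambda>p. Val p) \<le> MC.E (Suc m) (\<lambda>p. Val p)"
    unfolding MC.expectation_step[OF measurable_Val]
    by (intro nn_integral_mono lower_step[OF Sp]) auto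
  finally show ?case .
qed simp

text \<open>The mean value never decreases, and at each time it is at most the probability that Maxine has not
  yet lost. These probabilities tend to the mean payment.\<close>

lemma lower_pay:
  assumes Sp: "Sp = maxine_eq"
  shows "MC.E n (\<lambda>p. Val p) \<le> ennreal (mean_pay T \<epsilon> lam v Sm Sp)"
proof -
  interpret prob_space law by (rule MC.prob_law)
  obtain c where c: "0 \<le> c" "MC.E n (\<lambda>p. Val p) = ennreal c"
    using E_Val_le_1[of n] by (cases "MC.E n (\<lambda>p. Val p)") (auto simp: top_unique)
  have "c \<le> measure law (alive m)" for m
  proof -
    have "MC.E n (\<lambda>p. Val p) \<le> MC.E (max n m) (\<lambda>p. Val p)" using Sp by (intro lower_mono) auto
    also have "\<dots> \<le> MC.E (max n m) (indicator {p. snd p \<in> insert r O\<^sub>p})"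
      using state_val_bounds state_val_dead by (intro E_mono) (auto simp: ennreal_le_1 split: split_indicator)
    also have "\<dots> = ennreal (measure law (alive (max n m)))" by (rule E_alive)
    finally have "c \<le> measure law (alive (max n m))" unfolding c(2) by simp
    also have "\<dots> \<le> measure law (alive m)"
    proof (rule finite_measure_mono_AE)
      show "AE \<omega> in law. \<omega> \<in> alive (max n m) \<longrightarrow> \<omega> \<in> alive m"
        using AE_alive_antimono
      proof eventually_elim
        case (elim \<omega>)
        have "\<omega> \<in> alive m" if "\<omega> \<in> alive k" "m \<le> k" for k
          using that(2,1) by (induction k rule: dec_induct) (use elim in auto)
        then show ?case by auto
      qed
    qed (rule sets_alive)
    finally show ?thesis .
  qed
  then show ?thesis unfolding c(2) by (intro ennreal_leI mean_pay_lower)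
qed

context
  fixes \<theta> :: "'v \<Rightarrow> nat \<Rightarrow> 'v"
  assumes Sm_eq: "Sm = mina_eq \<theta>" and \<theta>: "\<And>w i. w \<in> O\<^sub>p \<Longrightarrow> 1 \<le> i \<Longrightarrow> \<theta> w i \<in> V_minus T w"
begin

lemma upper_mono: "n \<le> m \<Longrightarrow> MC.E m (\<lambda>p. Val p) \<le> MC.E n (\<lambda>p. Val p)"
proof (induction m rule: dec_induct)
  case (step m)
  have "MC.E (Suc m) (\<lambda>p. Val p) \<le> MC.E m (\<lambda>p. Val p)"
    unfolding MC.expectation_step[OF measurable_Val]
    by (intro nn_integral_mono upper_step[OF Sm_eq \<theta>]) auto
  then show ?case using step.IH by (rule order.trans)
qed simp

text \<open>By \<open>K_growth\<close>, \<open>K\<close> is at most its value at zero times a power of \<open>1 + M\<close>.\<close>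

lemma share_lower_bound:
  assumes M: "0 \<le> M"
  shows "\<exists>c>0. \<forall>w\<in>O\<^sub>p. \<forall>z. 0 \<le> z \<and> z \<le> M \<longrightarrow> c \<le> share w z"
proof -
  have one: "\<exists>c>0. \<forall>z. 0 \<le> z \<and> z \<le> M \<longrightarrow> c \<le> share w z" if w: "w \<in> O\<^sub>p" for w
  proof -
    interpret L: levels "card V" "d_out T w" "levels_at (parent T w)" \<epsilon> by (rule levels_open[OF w])
    define N where "N = 4 * card V + 1"
    define c where "c = \<epsilon> / (L.K 0 * (1 + M) ^ N)"
    have K0: "1 \<le> L.K 0" using L.K_ge_1[of 0] by simp
    have "c \<le> share w z" if z: "0 \<le> z" "z \<le> M" for z
    proof -
      have "L.K z * ((1 + 0) / (1 + z)) ^ N \<le> L.K 0" unfolding N_def using z by (intro L.K_growth) auto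
      then have "L.K z \<le> L.K 0 * (1 + z) ^ N" using z by (simp add: power_divide field_simps)
      also have "\<dots> \<le> L.K 0 * (1 + M) ^ N" using z K0 by (intro mult_left_mono power_mono) auto
      finally show ?thesis
        unfolding c_def share_def stake_def using eps L.K_ge_1[OF z(1)]
        by (intro divide_left_mono) auto
    qed
    moreover have "0 < c" unfolding c_def using eps K0 M by (intro divide_pos_pos mult_pos_pos) auto
    ultimately show ?thesis by blast
  qed
  then obtain c where c: "\<And>w. w \<in> O\<^sub>p \<Longrightarrow> 0 < c w"
    "\<And>w z. w \<in> O\<^sub>p \<Longrightarrow> 0 \<le> z \<Longrightarrow> z \<le> M \<Longrightarrow> c w \<le> share w z" by metis
  have "0 < Min (c ` O\<^sub>p)" using finite_open O_ne c(1) by (subst Min_gr_iff) auto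
  moreover have "Min (c ` O\<^sub>p) \<le> share w z" if "w \<in> O\<^sub>p" "0 \<le> z" "z \<le> M" for w z
  proof -
    have "Min (c ` O\<^sub>p) \<le> c w" using finite_open that(1) by (intro Min_le) auto
    then show ?thesis using c(2)[OF that] by simp
  qed
  ultimately show ?thesis by blast
qed

text \<open>Mina's share is at least \<open>c\<close> while the fortune is at most \<open>M\<close>, so that she wins a move with probability at
  least \<open>c / (M + c)\<close>, and her stake of at most \<open>\<epsilon>\<close> lets the fortune grow by a factor of at most
  \<open>1 / (1 - \<epsilon>)\<close> in a turn. Consider the potential \<open>f\<close> that is one off open play and otherwise equals
  \<open>\<kappa> ^ d_out w\<close> as long as the fortune is small enough for \<open>d_out w\<close> further moves of Mina to keep it
  at most \<open>M\<close>. A turn at such a state at least doubles the mean of \<open>f\<close>. As \<open>f\<close> is bounded by one, its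
  mean cannot increase by \<open>\<kappa> ^ N * \<eta>\<close> at every time from \<open>n0\<close> on.\<close>

lemma bounded_fortune_vanishes:
  assumes L: "0 < L" and \<eta>: "0 < \<eta>"
  shows "\<exists>n\<ge>n0. MC.E n (indicator {p. snd p \<in> O\<^sub>p \<and> fst p \<le> ennreal L}) \<le> ennreal \<eta>"
proof (rule ccontr)
  let ?g = "indicator {p. snd p \<in> O\<^sub>p \<and> fst p \<le> ennreal L} :: ennreal \<times> 'v \<Rightarrow> ennreal"
  assume "\<not> ?thesis"
  then have big: "ennreal \<eta> \<le> MC.E n ?g" if "n0 \<le> n" for n using that by (meson linear)
  interpret prob_space law by (rule MC.prob_law)
  define N where "N = card V"
  define e where "e = 1 - \<epsilon>"
  have e: "0 < e" "e \<le> 1" using eps eps_1 by (auto simp: e_def)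
  \<comment> \<open>fortunes up to L = M (1 - \<epsilon>) ^ N stay at most M for N turns\<close>
  define M where "M = L / e ^ N"
  have M: "0 < M" using L e by (simp add: M_def)
  obtain c where c: "0 < c" "\<And>w z. w \<in> O\<^sub>p \<Longrightarrow> 0 \<le> z \<Longrightarrow> z \<le> M \<Longrightarrow> c \<le> share w z"
    using share_lower_bound[of M] M by auto
  \<comment> \<open>half of the lower bound for the probability of a move by Mina: whence the doubling of f\<close>
  define \<kappa> where "\<kappa> = \<epsilon> * (c / (M + c)) / 2"
  have \<kappa>: "0 < \<kappa>" "\<kappa> \<le> 1"
  proof -
    show "0 < \<kappa>" using eps c M by (simp add: \<kappa>_def)
    have "\<epsilon> * (c / (M + c)) \<le> 1 * 1" using eps eps_1 c M by (intro mult_mono) auto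
    moreover have "q / 2 \<le> 1" if "q \<le> 1 * 1" for q :: real using that by simp
    ultimately show "\<kappa> \<le> 1" unfolding \<kappa>_def by blast
  qed
  let ?d = "d_out T"
  define F where "F x w = (if x \<le> ennreal (M * e ^ ?d w) then ennreal (\<kappa> ^ ?d w) else 0)" for x w
  define f where "f = (\<lambda>(x, w). if w \<notin> O\<^sub>p then (\<lambda>_. 1) (x, w) else F x w)"
  have mF: "(\<lambda>x. F x w) \<in> borel_measurable borel" for w
  proof -
    have [measurable]: "Measurable.pred borel (\<lambda>x. x \<le> ennreal (M * e ^ ?d w))" by (simp add: pred_def)
    show ?thesis unfolding F_def by measurable
  qed
  have f: "f \<in> borel_measurable game_space"
    unfolding f_def by (rule measurable_state_cases[OF finite_open mF]) simp
  note g = measurable_bounded_open[of L]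
  have f1: "f p \<le> 1" for p
    using \<kappa> by (auto simp: f_def F_def ennreal_le_1 power_le_one split: prod.split)
  have d_N: "?d w \<le> N" if "w \<in> O\<^sub>p" for w
    using d_out_less[OF O_V[OF that] O_not_r[OF that]] by (simp add: N_def)
  have step: "f p + ennreal (\<kappa> ^ N) * ?g p \<le> (\<integral>\<^sup>+q. f q \<partial>kern (Suc n) p)" for p n
  proof (cases p)
    case (Pair x w)
    show ?thesis
    proof (cases "w \<in> O\<^sub>p \<and> x \<le> ennreal (M * e ^ ?d w)")
      case False
      show ?thesis
      proof (cases "w \<in> O\<^sub>p")
        case True
        have "\<not> x \<le> ennreal L"
        proof
          assume "x \<le> ennreal L"
          also have "L = M * e ^ N" using e by (simp add: M_def)
          also have "\<dots> \<le> M * e ^ ?d w" using M e d_N[OF True] by (intro mult_left_mono power_decreasing) auto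
          finally have "x \<le> ennreal (M * e ^ ?d w)" by (simp add: ennreal_leI order.trans)
          then show False using False True by simp
        qed
        then show ?thesis using False True Pair by (simp add: f_def F_def)
      next
        case False
        have "(\<integral>\<^sup>+q. f q \<partial>kern (Suc n) p) = f p"
          unfolding Pair by (rule nn_integral_kern_closed[OF f False])
        then show ?thesis using Pair False by simp
      qed
    next
      case True
      then have w: "w \<in> O\<^sub>p" and "x \<le> ennreal (M * e ^ ?d w)" by auto
      then obtain z where z: "0 \<le> z" "x = ennreal z" "z \<le> M * e ^ ?d w"
        using M e by (cases x) (auto simp: top_unique)
      have zM: "z \<le> M"
      proof -
        have "M * e ^ ?d w \<le> M * 1" using M e by (intro mult_left_mono power_le_one) auto
        with z show ?thesis by simp
      qed
      define s where "s = share w z"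
      have s: "c \<le> s" "s \<le> \<epsilon>" "s < 1" "0 < s"
        using c(2)[OF w z(1) zM] share_bounds[OF w z(1)] by (auto simp: s_def)
      define u where "u = \<theta> w (Suc n)"
      have u: "u \<in> V_minus T w" unfolding u_def by (rule \<theta>[OF w]) simp
      have du: "?d w = Suc (?d u)" using V_minusD(2)[OF u] by simp
      have "ennreal (2 * \<kappa> ^ ?d w) \<le> turn_mean f w (Suc n) z a s" if a: "0 \<le> a" "a \<le> z" for a
      proof -
        define y where "y = (z - a) / (1 - s)"
        have nf: "next_fortune z a s = ennreal y" using s by (simp add: next_fortune_def y_def)
        have y: "0 \<le> y" using a s by (simp add: y_def)
        have wp: "1 - win_prob z a s = s / (a + s)"
        proof -
          have "1 - a / (a + s) = s / (a + s)" using s a by (simp add: field_simps)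
          then show ?thesis using s by (simp add: win_prob_def)
        qed
        have q: "c / (M + c) \<le> 1 - win_prob z a s"
        proof -
          have "c * a \<le> s * M" using s a zM c M by (intro mult_mono) auto
          then have "c * (a + s) \<le> s * (M + c)" by (simp add: algebra_simps)
          then show ?thesis unfolding wp using s a c M by (simp add: divide_simps mult.commute)
        qed
        have fu: "ennreal (\<kappa> ^ ?d u) \<le> f (ennreal y, u)"
        proof (cases "u \<in> O\<^sub>p")
          case True
          have "y \<le> z / e"
            unfolding y_def using a s z e by (intro frac_le) (auto simp: e_def)
          also have "\<dots> \<le> M * e ^ ?d w / e" using z e by (intro divide_right_mono) auto
          also have "\<dots> = M * e ^ ?d u" using e by (simp add: du)
          finally show ?thesis using True by (simp add: f_def F_def ennreal_leI)
        next
          case False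
          then show ?thesis using \<kappa> by (simp add: f_def power_le_one)
        qed
        have "2 * (t / 2) = t" for t :: real by simp
        then have "2 * \<kappa> = \<epsilon> * (c / (M + c))" unfolding \<kappa>_def .
        then have "2 * \<kappa> ^ ?d w = \<epsilon> * (c / (M + c)) * \<kappa> ^ ?d u"
          unfolding du power_Suc by (metis mult.assoc)
        then have "ennreal (2 * \<kappa> ^ ?d w) = ennreal \<epsilon> * (ennreal (c / (M + c)) * ennreal (\<kappa> ^ ?d u))"
          using eps c M \<kappa> by (simp add: ennreal_mult[symmetric] mult.assoc)
        also have "\<dots> \<le> ennreal \<epsilon> * (ennreal (1 - win_prob z a s) * f (ennreal y, u))"
          using q fu by (intro mult_left_mono mult_mono ennreal_leI) auto
        also have "\<dots> \<le> turn_mean f w (Suc n) z a s"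
          unfolding turn_mean_def Let_def nf
          by (simp add: Sm_eq mina_eq_def u_def distrib_left add_increasing add_increasing2)
        finally show ?thesis .
      qed
      note turn = this
      note P = strategy_stake_space[OF Sp' w _ z(1), of "Suc n"]
      interpret P: prob_space "fst Sp z w (Suc n)" using P(1) by (simp add: space_prob_algebra)
      have "f p + ennreal (\<kappa> ^ N) * ?g p \<le> ennreal (\<kappa> ^ ?d w) + ennreal (\<kappa> ^ ?d w)"
      proof (rule add_mono)
        show "f p \<le> ennreal (\<kappa> ^ ?d w)" using Pair w by (simp add: f_def F_def)
        have "ennreal (\<kappa> ^ N) * ?g p \<le> ennreal (\<kappa> ^ N) * 1" by (intro mult_left_mono) (auto split: split_indicator)
        also have "\<dots> \<le> ennreal (\<kappa> ^ ?d w)" using \<kappa> d_N[OF w] by (simp add: ennreal_leI power_decreasing)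
        finally show "ennreal (\<kappa> ^ N) * ?g p \<le> ennreal (\<kappa> ^ ?d w)" .
      qed
      also have "\<dots> = (\<integral>\<^sup>+a. ennreal (2 * \<kappa> ^ ?d w) \<partial>fst Sp z w (Suc n))"
        using \<kappa> by (simp add: P.emeasure_space_1 ennreal_plus[symmetric] del: ennreal_plus)
      also have "\<dots> \<le> (\<integral>\<^sup>+a. turn_mean f w (Suc n) z a s \<partial>fst Sp z w (Suc n))"
      proof (rule nn_integral_mono_AE)
        show "AE a in fst Sp z w (Suc n). ennreal (2 * \<kappa> ^ ?d w) \<le> turn_mean f w (Suc n) z a s"
          using P(2) by (rule eventually_mono) (auto intro: turn)
      qed
      also have "\<dots> = (\<integral>\<^sup>+q. f q \<partial>kern (Suc n) (ennreal z, w))"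
        using s by (intro mina_turn_integral[symmetric] f w z(1)) (auto simp: Sm_eq mina_eq_def s_def)
      finally show ?thesis using Pair z by simp
    qed
  qed
  have sum: "of_nat k * ennreal (\<kappa> ^ N * \<eta>) \<le> MC.E (n0 + k) f" for k
  proof (induction k)
    case (Suc k)
    have "of_nat (Suc k) * ennreal (\<kappa> ^ N * \<eta>) \<le> MC.E (n0 + k) f + ennreal (\<kappa> ^ N) * MC.E (n0 + k) ?g"
    proof -
      have "ennreal (\<kappa> ^ N * \<eta>) = ennreal (\<kappa> ^ N) * ennreal \<eta>" using \<kappa> \<eta> by (simp add: ennreal_mult)
      also have "\<dots> \<le> ennreal (\<kappa> ^ N) * MC.E (n0 + k) ?g" using big[of "n0 + k"] by (intro mult_left_mono) auto
      finally have le: "ennreal (\<kappa> ^ N * \<eta>) \<le> ennreal (\<kappa> ^ N) * MC.E (n0 + k) ?g" .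
      have "of_nat (Suc k) * ennreal (\<kappa> ^ N * \<eta>) = of_nat k * ennreal (\<kappa> ^ N * \<eta>) + ennreal (\<kappa> ^ N * \<eta>)"
        by (simp add: distrib_right add.commute)
      also have "\<dots> \<le> MC.E (n0 + k) f + ennreal (\<kappa> ^ N) * MC.E (n0 + k) ?g"
        by (rule add_mono[OF Suc.IH le])
      finally show ?thesis .
    qed
    also have "\<dots> = MC.E (n0 + k) (\<lambda>p. f p + ennreal (\<kappa> ^ N) * ?g p)"
      using MC.measurable_coord[OF f, of "n0 + k"] MC.measurable_coord[OF g, of "n0 + k"]
      by (simp add: nn_integral_add nn_integral_cmult)
    also have "\<dots> \<le> MC.E (Suc (n0 + k)) f"
      unfolding MC.expectation_step[OF f] by (intro nn_integral_mono step)
    finally show ?case by simp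
  qed simp
  obtain k :: nat where k: "1 < real k * (\<kappa> ^ N * \<eta>)"
    using reals_Archimedean3[of "\<kappa> ^ N * \<eta>"] \<kappa> \<eta> by auto
  have "MC.E (n0 + k) f \<le> (\<integral>\<^sup>+\<omega>. 1 \<partial>law)" using f1 by (intro nn_integral_mono) auto
  then have "of_nat k * ennreal (\<kappa> ^ N * \<eta>) \<le> 1" using sum[of k] by (simp add: emeasure_space_1)
  then have "ennreal (real k * (\<kappa> ^ N * \<eta>)) \<le> ennreal 1"
    using \<kappa> \<eta> by (simp add: ennreal_mult ennreal_of_nat_eq_real_of_nat)
  with k show False by simp
qed

text \<open>Games in which Maxine has not lost by a late time are finished at the root, or have a fortune above
  \<open>L\<close> and thus value at least \<open>(L / (1 + L)) ^ card V\<close>, or belong to the event of small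
  probability in \<open>bounded_fortune_vanishes\<close>. Then \<open>L \<rightarrow> \<infinity>\<close>.\<close>

lemma upper_pay: "ennreal (mean_pay T \<epsilon> lam v Sm Sp) \<le> MC.E n (\<lambda>p. Val p)"
proof -
  interpret prob_space law by (rule MC.prob_law)
  obtain e where e: "0 \<le> e" "MC.E n (\<lambda>p. Val p) = ennreal e"
    using E_Val_le_1[of n] by (cases "MC.E n (\<lambda>p. Val p)") (auto simp: top_unique)
  let ?m = "mean_pay T \<epsilon> lam v Sm Sp"
  have m0: "0 \<le> ?m" by (simp add: mean_pay_eq)
  have main: "?m * (L / (1 + L)) ^ card V \<le> e" if L: "0 < L" for L
  proof -
    define t where "t = (L / (1 + L)) ^ card V"
    have t: "0 < t" "t \<le> 1" using L by (auto simp: t_def power_le_one)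
    have "?m * t \<le> e + \<eta>" if \<eta>: "0 < \<eta>" for \<eta>
    proof -
      let ?g = "indicator {p. snd p \<in> O\<^sub>p \<and> fst p \<le> ennreal L} :: ennreal \<times> 'v \<Rightarrow> ennreal"
      obtain k where k: "n \<le> k" "MC.E k ?g \<le> ennreal \<eta>"
        using bounded_fortune_vanishes[OF L \<eta>, of n] by blast
      have pt: "ennreal t * indicator {p. snd p \<in> insert r O\<^sub>p} p \<le> Val p + ?g p" for p :: "ennreal \<times> 'v"
      proof (cases p)
        case (Pair x w)
        consider "w = r" | "w \<in> O\<^sub>p" "x \<le> ennreal L" | "w \<in> O\<^sub>p" "x = \<infinity>"
          | y where "w \<in> O\<^sub>p" "x = ennreal y" "L \<le> y" | "w \<notin> insert r O\<^sub>p"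
        proof (cases x)
          case (real y)
          with that show ?thesis by (cases "y \<le> L"; cases "w \<in> O\<^sub>p"; cases "w = r") (auto simp: ennreal_leI)
        next
          case top
          with that show ?thesis by (cases "w \<in> O\<^sub>p"; cases "w = r") auto
        qed
        then show ?thesis
        proof cases
          case 1
          then show ?thesis using Pair t O_not_r by (auto simp: state_val_def ennreal_le_1 split: split_indicator)
        next
          case 2
          then have "ennreal t * indicator {p. snd p \<in> insert r O\<^sub>p} p \<le> ?g p"
            using Pair t by (simp add: ennreal_le_1)
          then show ?thesis by (simp add: add_increasing)
        next
          case 3
          then show ?thesis using Pair t Val_infinite[OF 3(1)] by (simp add: ennreal_le_1 add_increasing2)
        next
          case 4
          then have y0: "0 \<le> y" using L by simp
          have "L / (1 + L) \<le> y / (1 + y)" using 4(3) L by (simp add: field_simps)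
          then have "t \<le> (y / (1 + y)) ^ card V" unfolding t_def using L by (intro power_mono) auto
          also have "\<dots> \<le> val w y" by (rule val_lower[OF y0 4(1)])
          also have "\<dots> = state_val p" using state_val_finite[OF O_V[OF 4(1)] y0] Pair 4 by simp
          finally have "ennreal t \<le> Val p" by (rule ennreal_leI)
          then show ?thesis using Pair 4 by (simp add: add_increasing2)
        next
          case 5
          then show ?thesis using Pair by simp
        qed
      qed
      note g = measurable_bounded_open[of L]
      have A: "indicator {p. snd p \<in> insert r O\<^sub>p} \<in> borel_measurable (game_space :: (ennreal \<times> 'v) measure)"
        by (rule borel_measurable_indicator[OF sets_snd])
      have "ennreal (?m * t) \<le> ennreal t * ennreal (measure law (alive k))"
        using mean_pay_upper[of k] t m0 by (simp add: ennreal_mult[symmetric] mult.commute ennreal_leI mult_left_mono)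
      also have "\<dots> = MC.E k (\<lambda>p. ennreal t * indicator {p. snd p \<in> insert r O\<^sub>p} p)"
        unfolding E_alive[symmetric] by (intro nn_integral_cmult[symmetric] MC.measurable_coord[OF A])
      also have "\<dots> \<le> MC.E k (\<lambda>p. Val p + ?g p)" by (intro nn_integral_mono pt)
      also have "\<dots> = MC.E k (\<lambda>p. Val p) + MC.E k ?g"
        by (intro nn_integral_add MC.measurable_coord[OF measurable_Val] MC.measurable_coord[OF g])
      also have "\<dots> \<le> ennreal e + ennreal \<eta>" using upper_mono[OF k(1)] k(2) e(2) by (intro add_mono) auto
      also have "\<dots> = ennreal (e + \<eta>)" using e \<eta> by simp
      finally show ?thesis using e(1) \<eta> by (subst (asm) ennreal_le_iff) auto
    qed
    then have "?m * t \<le> e" by (rule field_le_epsilon)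
    then show ?thesis by (simp only: t_def)
  qed
  have "((\<lambda>L::real. ?m * (L / (1 + L)) ^ card V) \<longlongrightarrow> ?m * 1 ^ card V) at_top"
  proof (intro tendsto_intros)
    have "((\<lambda>L::real. 1 - 1 / (1 + L)) \<longlongrightarrow> 1 - 0) at_top"
      by (intro tendsto_intros tendsto_divide_0[OF tendsto_const] filterlim_at_top_imp_at_infinity
          filterlim_tendsto_add_at_top[OF tendsto_const filterlim_ident])
    moreover have "\<forall>\<^sub>F L::real in at_top. 1 - 1 / (1 + L) = L / (1 + L)"
      using eventually_gt_at_top[of 0] by (rule eventually_mono) (simp add: field_simps)
    ultimately show "((\<lambda>L::real. L / (1 + L)) \<longlongrightarrow> 1) at_top"
      using tendsto_cong by fastforce
  qed
  moreover have "\<forall>\<^sub>F L in at_top. ?m * (L / (1 + L)) ^ card V \<le> e"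
    using eventually_gt_at_top[of 0] by (rule eventually_mono) (rule main)
  ultimately have "?m * 1 ^ card V \<le> e" by (rule tendsto_upperbound) simp
  then show ?thesis unfolding e(2) by (simp add: ennreal_leI)
qed

end
end

section \<open>Nash equilibria and the processes \<open>X\<^sub>\<theta>\<close>\<close>

lemma (in equilibrium) theta_markov:
  "markov_chain (count_space UNIV) v (theta_kernel T \<epsilon> lam \<theta>)"
  by standard (auto simp: theta_kernel_def space_prob_algebra prob_space_measure_pmf)

context play_from
begin

text \<open>The mean value decreases from the value of the game at time zero and always stays above the
  payment. If these two agree, it is constant, and the supermartingale inequality is an
  equality at almost every state reached, in particular at every state that is reached with positive
  probability.\<close>

lemma upper_extremal:
  assumes Sm_eq: "Sm = mina_eq \<theta>" and \<theta>: "\<And>w i. w \<in> O\<^sub>p \<Longrightarrow> 1 \<le> i \<Longrightarrow> \<theta> w i \<in> V_minus T w"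
    and opt: "mean_pay T \<epsilon> lam v Sm Sp = val v lam" and lam0: "0 < lam"
    and w: "w \<in> O\<^sub>p" and reach: "MC.E n (indicator {(ennreal lam, w)}) \<noteq> 0"
  shows "fst Sp lam w (Suc n) = return halfline (lam * share w lam) \<and> snd Sp (ennreal lam) w (Suc n) = parent T w"
proof -
  have E: "MC.E m (\<lambda>p. Val p) = ennreal (val v lam)" for m
    using upper_mono[OF Sm_eq \<theta>, of 0 m] upper_pay[OF Sm_eq \<theta>, of m] opt E_start_Val
    by (intro antisym) auto
  let ?h = "\<lambda>p. \<integral>\<^sup>+q. Val q \<partial>kern (Suc n) p"
  have h: "?h \<in> borel_measurable game_space"
    by (rule measurable_compose[OF MC.K_sub nn_integral_measurable_subprob_algebra[OF measurable_Val]])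
  have "AE \<omega> in law. ?h (\<omega> n) = Val (\<omega> n)"
  proof (rule nn_integral_eq_imp_AE_eq)
    show "AE \<omega> in law. ?h (\<omega> n) \<le> Val (\<omega> n)"
      by (intro AE_I2 upper_step[OF Sm_eq \<theta>]) auto
    have "MC.E n ?h = MC.E (Suc n) (\<lambda>p. Val p)" by (rule MC.expectation_step[OF measurable_Val, symmetric])
    then show "MC.E n ?h = MC.E n (\<lambda>p. Val p)" "MC.E n ?h \<noteq> \<infinity>" by (simp_all add: E)
  qed (rule MC.measurable_coord[OF h] MC.measurable_coord[OF measurable_Val])+
  moreover have "Val (ennreal lam, w) = ennreal (val w lam)" using state_val_finite[OF O_V[OF w] lam] by simp
  ultimately have "?h (ennreal lam, w) = ennreal (val w lam)"
  proof (rule_tac ccontr)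
    assume ae: "AE \<omega> in law. ?h (\<omega> n) = Val (\<omega> n)" and v: "Val (ennreal lam, w) = ennreal (val w lam)"
      and n: "?h (ennreal lam, w) \<noteq> ennreal (val w lam)"
    from ae have "AE \<omega> in law. indicator {(ennreal lam, w)} (\<omega> n) = (0 :: ennreal)"
      by (rule eventually_mono) (use v n in \<open>auto split: split_indicator\<close>)
    then have "MC.E n (indicator {(ennreal lam, w)}) = (\<integral>\<^sup>+\<omega>. 0 \<partial>law)"
      by (intro nn_integral_cong_AE) auto
    with reach show False by simp
  qed
  then show ?thesis using upper_turn(2)[OF Sm_eq \<theta> w _ lam lam0, of "Suc n"] by simp
qed

lemma lower_extremal:
  assumes Sp_eq: "Sp = maxine_eq"
    and opt: "mean_pay T \<epsilon> lam v Sm Sp = val v lam" and lam0: "0 < lam"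
    and w: "w \<in> O\<^sub>p" and reach: "MC.E n (indicator {(ennreal lam, w)}) \<noteq> 0"
  shows "fst Sm lam w (Suc n) = return halfline (share w lam) \<and> snd Sm (ennreal lam) w (Suc n) \<in> V_minus T w"
proof -
  have E: "MC.E m (\<lambda>p. Val p) = ennreal (val v lam)" for m
    using lower_mono[OF Sp_eq, of 0 m] lower_pay[OF Sp_eq, of m] opt E_start_Val
    by (intro antisym) auto
  let ?h = "\<lambda>p. \<integral>\<^sup>+q. Val q \<partial>kern (Suc n) p"
  have h: "?h \<in> borel_measurable game_space"
    by (rule measurable_compose[OF MC.K_sub nn_integral_measurable_subprob_algebra[OF measurable_Val]])
  have ae: "AE \<omega> in law. Val (\<omega> n) = ?h (\<omega> n)"
  proof (rule nn_integral_eq_imp_AE_eq)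
    show "AE \<omega> in law. Val (\<omega> n) \<le> ?h (\<omega> n)"
      by (intro AE_I2 lower_step[OF Sp_eq]) auto
    have "MC.E n ?h = MC.E (Suc n) (\<lambda>p. Val p)" by (rule MC.expectation_step[OF measurable_Val, symmetric])
    then show "MC.E n (\<lambda>p. Val p) = MC.E n ?h" "MC.E n (\<lambda>p. Val p) \<noteq> \<infinity>" by (simp_all add: E)
  qed (rule MC.measurable_coord[OF h] MC.measurable_coord[OF measurable_Val])+
  have v: "Val (ennreal lam, w) = ennreal (val w lam)" using state_val_finite[OF O_V[OF w] lam] by simp
  have "?h (ennreal lam, w) = ennreal (val w lam)"
  proof (rule ccontr)
    assume n: "?h (ennreal lam, w) \<noteq> ennreal (val w lam)"
    from ae have "AE \<omega> in law. indicator {(ennreal lam, w)} (\<omega> n) = (0 :: ennreal)"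
      by (rule eventually_mono) (use v n in \<open>auto split: split_indicator\<close>)
    then have "MC.E n (indicator {(ennreal lam, w)}) = (\<integral>\<^sup>+\<omega>. 0 \<partial>law)"
      by (intro nn_integral_cong_AE) auto
    with reach show False by simp
  qed
  then show ?thesis using lower_turn(2)[OF Sp_eq w _ lam lam0, of "Suc n"] by simp
qed

text \<open>From fortune \<open>lam\<close> at vertex \<open>w\<close>, turn \<open>k + 1\<close> leaves the fortune unchanged and moves the counter
  as \<open>X\<^sub>\<theta>\<close> does. The equality of integrals says this without a comparison of \<open>\<sigma>\<close>-algebras.\<close>

definition turn_agrees :: "(real \<Rightarrow> 'v \<Rightarrow> nat \<Rightarrow> 'v) \<Rightarrow> nat \<Rightarrow> 'v \<Rightarrow> bool" where
  "turn_agrees \<theta> k w \<longleftrightarrow> (\<forall>f\<in>borel_measurable game_space.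
     (\<integral>\<^sup>+p. f p \<partial>kern (Suc k) (ennreal lam, w)) = (\<integral>\<^sup>+y. f (ennreal lam, y) \<partial>theta_kernel T \<epsilon> lam \<theta> k w))"

lemma turn_agreesI:
  assumes w: "w \<in> O\<^sub>p" and lam0: "0 < lam"
    and Sp: "fst Sp lam w (Suc k) = return halfline (lam * share w lam)" "snd Sp (ennreal lam) w (Suc k) = parent T w"
    and Sm: "fst Sm lam w (Suc k) = return halfline (share w lam)" "snd Sm (ennreal lam) w (Suc k) = \<theta> lam w k"
  shows "turn_agrees \<theta> k w"
  unfolding turn_agrees_def
proof
  fix f :: "ennreal \<times> 'v \<Rightarrow> ennreal" assume f: "f \<in> borel_measurable game_space"
  have s: "0 \<le> share w lam" "0 \<le> lam * share w lam" using share_bounds[OF w lam] lam by auto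
  have "(\<integral>\<^sup>+p. f p \<partial>kern (Suc k) (ennreal lam, w)) = (\<integral>\<^sup>+a. turn_mean f w (Suc k) lam a (share w lam) \<partial>fst Sp lam w (Suc k))"
    by (rule mina_turn_integral[OF f w _ lam Sm(1) s(1)]) simp
  also have "\<dots> = turn_mean f w (Suc k) lam (lam * share w lam) (share w lam)"
    unfolding Sp(1) using measurable_turn_mean_stakes(1)[OF f w] s
    by (intro nn_integral_return) (auto simp: space_halfline)
  also have "\<dots> = ennreal (1 - \<epsilon>) * f (ennreal lam, w) + ennreal \<epsilon> * (ennreal (lam / (1 + lam)) * f (ennreal lam, parent T w)
      + ennreal (1 - lam / (1 + lam)) * f (ennreal lam, \<theta> lam w k))"
    unfolding turn_mean_def Let_def equilibrium_turn[OF w lam0] Sp(2) Sm(2) ..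
  also have "\<dots> = (\<integral>\<^sup>+y. f (ennreal lam, y) \<partial>theta_kernel T \<epsilon> lam \<theta> k w)"
    using w eps eps_1 lam by (simp add: theta_kernel_def nn_integral_turn_pmf divide_le_eq_1)
  finally show "(\<integral>\<^sup>+p. f p \<partial>kern (Suc k) (ennreal lam, w)) = (\<integral>\<^sup>+y. f (ennreal lam, y) \<partial>theta_kernel T \<epsilon> lam \<theta> k w)" .
qed

lemma turn_agrees_closed: "w \<notin> O\<^sub>p \<Longrightarrow> turn_agrees \<theta> k w"
  by (simp add: turn_agrees_def nn_integral_kern_closed theta_kernel_def nn_integral_return_pmf)

abbreviation "reached \<theta> k w \<equiv> (\<integral>\<^sup>+X. indicator {w} (X k) \<partial>theta_law T \<epsilon> lam v \<theta>) \<noteq> 0"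

text \<open>Induction on time, where the induction step replaces \<open>f\<close> by its mean after one more turn; this is why
  \<open>f\<close> may depend on the fortune. The vertices that \<open>X\<^sub>\<theta>\<close> does not reach
  carry no mass.\<close>

lemma joint_law:
  assumes "\<And>k w. k < n \<Longrightarrow> w \<in> O\<^sub>p \<Longrightarrow> reached \<theta> k w \<Longrightarrow> turn_agrees \<theta> k w"
    and f: "f \<in> borel_measurable game_space"
  shows "(\<integral>\<^sup>+\<omega>. indicator {\<omega>. \<forall>i\<le>n. pos \<omega> i \<in> A i} \<omega> * f (\<omega> n) \<partial>law) =
    (\<integral>\<^sup>+X. indicator {X. \<forall>i\<le>n. X i \<in> A i} X * f (ennreal lam, X n) \<partial>theta_law T \<epsilon> lam v \<theta>)"
  using assms
proof (induction n arbitrary: f)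
  case 0
  interpret TH: markov_chain "count_space UNIV" v "theta_kernel T \<epsilon> lam \<theta>" by (rule theta_markov)
  have ind: "indicator {p. snd p \<in> A 0} \<in> borel_measurable (game_space :: (ennreal \<times> 'v) measure)"
    by (rule borel_measurable_indicator[OF sets_snd])
  have "(\<lambda>p. indicator {p. snd p \<in> A 0} p * f p) \<in> borel_measurable game_space"
    by (intro borel_measurable_times_ennreal ind 0)
  from MC.nn_integral_start[OF this]
  have "(\<integral>\<^sup>+\<omega>. indicator {p. snd p \<in> A 0} (\<omega> 0) * f (\<omega> 0) \<partial>law) = indicator (A 0) v * f (ennreal lam, v)"
    by (simp add: indicator_def)
  moreover have "(\<integral>\<^sup>+X. indicator (A 0) (X 0) * f (ennreal lam, X 0) \<partial>TH.law) = indicator (A 0) v * f (ennreal lam, v)"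
    using TH.nn_integral_start[of "\<lambda>x. indicator (A 0) x * f (ennreal lam, x)"] by simp
  ultimately show ?case by (simp add: indicator_def theta_law_def)
next
  case (Suc n)
  interpret TH: markov_chain "count_space UNIV" v "theta_kernel T \<epsilon> lam \<theta>" by (rule theta_markov)
  let ?F = "\<lambda>p. indicator {p. snd p \<in> A (Suc n)} p * f p"
  let ?F' = "\<lambda>y. ?F (ennreal lam, y)"
  let ?h = "\<lambda>p. \<integral>\<^sup>+q. ?F q \<partial>kern (Suc n) p"
  let ?G = "\<lambda>\<omega>. indicator {\<omega>. \<forall>i\<le>n. pos \<omega> i \<in> A i} \<omega> :: ennreal"
  let ?G' = "\<lambda>X. indicator {X. \<forall>i\<le>n. X i \<in> A i} X :: ennreal"
  have ind: "indicator {p. snd p \<in> A (Suc n)} \<in> borel_measurable (game_space :: (ennreal \<times> 'v) measure)"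
    by (rule borel_measurable_indicator[OF sets_snd])
  have F: "?F \<in> borel_measurable game_space"
    by (intro borel_measurable_times_ennreal ind Suc.prems)
  have h: "?h \<in> borel_measurable game_space"
    by (rule measurable_compose[OF MC.K_sub nn_integral_measurable_subprob_algebra[OF F]])
  have pr: "Measurable.pred (Pi\<^sub>M {0..<Suc n} (\<lambda>_. game_space)) (\<lambda>\<omega>. \<forall>i\<in>{..n}. pos \<omega> i \<in> A i)"
    by (intro pred_intros_finite measurable_coordinate measurable_snd_pred) auto
  have G: "(\<lambda>\<omega>. if \<forall>i\<in>{..n}. pos \<omega> i \<in> A i then 1 else 0 :: ennreal) \<in> borel_measurable (Pi\<^sub>M {0..<Suc n} (\<lambda>_. game_space))"
    using pr by (intro measurable_If) (auto simp: pred_def)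
  have pr': "Measurable.pred (Pi\<^sub>M {0..<Suc n} (\<lambda>_. count_space UNIV)) (\<lambda>X. \<forall>i\<in>{..n}. X i \<in> A i)"
    by (intro pred_intros_finite measurable_coordinate[where f = "\<lambda>x. x \<in> A i" for i]) auto
  have G': "(\<lambda>X. if \<forall>i\<in>{..n}. X i \<in> A i then 1 else 0 :: ennreal) \<in> borel_measurable (Pi\<^sub>M {0..<Suc n} (\<lambda>_. count_space UNIV))"
    using pr' by (intro measurable_If) (auto simp: pred_def)
  have "(\<integral>\<^sup>+\<omega>. indicator {\<omega>. \<forall>i\<le>Suc n. pos \<omega> i \<in> A i} \<omega> * f (\<omega> (Suc n)) \<partial>law)
      = (\<integral>\<^sup>+\<omega>. (if \<forall>i\<in>{..n}. pos (restrict \<omega> {0..<Suc n}) i \<in> A i then 1 else 0) * ?F (\<omega> (Suc n)) \<partial>law)"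
    by (intro nn_integral_cong) (auto simp: indicator_def le_Suc_eq)
  also have "\<dots> = (\<integral>\<^sup>+\<omega>. (if \<forall>i\<in>{..n}. pos (restrict \<omega> {0..<Suc n}) i \<in> A i then 1 else 0) * ?h (\<omega> n) \<partial>law)"
    by (rule MC.nn_integral_step[OF G F])
  also have "\<dots> = (\<integral>\<^sup>+\<omega>. ?G \<omega> * ?h (\<omega> n) \<partial>law)"
    by (intro nn_integral_cong) (auto simp: indicator_def)
  also have "\<dots> = (\<integral>\<^sup>+X. ?G' X * ?h (ennreal lam, X n) \<partial>theta_law T \<epsilon> lam v \<theta>)"
    by (rule Suc.IH[OF _ h]) (use Suc.prems(1) in auto)
  also have "\<dots> = (\<integral>\<^sup>+X. ?G' X * (\<integral>\<^sup>+y. ?F' y \<partial>theta_kernel T \<epsilon> lam \<theta> n (X n)) \<partial>theta_law T \<epsilon> lam v \<theta>)"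
  proof (rule nn_integral_cong_AE)
    have "AE X in theta_law T \<epsilon> lam v \<theta>. \<forall>w\<in>O\<^sub>p. X n = w \<longrightarrow> reached \<theta> n w"
    proof (intro AE_finite_allI finite_open)
      fix w
      show "AE X in theta_law T \<epsilon> lam v \<theta>. X n = w \<longrightarrow> reached \<theta> n w"
      proof (cases "reached \<theta> n w")
        case False
        then have "AE X in theta_law T \<epsilon> lam v \<theta>. indicator {w} (X n) = (0::ennreal)"
          unfolding theta_law_def
          by (subst (asm) nn_integral_0_iff_AE) (auto intro: TH.measurable_coord)
        then show ?thesis by (rule eventually_mono) (auto split: split_indicator_asm)
      qed simp
    qed
    then show "AE X in theta_law T \<epsilon> lam v \<theta>. ?G' X * ?h (ennreal lam, X n) =
        ?G' X * (\<integral>\<^sup>+y. ?F' y \<partial>theta_kernel T \<epsilon> lam \<theta> n (X n))"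
    proof eventually_elim
      case (elim X)
      then have "turn_agrees \<theta> n (X n)" using turn_agrees_closed Suc.prems(1)[of n "X n"] by (cases "X n \<in> O\<^sub>p") auto
      from this[unfolded turn_agrees_def, rule_format, OF F] show ?case by (simp only:)
    qed
  qed
  also have "\<dots> = (\<integral>\<^sup>+X. (if \<forall>i\<in>{..n}. restrict X {0..<Suc n} i \<in> A i then 1 else 0) * (\<integral>\<^sup>+y. ?F' y \<partial>theta_kernel T \<epsilon> lam \<theta> n (X n)) \<partial>TH.law)"
    unfolding theta_law_def by (intro nn_integral_cong) (auto simp: indicator_def)
  also have "\<dots> = (\<integral>\<^sup>+X. (if \<forall>i\<in>{..n}. restrict X {0..<Suc n} i \<in> A i then 1 else 0) * ?F' (X (Suc n)) \<partial>TH.law)"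
    by (rule TH.nn_integral_step[OF G', symmetric]) simp
  also have "\<dots> = (\<integral>\<^sup>+X. indicator {X. \<forall>i\<le>Suc n. X i \<in> A i} X * f (ennreal lam, X (Suc n)) \<partial>theta_law T \<epsilon> lam v \<theta>)"
    unfolding theta_law_def by (intro nn_integral_cong) (auto simp: indicator_def le_Suc_eq)
  finally show ?case .
qed

lemma marginal_law:
  assumes "\<And>k w. k < n \<Longrightarrow> w \<in> O\<^sub>p \<Longrightarrow> reached \<theta> k w \<Longrightarrow> turn_agrees \<theta> k w"
  shows "MC.E n (indicator {(ennreal lam, w)}) = (\<integral>\<^sup>+X. indicator {w} (X n) \<partial>theta_law T \<epsilon> lam v \<theta>)"
proof -
  have "{ennreal lam} \<times> {w} \<in> sets game_space" unfolding game_space_def by (intro pair_measureI) auto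
  then have f: "indicator {(ennreal lam, w)} \<in> borel_measurable game_space" by simp
  show ?thesis
    using joint_law[OF assms f, where A = "\<lambda>_. UNIV"] by (simp add: indicator_def)
qed

lemma gameplay_eq:
  assumes turn_agrees: "\<And>k w. w \<in> O\<^sub>p \<Longrightarrow> reached \<theta> k w \<Longrightarrow> turn_agrees \<theta> k w"
  shows "gameplay_law T \<epsilon> lam v Sm Sp = theta_law T \<epsilon> lam v \<theta>"
proof -
  interpret TH: markov_chain "count_space UNIV" v "theta_kernel T \<epsilon> lam \<theta>" by (rule theta_markov)
  let ?P = "gameplay_law T \<epsilon> lam v Sm Sp" and ?Q = "theta_law T \<epsilon> lam v \<theta>"
  let ?M = "\<lambda>_::nat. count_space UNIV :: 'v measure"
  have sP: "sets ?P = sets (Pi\<^sub>M UNIV ?M)" by (simp add: gameplay_law_def)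
  have sQ: "sets ?Q = sets (Pi\<^sub>M UNIV ?M)" by (simp add: theta_law_def TH.sets_law)
  show ?thesis
  proof (rule measure_eqI_PiM_infinite[OF sP sQ])
    show "finite_measure ?P"
      unfolding gameplay_law_def game_law_eq
      by (intro prob_space.finite_measure prob_space.prob_space_distr MC.prob_law measurable_pos)
    fix A :: "nat \<Rightarrow> 'v set" and J :: "nat set" assume J: "finite J"
    define n where "n = Max (insert 0 J)"
    define A' where "A' i = (if i \<in> J then A i else UNIV)" for i
    have Jn: "i \<le> n" if "i \<in> J" for i using J that by (simp add: n_def)
    let ?C = "prod_emb UNIV ?M J (Pi\<^sub>E J A)"
    have C: "?C = {X. \<forall>i\<le>n. X i \<in> A' i}"
      using Jn by (auto simp: prod_emb_def A'_def)
    have sC: "?C \<in> sets (Pi\<^sub>M UNIV ?M)" using J by (intro sets_PiM_I) auto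
    have "emeasure ?P ?C = (\<integral>\<^sup>+X. indicator ?C X \<partial>?P)" using sC sP by simp
    also have "\<dots> = (\<integral>\<^sup>+\<omega>. indicator ?C (\<lambda>k. pos \<omega> k) \<partial>law)"
      unfolding gameplay_law_def game_law_eq using sC by (intro nn_integral_distr measurable_pos) simp
    also have "\<dots> = (\<integral>\<^sup>+\<omega>. indicator {\<omega>. \<forall>i\<le>n. pos \<omega> i \<in> A' i} \<omega> * 1 \<partial>law)"
      unfolding C by (intro nn_integral_cong) (simp add: indicator_def)
    also have "\<dots> = (\<integral>\<^sup>+X. indicator {X. \<forall>i\<le>n. X i \<in> A' i} X * 1 \<partial>?Q)"
      by (rule joint_law[where f = "\<lambda>_. 1", OF turn_agrees]) auto
    also have "\<dots> = (\<integral>\<^sup>+X. indicator ?C X \<partial>?Q)" unfolding C by simp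
    also have "\<dots> = emeasure ?Q ?C" using sC sQ by simp
    finally show "emeasure ?P ?C = emeasure ?Q ?C" .
  qed
qed

end

context equilibrium
begin

lemma play_fromI:
  "Sm \<in> mina_strategies T \<Longrightarrow> Sp \<in> maxine_strategies T \<Longrightarrow> 0 \<le> lam \<Longrightarrow> v \<in> O\<^sub>p \<Longrightarrow> play_from T \<epsilon> Sm Sp lam v"
  by unfold_locales auto

lemma mina_guarantee:
  assumes \<theta>: "\<And>w i. w \<in> O\<^sub>p \<Longrightarrow> 1 \<le> i \<Longrightarrow> \<theta> w i \<in> V_minus T w"
    and Sp: "Sp \<in> maxine_strategies T" and lv: "0 \<le> lam" "v \<in> O\<^sub>p"
  shows "mean_pay T \<epsilon> lam v (mina_eq \<theta>) Sp \<le> val v lam"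
proof -
  interpret play_from T \<epsilon> "mina_eq \<theta>" Sp lam v by (rule play_fromI[OF mina_eq_strategy[OF \<theta>] Sp lv])
  show ?thesis using upper_pay[OF refl \<theta>, of 0] E_start_Val val_nonneg[OF lv(1), of v] by simp
qed

lemma maxine_guarantee:
  assumes Sm: "Sm \<in> mina_strategies T" and lv: "0 \<le> lam" "v \<in> O\<^sub>p"
  shows "val v lam \<le> mean_pay T \<epsilon> lam v Sm maxine_eq"
proof -
  interpret play_from T \<epsilon> Sm maxine_eq lam v by (rule play_fromI[OF Sm maxine_eq_strategy lv])
  have "0 \<le> mean_pay T \<epsilon> lam v Sm maxine_eq" by (simp add: mean_pay_eq)
  then show ?thesis using lower_pay[OF refl, of 0] E_start_Val by simp
qed

lemma equilibrium_nash:
  assumes \<theta>: "\<And>w i. w \<in> O\<^sub>p \<Longrightarrow> 1 \<le> i \<Longrightarrow> \<theta> w i \<in> V_minus T w"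
  shows "nash_equilibrium T \<epsilon> (mina_eq \<theta>) maxine_eq"
proof -
  have M: "mina_eq \<theta> \<in> mina_strategies T" by (rule mina_eq_strategy[OF \<theta>])
  have G: "mean_pay T \<epsilon> lam v (mina_eq \<theta>) Sp \<le> val v lam"
    if "Sp \<in> maxine_strategies T" "0 \<le> lam" "v \<in> O\<^sub>p" for Sp lam v
    by (rule mina_guarantee[OF \<theta> that])
  have "mean_pay T \<epsilon> lam v (mina_eq \<theta>) maxine_eq = val v lam" if "0 \<le> lam" "v \<in> O\<^sub>p" for lam v
    using G[OF maxine_eq_strategy that] maxine_guarantee[OF M that] by simp
  then show ?thesis
    unfolding nash_equilibrium_def using M maxine_eq_strategy G maxine_guarantee by simp
qed

text \<open>The mean payment of the equilibrium lies between the two payments in question, of which the first is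
  at most the value and the second at least the value.\<close>

lemma nash_value:
  assumes N: "nash_equilibrium T \<epsilon> Sm Sp" and lv: "0 \<le> lam" "v \<in> O\<^sub>p"
    and \<theta>: "\<And>w i. w \<in> O\<^sub>p \<Longrightarrow> 1 \<le> i \<Longrightarrow> \<theta> w i \<in> V_minus T w"
  shows "mean_pay T \<epsilon> lam v (mina_eq \<theta>) Sp = val v lam" "mean_pay T \<epsilon> lam v Sm maxine_eq = val v lam"
proof -
  have S: "Sm \<in> mina_strategies T" "Sp \<in> maxine_strategies T" using N by (auto simp: nash_equilibrium_def)
  have M: "mina_eq \<theta> \<in> mina_strategies T" by (rule mina_eq_strategy[OF \<theta>])
  have G: "mean_pay T \<epsilon> lam v (mina_eq \<theta>) Sp \<le> val v lam"
    by (rule mina_guarantee[OF \<theta> S(2) lv])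
  have "mean_pay T \<epsilon> lam v Sm Sp \<le> mean_pay T \<epsilon> lam v (mina_eq \<theta>) Sp"
    "mean_pay T \<epsilon> lam v Sm maxine_eq \<le> mean_pay T \<epsilon> lam v Sm Sp"
    using N lv M maxine_eq_strategy unfolding nash_equilibrium_def by blast+
  with G maxine_guarantee[OF S(1) lv]
  show "mean_pay T \<epsilon> lam v (mina_eq \<theta>) Sp = val v lam" "mean_pay T \<epsilon> lam v Sm maxine_eq = val v lam" by auto
qed

text \<open>Mina can use \<open>\<theta> lam\<close> as her move map, whatever the fortune.\<close>

lemma theta_is_gameplay:
  assumes \<theta>: "\<theta> \<in> Theta T" and lam0: "0 < lam" and v: "v \<in> O\<^sub>p"
  shows "\<exists>Sm Sp. theta_law T \<epsilon> lam v \<theta> = gameplay_law T \<epsilon> lam v Sm Sp \<and> nash_equilibrium T \<epsilon> Sm Sp"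
proof -
  \<comment> \<open>turn i begins at time i - 1\<close>
  define \<phi> where "\<phi> w i = \<theta> lam w (i - 1)" for w and i :: nat
  have \<phi>: "\<phi> w i \<in> V_minus T w" if "w \<in> O\<^sub>p" "1 \<le> i" for w i
    using \<theta> lam0 that by (simp add: \<phi>_def Theta_def)
  have lam': "0 \<le> lam" using lam0 by simp
  interpret play_from T \<epsilon> "mina_eq \<phi>" maxine_eq lam v
    by (rule play_fromI[OF mina_eq_strategy[OF \<phi>] maxine_eq_strategy lam' v])
  have "gameplay_law T \<epsilon> lam v (mina_eq \<phi>) maxine_eq = theta_law T \<epsilon> lam v \<theta>"
    using lam0 by (intro gameplay_eq turn_agreesI) (auto simp: mina_eq_def maxine_eq_def \<phi>_def)
  moreover have "nash_equilibrium T \<epsilon> (mina_eq \<phi>) maxine_eq" by (rule equilibrium_nash[OF \<phi>])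
  ultimately show ?thesis by metis
qed

text \<open>Induction on time. If both players have played as claimed at all vertices reached before
  time \<open>n\<close>, then \<open>X\<^sub>\<theta>\<close> and the two games in which one of the players is replaced by an
  equilibrium player have the same law up to time \<open>n\<close>. The vertices that \<open>X\<^sub>\<theta>\<close> reaches at
  time \<open>n\<close> are therefore reached in these games, and extremality fixes the play of the other
  player there.\<close>

lemma gameplay_is_theta:
  assumes N: "nash_equilibrium T \<epsilon> Sm Sp" and lam: "0 < lam" and v: "v \<in> O\<^sub>p"
  shows "\<exists>\<theta>\<in>Theta T. gameplay_law T \<epsilon> lam v Sm Sp = theta_law T \<epsilon> lam v \<theta>"
proof -
  have S: "Sm \<in> mina_strategies T" "Sp \<in> maxine_strategies T" using N by (auto simp: nash_equilibrium_def)
  have lam': "0 \<le> lam" using lam by simp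
  \<comment> \<open>Mina's moves, corrected where no play leads and they may lie outside V_minus\<close>
  define \<phi> where "\<phi> w i = (if snd Sm (ennreal lam) w i \<in> V_minus T w then snd Sm (ennreal lam) w i
    else (SOME u. u \<in> V_minus T w))" for w i
  have \<phi>: "\<phi> w i \<in> V_minus T w" if "w \<in> O\<^sub>p" "1 \<le> i" for w i
    using V_minus_ne[OF that(1)] by (auto simp: \<phi>_def some_in_eq)
  define \<theta> where "\<theta> l w k = \<phi> w (Suc k)" for l :: real and w k
  have \<theta>: "\<theta> \<in> Theta T" using \<phi> by (simp add: Theta_def \<theta>_def)
  interpret A: play_from T \<epsilon> "mina_eq \<phi>" Sp lam v
    by (rule play_fromI[OF mina_eq_strategy[OF \<phi>] S(2) lam' v])
  interpret B: play_from T \<epsilon> Sm maxine_eq lam v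
    by (rule play_fromI[OF S(1) maxine_eq_strategy lam' v])
  interpret C: play_from T \<epsilon> Sm Sp lam v
    by (rule play_fromI[OF S lam' v])
  have key: "(fst Sp lam w (Suc n) = return halfline (lam * share w lam) \<and> snd Sp (ennreal lam) w (Suc n) = parent T w)
      \<and> (fst Sm lam w (Suc n) = return halfline (share w lam) \<and> snd Sm (ennreal lam) w (Suc n) = \<theta> lam w n)"
    if "w \<in> O\<^sub>p" "C.reached \<theta> n w" for n w
    using that
  proof (induction n arbitrary: w rule: less_induct)
    case (less n)
    have gA: "A.turn_agrees \<theta> k u" if "k < n" "u \<in> O\<^sub>p" "C.reached \<theta> k u" for k u
      using less.IH[OF that] that lam by (intro A.turn_agreesI) (auto simp: mina_eq_def \<theta>_def)
    have gB: "B.turn_agrees \<theta> k u" if "k < n" "u \<in> O\<^sub>p" "C.reached \<theta> k u" for k u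
      using less.IH[OF that] that lam by (intro B.turn_agreesI) (auto simp: maxine_eq_def)
    have rA: "A.MC.E n (indicator {(ennreal lam, w)}) \<noteq> 0"
      using A.marginal_law[of n \<theta> w, OF gA] less.prems by simp
    have rB: "B.MC.E n (indicator {(ennreal lam, w)}) \<noteq> 0"
      using B.marginal_law[of n \<theta> w, OF gB] less.prems by simp
    have "fst Sp lam w (Suc n) = return halfline (lam * share w lam) \<and> snd Sp (ennreal lam) w (Suc n) = parent T w"
      using nash_value(1)[OF N lam' v, of \<phi>] \<phi> lam less.prems(1) rA
      by (intro A.upper_extremal[OF refl]) blast+
    moreover have "fst Sm lam w (Suc n) = return halfline (share w lam) \<and> snd Sm (ennreal lam) w (Suc n) \<in> V_minus T w"
      using nash_value(2)[OF N lam' v, of \<phi>] \<phi> lam less.prems(1) rB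
      by (intro B.lower_extremal[OF refl]) blast+
    ultimately show ?case by (simp add: \<theta>_def \<phi>_def)
  qed
  have "gameplay_law T \<epsilon> lam v Sm Sp = theta_law T \<epsilon> lam v \<theta>"
    using key lam by (intro C.gameplay_eq C.turn_agreesI) auto
  with \<theta> show ?thesis by blast
qed

end

text \<open>There are at least two leaves, so that the exponent is at most \<open>-5\<close>.\<close>

lemma (in reward_tree) threshold_bounds:
  defines "\<epsilon>\<^sub>0 \<equiv> real (card V) powr (- 2 * real (card B) - 1) / 4"
  shows "\<epsilon>\<^sub>0 \<in> {0<..<1}" and "\<epsilon> < \<epsilon>\<^sub>0 \<Longrightarrow> 4 * \<epsilon> * real (card V) ^ 5 \<le> 1"
proof -
  let ?n = "real (card V)"
  have n: "1 \<le> ?n" using card_V by simp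
  have "?n powr (- 2 * real (card B) - 1) \<le> ?n powr (- 5)"
    using n card_B by (intro powr_mono) auto
  also have "?n powr (- 5) = 1 / ?n ^ 5" using n by (simp add: powr_minus divide_inverse)
  finally have le: "4 * \<epsilon>\<^sub>0 \<le> 1 / ?n ^ 5" by (simp add: \<epsilon>\<^sub>0_def)
  also have "\<dots> \<le> 1" using n by simp
  finally show "\<epsilon>\<^sub>0 \<in> {0<..<1}" using n by (simp add: \<epsilon>\<^sub>0_def)
  show "4 * \<epsilon> * ?n ^ 5 \<le> 1" if "\<epsilon> < \<epsilon>\<^sub>0"
  proof -
    have "4 * \<epsilon> \<le> 1 / ?n ^ 5" using le that by simp
    then show ?thesis using n by (simp add: field_simps)
  qed
qed

theorem corollary1p16:
  fixes T :: "'v rooted_graph"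
  assumes "root_reward_tree T"
  shows "let \<epsilon>\<^sub>0 = real (card (verts T)) powr (- 2 * real (card (boundary T)) - 1) / 4 in
    \<epsilon>\<^sub>0 \<in> {0<..<1} \<and>
    (\<forall>\<epsilon>\<in>{0<..<\<epsilon>\<^sub>0}. \<forall>lam>0. \<forall>v\<in>open_play T.
       {gameplay_law T \<epsilon> lam v Sm Sp | Sm Sp. nash_equilibrium T \<epsilon> Sm Sp} =
       {theta_law T \<epsilon> lam v \<theta> | \<theta>. \<theta> \<in> Theta T})"
proof -
  interpret reward_tree T by standard (rule assms)
  show ?thesis
    unfolding Let_def
  proof (intro conjI ballI allI impI threshold_bounds(1))
    fix \<epsilon> lam :: real and v
    assume e: "\<epsilon> \<in> {0<..<real (card (verts T)) powr (- 2 * real (card (boundary T)) - 1) / 4}"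
      and lam: "0 < lam" and v: "v \<in> open_play T"
    interpret equilibrium T \<epsilon>
      by standard (use e threshold_bounds(2)[of \<epsilon>] in auto)
    show "{gameplay_law T \<epsilon> lam v Sm Sp | Sm Sp. nash_equilibrium T \<epsilon> Sm Sp} =
       {theta_law T \<epsilon> lam v \<theta> | \<theta>. \<theta> \<in> Theta T}"
      using gameplay_is_theta[OF _ lam v] theta_is_gameplay[OF _ lam v] by blast
  qed
qed

end
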